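(* For $\xi\in\mathbb R$ let $$\tilde P(\xi):=\begin{pmatrix}1&-\frac{2i\xi}{1+4\xi^2}\\ \frac{2i\xi}{1+4\xi^2}&1\end{pmatrix},\qquad \tilde\mu(\xi):=\frac12\left(1-\frac1{\sqrt{1+4\xi^2(1+4\xi^2)}}\right),$$ and for $y=(u,v)^\top$ with real-valued $u,v\in\mathrm L^2(\mathbb R)$ let $\mathsf H_3[y]=\mathsf H_3[u,v]:=\int_{\mathbb R}\hat y(\xi)^*\tilde P(\xi)\,\hat y(\xi)\,d\xi$. a) For $u,v\in\mathrm L^2(\mathbb R)$, the functional $\mathsf H_3$ can be expressed as $$\mathsf H_3[u,v]=\|u\|^2_{\mathrm L^2(\mathbb R)}+\|v\|^2_{\mathrm L^2(\mathbb R)}-4\int_{\mathbb R}u(x)\,\partial_x\big(1-4\partial_x^2\big)^{-1}v(x)\,dx .$$ b) Let $y:=(u,v)^\top\in C\big([0,\infty);(\mathrm L^2(\mathbb R))^2\big)$ be a mild real-valued solution to the Goldstein--Taylor equation with $\sigma=1$, $$\partial_tu=-\partial_xv,\qquad\partial_tv=-\partial_xu-v,\qquad x\in\mathbb R,\ t\ge0,$$ with initial datum $y_0=(u_0,v_0)^\top$, $u_0,v_0\in\mathrm L^1(\mathbb R)\cap\mathrm L^2(\mathbb R)$. Then the functional $\mathsf H_3$ yields the decay estimate: for all $t\ge0$, $$\|y(t)\|_{\mathrm L^2(\mathbb R)}^2\le\inf_{0<R\le\frac{\sqrt5-1}4}\left(\frac{1+2R+4R^2}{1-2R+4R^2}\,\min\Big\{2R,\sqrt{\frac{\pi}{2t}}\Big\}\|y_0\|_{\mathrm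 L^1(\mathbb R)}^2+3\,e^{-2\tilde\mu(R)t}\,\|y_0\|_{\mathrm L^2(\mathbb R)}^2\right).$$
   Context: $\hat y=(\hat u,\hat v)^\top$ is the Fourier transform in $x$, normalized so that Plancherel's identity reads $\|\hat u\|_{\mathrm L^2(d\xi)}=\|u\|_{\mathrm L^2(dx)}$, i.e. $\hat u(\xi)=(2\pi)^{-1/2}\int_{\mathbb R}e^{-ix\xi}u(x)\,dx$. The operator $\partial_x(1-4\partial_x^2)^{-1}$ is the Fourier multiplier with symbol $i\xi/(1+4\xi^2)$. For vector-valued $y$, $\|y\|_{\mathrm L^p(\mathbb R)}=\big(\int_{\mathbb R}|y(x)|^p\,dx\big)^{1/p}$ with $|\cdot|$ the Euclidean norm. "Mild solution" is in the sense of semigroup theory. At $t=0$, $\sqrt{\pi/(2t)}$ is read as $+\infty$. *)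

theory Defs
  imports "HOL-Analysis.Analysis"
begin

text \<open>
  Elements of the spaces \<open>L\<^sup>p(\<real>)\<close> are represented by Borel measurable functions, and
  equality in \<open>L\<^sup>p\<close> is equality almost everywhere. The norm on the type
  \<^typ>\<open>real \<times> real\<close> is the Euclidean one.
\<close>

definition mem_Lp :: "real \<Rightarrow> (real \<Rightarrow> 'a::real_normed_vector) \<Rightarrow> bool" where
  "mem_Lp p f \<longleftrightarrow> f \<in> borel_measurable lborel \<and> integrable lborel (\<lambda>x. norm (f x) powr p)"

definition Lp_norm :: "real \<Rightarrow> (real \<Rightarrow> 'a::real_normed_vector) \<Rightarrow> real" where
  "Lp_norm p f = (LINT x|lborel. norm (f x) powr p) powr (1 / p)"


definition fourier_int :: "(real \<Rightarrow> complex) \<Rightarrow> real \<Rightarrow> complex" where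
  "fourier_int f \<xi> = (LINT x|lborel. exp (- \<i> * of_real (x * \<xi>)) * f x) / of_real (sqrt (2 * pi))"

text \<open>
  The Fourier integral need not converge for \<open>f \<in> L\<^sup>2\<close>, so the transform is the \<open>L\<^sup>2\<close>-limit
  of the Fourier integrals of the truncations of \<open>f\<close>. The limit is unique almost everywhere and
  exists by Plancherel's theorem. The nonnegative integral is used since it is \<open>\<infinity>\<close>, and not
  \<open>0\<close>, if the difference is not square integrable.
\<close>

definition has_fourier :: "(real \<Rightarrow> complex) \<Rightarrow> (real \<Rightarrow> complex) \<Rightarrow> bool" where
  "has_fourier f g \<longleftrightarrow> mem_Lp 2 g \<and>
     ((\<lambda>r. \<integral>\<^sup>+\<xi>. ennreal ((cmod (fourier_int (\<lambda>x. indicator {-r..r} x * f x) \<xi> - g \<xi>))\<^sup>2) \<partial>lborel)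
        \<longlongrightarrow> 0) at_top"

definition fourier :: "(real \<Rightarrow> complex) \<Rightarrow> real \<Rightarrow> complex" where
  "fourier f = (SOME g. has_fourier f g)"

definition fourier_multiplier :: "(real \<Rightarrow> complex) \<Rightarrow> (real \<Rightarrow> complex) \<Rightarrow> real \<Rightarrow> complex" where
  "fourier_multiplier m f =
     (SOME g. mem_Lp 2 g \<and> (AE \<xi> in lborel. fourier g \<xi> = m \<xi> * fourier f \<xi>))"


definition P_tilde :: "real \<Rightarrow> complex ^ 2 ^ 2" where
  "P_tilde \<xi> = vector
     [vector [1, - (2 * \<i> * of_real \<xi> / of_real (1 + 4 * \<xi>\<^sup>2))],
      vector [2 * \<i> * of_real \<xi> / of_real (1 + 4 * \<xi>\<^sup>2), 1]]"

definition mu_tilde :: "real \<Rightarrow> real" where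
  "mu_tilde \<xi> = 1 / 2 * (1 - 1 / sqrt (1 + 4 * \<xi>\<^sup>2 * (1 + 4 * \<xi>\<^sup>2)))"

definition fourier_pair :: "(real \<Rightarrow> real) \<Rightarrow> (real \<Rightarrow> real) \<Rightarrow> real \<Rightarrow> complex ^ 2" where
  "fourier_pair u v \<xi> =
     vector [fourier (\<lambda>x. of_real (u x)) \<xi>, fourier (\<lambda>x. of_real (v x)) \<xi>]"

text \<open>
  The value is complex by type. It is real since \<^const>\<open>P_tilde\<close> is Hermitian.
\<close>

definition H3 :: "(real \<Rightarrow> real) \<Rightarrow> (real \<Rightarrow> real) \<Rightarrow> complex" where
  "H3 u v = (LINT \<xi>|lborel.
     (\<Sum>i\<in>UNIV. cnj (fourier_pair u v \<xi> $ i) * (P_tilde \<xi> *v fourier_pair u v \<xi>) $ i))"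


definition weak_deriv :: "(real \<Rightarrow> real) \<Rightarrow> (real \<Rightarrow> real) \<Rightarrow> bool" where
  "weak_deriv f g \<longleftrightarrow>
     (\<forall>\<phi>. \<phi> C1_differentiable_on UNIV \<and> compact (closure {x. \<phi> x \<noteq> 0}) \<longrightarrow>
        (LINT x|lborel. f x * deriv \<phi> x) = - (LINT x|lborel. g x * \<phi> x))"

text \<open>
  The graph of the unbounded operator \<open>A (u, v) = (- \<partial>\<^sub>x v, - \<partial>\<^sub>x u - v)\<close> on \<open>L\<^sup>2 \<times> L\<^sup>2\<close>
  with domain \<open>H\<^sup>1 \<times> H\<^sup>1\<close>.
\<close>

definition GT_generator :: "(real \<Rightarrow> real \<times> real) \<Rightarrow> (real \<Rightarrow> real \<times> real) \<Rightarrow> bool" where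
  "GT_generator w z \<longleftrightarrow> mem_Lp 2 w \<and>
     (\<exists>du dv. mem_Lp 2 du \<and> weak_deriv (\<lambda>x. fst (w x)) du \<and>
              mem_Lp 2 dv \<and> weak_deriv (\<lambda>x. snd (w x)) dv \<and>
              (AE x in lborel. z x = (- dv x, - du x - snd (w x))))"

text \<open>
  The Riemann integral over \<open>[a, b]\<close> of an \<open>L\<^sup>2\<close>-valued function \<open>y\<close>: this is
  \<^const>\<open>has_integral\<close> with constant gauges and with the \<open>L\<^sup>2\<close>-norm as the norm.
\<close>

definition has_L2_integral ::
  "(real \<Rightarrow> real \<Rightarrow> real \<times> real) \<Rightarrow> (real \<Rightarrow> real \<times> real) \<Rightarrow> real \<Rightarrow> real \<Rightarrow> bool" where
  "has_L2_integral y w a b \<longleftrightarrow> mem_Lp 2 w \<and>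
     (\<forall>\<epsilon>>0. \<exists>\<delta>>0. \<forall>D. D tagged_division_of {a..b} \<and> (\<lambda>s. ball s \<delta>) fine D \<longrightarrow>
        Lp_norm 2 (\<lambda>x. (\<Sum>(s, K)\<in>D. measure lborel K *\<^sub>R y s x) - w x) < \<epsilon>)"

definition continuous_L2 :: "(real \<Rightarrow> real \<Rightarrow> real \<times> real) \<Rightarrow> bool" where
  "continuous_L2 y \<longleftrightarrow> (\<forall>t\<ge>0. mem_Lp 2 (y t)) \<and>
     (\<forall>t\<ge>0. ((\<lambda>s. Lp_norm 2 (\<lambda>x. y s x - y t x)) \<longlongrightarrow> 0) (at t within {0..}))"

text \<open>
  Mild solutions of \<open>y' = A y\<close>, \<open>y(0) = y\<^sub>0\<close>: \<open>y\<close> is continuous and, for all \<open>t \<ge> 0\<close>,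
  the integral of \<open>y\<close> over \<open>[0, t]\<close> is in the domain of \<open>A\<close> and
  \<open>y(t) = y\<^sub>0 + A \<integral>\<^sub>0\<^sup>t y(s) ds\<close>. The case \<open>t = 0\<close> is the initial condition.
\<close>

definition GT_mild_solution ::
  "(real \<Rightarrow> real \<Rightarrow> real \<times> real) \<Rightarrow> (real \<Rightarrow> real \<times> real) \<Rightarrow> bool" where
  "GT_mild_solution y y0 \<longleftrightarrow> continuous_L2 y \<and>
     (\<forall>t\<ge>0. \<exists>w z. has_L2_integral y w 0 t \<and> GT_generator w z \<and>
        (AE x in lborel. y t x = y0 x + z x))"

end

theory Submission
  imports Defs "HOL-Probability.Characteristic_Functions"
begin

text \<open>
  Write \<open>F\<close> for the Fourier transform. On the Fourier side the Goldstein--Taylor equation splits into the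
  systems \<open>\<partial>\<^sub>t y = - C y\<close> with \<open>C = ((0, \<i>\<xi>), (\<i>\<xi>, 1))\<close>, one
  for each frequency \<open>\<xi>\<close>. The matrix \<^const>\<open>P_tilde\<close> is a Lyapunov matrix for
  \<open>C\<close>: with \<open>\<mu>\<close> = \<^const>\<open>mu_tilde\<close> the matrix \<open>C\<^sup>* P + P C -
  2 \<mu> P\<close> is positive semidefinite, in fact singular (\<open>lyapunov_inequality\<close>). Hence the density
  of the functional decays like \<open>exp (-2 \<mu>(\<xi>) t)\<close> at almost every frequency
  (\<open>energy_density_decay\<close>). It is comparable to \<open>\<bar>y\<bar>\<^sup>2\<close>, since the
  eigenvalues of \<^const>\<open>P_tilde\<close> are \<open>1 \<plusminus> 2 \<xi> / (1 + 4 \<xi>\<^sup>2)\<close>;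
  their ratio is at most \<open>3\<close>, and smaller for low frequencies.

  The estimate follows by splitting the frequencies at \<open>R\<close> (\<open>GT_decay\<close>). High frequencies
  decay at the rate \<open>2 \<mu>(R)\<close>, because \<open>\<mu>\<close> increases with
  \<open>\<bar>\<xi>\<bar>\<close>, and Plancherel's identity bounds them by the \<open>L\<^sup>2\<close> norm of the
  initial datum. For low frequencies the initial transform is bounded by the \<open>L\<^sup>1\<close> norm, and
  \<open>\<mu>(\<xi>) \<ge> \<xi>\<^sup>2\<close> holds exactly up to \<open>\<bar>\<xi>\<bar> = (sqrt 5 - 1) /
  4\<close>, which leaves the integral of \<open>exp (-2 \<xi>\<^sup>2 t)\<close> over \<open>[-R, R]\<close>.

  A mild solution satisfies the equation only after integration in time, and its transform is known for each time only
  up to a null set of frequencies. So there is no differential equation for a single frequency to start with. On a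
  bounded set of frequencies, however, \<open>C\<close> is a bounded operator on \<open>L\<^sup>2\<close>, and there
  the transformed solution is differentiable in norm. The energy in the set decays (\<open>energy_decay\<close>), and
  letting the set vary gives the statement for almost every frequency.

  The formula in physical space is Parseval's identity applied to the off-diagonal part of
  \<^const>\<open>P_tilde\<close>, combined with the symmetry of the transforms of real functions
  (\<open>H3_physical_space\<close>).

  The facts about the Fourier transform on \<open>L\<^sup>2\<close> rest on one computation, the Gaussian means of
  \<open>\<bar>F f\<bar>\<^sup>2\<close> (\<open>gaussian_identity\<close>). It gives Bessel's inequality for
  functions in \<open>L\<^sup>1 \<inter> L\<^sup>2\<close> and, since translations are continuous in
  \<open>L\<^sup>1\<close>, Plancherel's identity for bounded ones. Existence of the transform on
  \<open>L\<^sup>2\<close> is then completeness, and inversion is the multiplication formula \<open>\<integral> (F f)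
  g = \<integral> f (F g)\<close> together with Parseval's identity (\<open>fourier_inversion\<close>), which shows
  that multipliers are defined.
\<close>

section \<open>The norm of square integrable functions\<close>

abbreviation L2_dist :: "(real \<Rightarrow> 'a::real_normed_vector) \<Rightarrow> (real \<Rightarrow> 'a) \<Rightarrow> real" where
  "L2_dist f g \<equiv> Lp_norm 2 (\<lambda>x. f x - g x)"

lemma mem_Lp_2_iff:
  "mem_Lp 2 f \<longleftrightarrow> f \<in> borel_measurable lborel \<and> integrable lborel (\<lambda>x. (norm (f x))\<^sup>2)"
  by (simp add: mem_Lp_def)

lemma mem_Lp_1_iff:
  fixes f :: "real \<Rightarrow> 'a::euclidean_space"
  shows "mem_Lp 1 f \<longleftrightarrow> integrable lborel f"
  by (auto simp: mem_Lp_def integrable_norm_iff)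

lemma L2_measurable: "mem_Lp 2 f \<Longrightarrow> f \<in> borel_measurable borel"
  by (simp add: mem_Lp_2_iff)

lemma L2_integrable_sq: "mem_Lp 2 f \<Longrightarrow> integrable lborel (\<lambda>x. (norm (f x))\<^sup>2)"
  by (simp add: mem_Lp_2_iff)

lemma Lp_norm_nonneg [simp]: "0 \<le> Lp_norm p f"
  by (simp add: Lp_norm_def)

lemma L2_norm_sq: "(Lp_norm 2 f)\<^sup>2 = (LINT x|lborel. (norm (f x))\<^sup>2)"
proof -
  have "0 \<le> (LINT x|lborel. (norm (f x))\<^sup>2)" by simp
  then show ?thesis by (simp add: Lp_norm_def powr_half_sqrt)
qed

lemma L2_norm_minus: "L2_dist f g = L2_dist g f"
  by (simp add: Lp_norm_def norm_minus_commute)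

lemma L2_norm_cong_AE:
  assumes "f \<in> borel_measurable borel" "g \<in> borel_measurable borel"
    and "AE x in lborel. norm (f x) = norm (g x)"
  shows "Lp_norm 2 f = Lp_norm 2 g"
proof -
  have "(LINT x|lborel. norm (f x) powr 2) = (LINT x|lborel. norm (g x) powr 2)"
    by (rule integral_cong_AE) (use assms in auto)
  then show ?thesis by (simp add: Lp_norm_def)
qed

text \<open>The workhorse for membership in \<open>L\<^sup>2\<close>: nearly every function below is compared with one that is
  already known to be square integrable. The two value spaces may differ, which allows passing from pairs to
  components and from complex functions to their absolute values.\<close>

lemma L2_dominated:
  assumes "mem_Lp 2 f" "h \<in> borel_measurable borel" "0 \<le> K"
    and "AE x in lborel. norm (h x) \<le> K * norm (f x)"
  shows "mem_Lp 2 h" "Lp_norm 2 h \<le> K * Lp_norm 2 f"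
proof -
  have m: "f \<in> borel_measurable borel" using assms(1) by (rule L2_measurable)
  have sq: "AE x in lborel. (norm (h x))\<^sup>2 \<le> K\<^sup>2 * (norm (f x))\<^sup>2"
    using assms(4) by eventually_elim (metis norm_ge_zero power_mono power_mult_distrib)
  have int: "integrable lborel (\<lambda>x. K\<^sup>2 * (norm (f x))\<^sup>2)"
    using L2_integrable_sq[OF assms(1)] by simp
  have inth: "integrable lborel (\<lambda>x. (norm (h x))\<^sup>2)"
    by (rule Bochner_Integration.integrable_bound[OF int]) (use assms(2) sq in auto)
  show mem: "mem_Lp 2 h" using assms(2) inth by (simp add: mem_Lp_2_iff)
  have "(Lp_norm 2 h)\<^sup>2 \<le> (LINT x|lborel. K\<^sup>2 * (norm (f x))\<^sup>2)"
    unfolding L2_norm_sq by (rule integral_mono_AE[OF inth int sq])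
  also have "\<dots> = (K * Lp_norm 2 f)\<^sup>2" by (simp add: L2_norm_sq power_mult_distrib)
  finally show "Lp_norm 2 h \<le> K * Lp_norm 2 f"
    by (rule power2_le_imp_le) (simp add: assms(3))
qed

lemma L2_prod_integrable:
  assumes "mem_Lp 2 f" "mem_Lp 2 g"
  shows "integrable lborel (\<lambda>x. norm (f x) * norm (g x))"
proof (rule Bochner_Integration.integrable_bound)
  show "integrable lborel (\<lambda>x. (norm (f x))\<^sup>2 + (norm (g x))\<^sup>2)"
    using assms by (intro Bochner_Integration.integrable_add L2_integrable_sq)
  show "(\<lambda>x. norm (f x) * norm (g x)) \<in> borel_measurable lborel"
    using assms by (auto intro!: borel_measurable_times borel_measurable_norm dest: L2_measurable)
  have "a * b \<le> a\<^sup>2 + b\<^sup>2" if "0 \<le> a" "0 \<le> b" for a b :: real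
    using sum_squares_bound[of a b] mult_nonneg_nonneg[OF that] by linarith
  then show "AE x in lborel. norm (norm (f x) * norm (g x)) \<le> norm ((norm (f x))\<^sup>2 + (norm (g x))\<^sup>2)"
    by (simp add: abs_mult)
qed

text \<open>Expanding \<open>0 \<le> \<integral> (B \<bar>f\<bar> - I \<bar>g\<bar>)\<^sup>2\<close> with \<open>B =
  \<parallel>g\<parallel>\<^sup>2\<close> and \<open>I = \<integral> \<bar>f\<bar> \<bar>g\<bar>\<close> gives
  \<open>B (\<parallel>f\<parallel>\<^sup>2 B - I\<^sup>2) \<ge> 0\<close>; if \<open>B = 0\<close>, then
  \<open>g\<close> vanishes almost everywhere.\<close>

lemma L2_Cauchy_Schwarz:
  assumes "mem_Lp 2 f" "mem_Lp 2 g"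
  shows "(LINT x|lborel. norm (f x) * norm (g x)) \<le> Lp_norm 2 f * Lp_norm 2 g"
proof -
  define A B I where "A = (Lp_norm 2 f)\<^sup>2" and "B = (Lp_norm 2 g)\<^sup>2"
    and "I = (LINT x|lborel. norm (f x) * norm (g x))"
  note int = L2_integrable_sq[OF assms(1)] L2_integrable_sq[OF assms(2)] L2_prod_integrable[OF assms]
  have "0 \<le> (LINT x|lborel. (B * norm (f x) - I * norm (g x))\<^sup>2)" by simp
  also have "\<dots> = (LINT x|lborel. B\<^sup>2 * (norm (f x))\<^sup>2 - 2 * B * I * (norm (f x) * norm (g x)) + I\<^sup>2 * (norm (g x))\<^sup>2)"
    by (rule Bochner_Integration.integral_cong) (auto simp: power2_eq_square algebra_simps)
  also have "\<dots> = B\<^sup>2 * A - 2 * B * I * I + I\<^sup>2 * B"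
    using int by (simp add: A_def B_def I_def L2_norm_sq)
  finally have main: "0 \<le> B * (A * B - I\<^sup>2)" by (simp add: power2_eq_square algebra_simps)
  have "I\<^sup>2 \<le> A * B"
  proof (cases "B = 0")
    case True
    then have "AE x in lborel. (norm (g x))\<^sup>2 = 0"
      using integral_nonneg_eq_0_iff_AE[OF int(2)] by (simp add: B_def L2_norm_sq)
    then have "AE x in lborel. norm (f x) * norm (g x) = 0" by eventually_elim simp
    then have "(LINT x|lborel. norm (f x) * norm (g x)) = 0"
      by (rule integral_eq_zero_AE)
    then show ?thesis using True by (simp add: I_def)
  next
    case False
    then have "B > 0" by (simp add: B_def)
    with main show ?thesis by (simp add: zero_le_mult_iff)
  qed
  then have "I\<^sup>2 \<le> (Lp_norm 2 f * Lp_norm 2 g)\<^sup>2" by (simp add: A_def B_def power_mult_distrib)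
  then show ?thesis unfolding I_def[symmetric] by (rule power2_le_imp_le) simp
qed

lemma L2_mult_integrable:
  fixes f g :: "real \<Rightarrow> 'a::{euclidean_space, real_normed_algebra}"
  assumes "mem_Lp 2 f" "mem_Lp 2 g"
  shows "integrable lborel (\<lambda>x. f x * g x)"
proof (rule Bochner_Integration.integrable_bound[OF L2_prod_integrable[OF assms]])
  show "(\<lambda>x. f x * g x) \<in> borel_measurable lborel"
    using assms[THEN L2_measurable] by simp
  show "AE x in lborel. norm (f x * g x) \<le> norm (norm (f x) * norm (g x))"
    using norm_mult_ineq by (intro AE_I2) (simp only: real_norm_def abs_of_nonneg mult_nonneg_nonneg norm_ge_zero)
qed

lemma L2_mult_bound:
  fixes f g :: "real \<Rightarrow> 'a::{euclidean_space, real_normed_algebra}"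
  assumes "mem_Lp 2 f" "mem_Lp 2 g"
  shows "norm (LINT x|lborel. f x * g x) \<le> Lp_norm 2 f * Lp_norm 2 g"
proof -
  have "norm (LINT x|lborel. f x * g x) \<le> (LINT x|lborel. norm (f x * g x))" by simp
  also have "\<dots> \<le> (LINT x|lborel. norm (f x) * norm (g x))"
    by (intro integral_mono integrable_norm L2_mult_integrable L2_prod_integrable assms norm_mult_ineq)
  also have "\<dots> \<le> Lp_norm 2 f * Lp_norm 2 g" by (rule L2_Cauchy_Schwarz[OF assms])
  finally show ?thesis .
qed

lemma L2_add:
  fixes f g :: "real \<Rightarrow> 'a::euclidean_space"
  assumes "mem_Lp 2 f" "mem_Lp 2 g"
  shows "mem_Lp 2 (\<lambda>x. f x + g x)" "Lp_norm 2 (\<lambda>x. f x + g x) \<le> Lp_norm 2 f + Lp_norm 2 g"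
proof -
  note int = L2_integrable_sq[OF assms(1)] L2_integrable_sq[OF assms(2)] L2_prod_integrable[OF assms]
  note m = assms[THEN L2_measurable]
  have int': "integrable lborel (\<lambda>x. (norm (f x))\<^sup>2 + 2 * (norm (f x) * norm (g x)) + (norm (g x))\<^sup>2)"
    using int by auto
  have le: "(norm (f x + g x))\<^sup>2 \<le> (norm (f x))\<^sup>2 + 2 * (norm (f x) * norm (g x)) + (norm (g x))\<^sup>2" for x
    using power_mono[OF norm_triangle_ineq[of "f x" "g x"], of 2] by (simp add: power2_sum)
  have ints: "integrable lborel (\<lambda>x. (norm (f x + g x))\<^sup>2)"
    by (rule Bochner_Integration.integrable_bound[OF int'])
       (use m le in \<open>auto intro: order_trans[OF le abs_ge_self]\<close>)
  show "mem_Lp 2 (\<lambda>x. f x + g x)" using m ints by (simp add: mem_Lp_2_iff)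
  have "(Lp_norm 2 (\<lambda>x. f x + g x))\<^sup>2 \<le> (LINT x|lborel. (norm (f x))\<^sup>2 + 2 * (norm (f x) * norm (g x)) + (norm (g x))\<^sup>2)"
    unfolding L2_norm_sq by (rule integral_mono[OF ints int' le])
  also have "\<dots> = (Lp_norm 2 f)\<^sup>2 + 2 * (LINT x|lborel. norm (f x) * norm (g x)) + (Lp_norm 2 g)\<^sup>2"
    using int by (simp add: L2_norm_sq)
  also have "\<dots> \<le> (Lp_norm 2 f + Lp_norm 2 g)\<^sup>2"
    using L2_Cauchy_Schwarz[OF assms] by (simp add: power2_sum)
  finally show "Lp_norm 2 (\<lambda>x. f x + g x) \<le> Lp_norm 2 f + Lp_norm 2 g"
    by (rule power2_le_imp_le) simp
qed

lemma L2_scaleR: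
  fixes f :: "real \<Rightarrow> 'a::euclidean_space"
  assumes "mem_Lp 2 f"
  shows "mem_Lp 2 (\<lambda>x. c *\<^sub>R f x)" "Lp_norm 2 (\<lambda>x. c *\<^sub>R f x) \<le> \<bar>c\<bar> * Lp_norm 2 f"
  by (rule L2_dominated[OF assms, where K="\<bar>c\<bar>"]; use L2_measurable[OF assms] in simp)+

lemma L2_diff:
  fixes f g :: "real \<Rightarrow> 'a::euclidean_space"
  assumes "mem_Lp 2 f" "mem_Lp 2 g"
  shows "mem_Lp 2 (\<lambda>x. f x - g x)" "L2_dist f g \<le> Lp_norm 2 f + Lp_norm 2 g"
proof -
  have g: "mem_Lp 2 (\<lambda>x. - g x)" "Lp_norm 2 (\<lambda>x. - g x) = Lp_norm 2 g"
    using assms(2) by (auto simp: mem_Lp_2_iff Lp_norm_def)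
  show "mem_Lp 2 (\<lambda>x. f x - g x)" using L2_add(1)[OF assms(1) g(1)] by simp
  show "L2_dist f g \<le> Lp_norm 2 f + Lp_norm 2 g"
    using L2_add(2)[OF assms(1) g(1)] g(2) by simp
qed

lemma L2_triangle:
  fixes f g h :: "real \<Rightarrow> 'a::euclidean_space"
  assumes "mem_Lp 2 f" "mem_Lp 2 g" "mem_Lp 2 h"
  shows "L2_dist f h \<le> L2_dist f g + L2_dist g h"
  using L2_add(2)[OF L2_diff(1)[OF assms(1,2)] L2_diff(1)[OF assms(2,3)]] by simp

lemma L2_norm_reverse_triangle:
  fixes f g :: "real \<Rightarrow> 'a::euclidean_space"
  assumes "mem_Lp 2 f" "mem_Lp 2 g"
  shows "\<bar>Lp_norm 2 f - Lp_norm 2 g\<bar> \<le> L2_dist f g"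
  using L2_add(2)[OF L2_diff(1)[OF assms] assms(2)]
    L2_add(2)[OF L2_diff(1)[OF assms(2,1)] assms(1)] L2_norm_minus[of f g]
  by simp

lemma L2_norm_zero_AE:
  assumes "mem_Lp 2 f" "Lp_norm 2 f = 0"
  shows "AE x in lborel. f x = 0"
  using integral_nonneg_eq_0_iff_AE[OF L2_integrable_sq[OF assms(1)]] assms(2) L2_norm_sq[of f]
  by simp

lemma L2_AE_eqI:
  fixes f g :: "real \<Rightarrow> 'a::euclidean_space"
  assumes "mem_Lp 2 f" "mem_Lp 2 g" "L2_dist f g = 0"
  shows "AE x in lborel. f x = g x"
  using L2_norm_zero_AE[OF L2_diff(1)[OF assms(1,2)] assms(3)] by simp

lemma L2_sum:
  fixes f :: "'i \<Rightarrow> real \<Rightarrow> 'a::euclidean_space"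
  assumes "finite I" "\<And>i. i \<in> I \<Longrightarrow> mem_Lp 2 (f i)"
  shows "mem_Lp 2 (\<lambda>x. \<Sum>i\<in>I. f i x) \<and> Lp_norm 2 (\<lambda>x. \<Sum>i\<in>I. f i x) \<le> (\<Sum>i\<in>I. Lp_norm 2 (f i))"
  using assms
proof (induction I rule: finite_induct)
  case empty
  then show ?case by (simp add: mem_Lp_2_iff Lp_norm_def)
next
  case (insert i I)
  then show ?case using L2_add[of "f i" "\<lambda>x. \<Sum>i\<in>I. f i x"] by fastforce
qed

text \<open>One statement serves three kinds of cutoff: truncation to \<open>[-r, r]\<close>, truncation in the values as well
  as in the argument, and continuously differentiable bumps.\<close>

lemma L2_cutoff_tendsto:
  fixes f :: "real \<Rightarrow> 'a::euclidean_space" and c :: "real \<Rightarrow> real \<Rightarrow> real"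
  assumes "mem_Lp 2 f"
    and c: "\<And>r. c r \<in> borel_measurable borel" "\<And>r x. \<bar>c r x\<bar> \<le> 1" "\<And>x. ((\<lambda>r. c r x) \<longlongrightarrow> 1) at_top"
  shows "((\<lambda>r. Lp_norm 2 (\<lambda>x. c r x *\<^sub>R f x - f x)) \<longlongrightarrow> 0) at_top"
proof -
  note [measurable] = L2_measurable[OF assms(1)] c(1)
  have "((\<lambda>r. LINT x|lborel. (norm (c r x *\<^sub>R f x - f x))\<^sup>2) \<longlongrightarrow> (LINT x::real|lborel. (0::real))) at_top"
  proof (rule integral_dominated_convergence_at_top[where w="\<lambda>x. 4 * (norm (f x))\<^sup>2" and f="\<lambda>x. 0::real"
       and s="\<lambda>r x. (norm (c r x *\<^sub>R f x - f x))\<^sup>2"])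
    show "integrable lborel (\<lambda>x. 4 * (norm (f x))\<^sup>2)" using L2_integrable_sq[OF assms(1)] by simp
    have "((\<lambda>r. (norm (c r x *\<^sub>R f x - f x))\<^sup>2) \<longlongrightarrow> (norm (1 *\<^sub>R f x - f x))\<^sup>2) at_top" for x
      by (intro tendsto_intros c(3))
    then show "AE x in lborel. ((\<lambda>r. (norm (c r x *\<^sub>R f x - f x))\<^sup>2) \<longlongrightarrow> 0) at_top" by simp
    have "norm ((norm (c r x *\<^sub>R f x - f x))\<^sup>2) \<le> 4 * (norm (f x))\<^sup>2" for r x
    proof -
      have "norm (c r x *\<^sub>R f x - f x) \<le> \<bar>c r x\<bar> * norm (f x) + norm (f x)"
        by (metis norm_triangle_ineq4 norm_scaleR)
      also have "\<dots> \<le> 2 * norm (f x)" using mult_right_mono[OF c(2)[of r x] norm_ge_zero[of "f x"]] by simp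
      finally have "(norm (c r x *\<^sub>R f x - f x))\<^sup>2 \<le> (2 * norm (f x))\<^sup>2" by (intro power_mono) auto
      then show ?thesis by (simp add: power_mult_distrib)
    qed
    then show "\<forall>\<^sub>F r in at_top. AE x in lborel. norm ((norm (c r x *\<^sub>R f x - f x))\<^sup>2) \<le> 4 * (norm (f x))\<^sup>2"
      by simp
  qed (auto)
  then have "((\<lambda>r. sqrt ((Lp_norm 2 (\<lambda>x. c r x *\<^sub>R f x - f x))\<^sup>2)) \<longlongrightarrow> sqrt 0) at_top"
    unfolding L2_norm_sq by (intro tendsto_real_sqrt) simp
  then show ?thesis by simp
qed

section \<open>Completeness and translations\<close>

lemma L2_nn_integral:
  assumes "mem_Lp 2 f"
  shows "(\<integral>\<^sup>+x. ennreal ((norm (f x))\<^sup>2) \<partial>lborel) = ennreal ((Lp_norm 2 f)\<^sup>2)"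
  unfolding L2_norm_sq by (rule nn_integral_eq_integral[OF L2_integrable_sq[OF assms]]) simp

lemma L2_nn_integral_bound:
  assumes "f \<in> borel_measurable borel" "0 \<le> B"
    and "(\<integral>\<^sup>+x. ennreal ((norm (f x))\<^sup>2) \<partial>lborel) \<le> ennreal (B\<^sup>2)"
  shows "mem_Lp 2 f" "Lp_norm 2 f \<le> B"
proof -
  have "integrable lborel (\<lambda>x. (norm (f x))\<^sup>2)"
    using assms by (intro integrableI_bounded) (auto intro: le_less_trans)
  then show mem: "mem_Lp 2 f" using assms(1) by (simp add: mem_Lp_2_iff)
  show "Lp_norm 2 f \<le> B"
    using assms(2,3) unfolding L2_nn_integral[OF mem] by (auto intro: power2_le_imp_le simp: ennreal_le_iff)
qed

lemma L2_Fatou: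
  fixes f :: "nat \<Rightarrow> real \<Rightarrow> 'a::euclidean_space"
  assumes mem: "\<And>k. mem_Lp 2 (f k)" and g: "g \<in> borel_measurable borel"
    and lim: "AE x in lborel. (\<lambda>k. f k x) \<longlonglongrightarrow> g x"
    and bnd: "\<forall>\<^sub>F k in sequentially. Lp_norm 2 (f k) \<le> B" and "0 \<le> B"
  shows "mem_Lp 2 g" "Lp_norm 2 g \<le> B"
proof -
  have m: "f k \<in> borel_measurable borel" for k using L2_measurable[OF mem] .
  have "(\<integral>\<^sup>+x. ennreal ((norm (g x))\<^sup>2) \<partial>lborel)
      = (\<integral>\<^sup>+x. liminf (\<lambda>k. ennreal ((norm (f k x))\<^sup>2)) \<partial>lborel)"
  proof (rule nn_integral_cong_AE)
    show "AE x in lborel. ennreal ((norm (g x))\<^sup>2) = liminf (\<lambda>k. ennreal ((norm (f k x))\<^sup>2))"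
      using lim
    proof eventually_elim
      case (elim x)
      then have "(\<lambda>k. ennreal ((norm (f k x))\<^sup>2)) \<longlonglongrightarrow> ennreal ((norm (g x))\<^sup>2)"
        by (intro tendsto_ennrealI tendsto_intros)
      then show ?case by (rule lim_imp_Liminf[OF trivial_limit_sequentially, symmetric])
    qed
  qed
  also have "\<dots> \<le> liminf (\<lambda>k. \<integral>\<^sup>+x. ennreal ((norm (f k x))\<^sup>2) \<partial>lborel)"
    using m by (intro nn_integral_liminf) auto
  also have "\<dots> \<le> ennreal (B\<^sup>2)"
  proof (rule Liminf_le[OF trivial_limit_sequentially])
    show "\<forall>\<^sub>F k in sequentially. (\<integral>\<^sup>+x. ennreal ((norm (f k x))\<^sup>2) \<partial>lborel) \<le> ennreal (B\<^sup>2)"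
      using bnd by eventually_elim (simp add: L2_nn_integral[OF mem] ennreal_leI power_mono)
  qed
  finally have le: "(\<integral>\<^sup>+x. ennreal ((norm (g x))\<^sup>2) \<partial>lborel) \<le> ennreal (B\<^sup>2)" .
  show "mem_Lp 2 g" "Lp_norm 2 g \<le> B"
    using L2_nn_integral_bound[OF g \<open>0 \<le> B\<close> le] by auto
qed

text \<open>Riesz--Fischer. Along a subsequence whose increments \<open>d\<^sub>k\<close> have norm at most
  \<open>2\<^sup>-\<^sup>k\<close> the function \<open>\<Sum> 2\<^sup>k d\<^sub>k\<^sup>2\<close> has a finite
  integral, since the \<open>k\<close>-th term contributes at most \<open>2\<^sup>k 4\<^sup>-\<^sup>k\<close>. So
  almost everywhere the increments are bounded by a geometric sequence, and the subsequence converges; Fatou's lemma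
  turns the pointwise limit into a limit in norm.\<close>

lemma L2_complete:
  fixes F :: "nat \<Rightarrow> real \<Rightarrow> 'a::euclidean_space"
  assumes mem: "\<And>n. mem_Lp 2 (F n)"
    and cauchy: "\<And>e. e > 0 \<Longrightarrow> \<exists>N. \<forall>m\<ge>N. \<forall>n\<ge>N. L2_dist (F m) (F n) \<le> e"
  obtains g where "mem_Lp 2 g" "(\<lambda>n. L2_dist (F n) g) \<longlonglongrightarrow> 0"
proof -
  have "\<exists>N. \<forall>m\<ge>N. \<forall>n\<ge>N. L2_dist (F m) (F n) \<le> (1/2)^k" for k
    by (rule cauchy) simp
  then obtain N where N: "\<And>k m n. N k \<le> m \<Longrightarrow> N k \<le> n \<Longrightarrow> L2_dist (F m) (F n) \<le> (1/2)^k"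
    by metis
  define r where "r k = (\<Sum>i\<le>k. N i)" for k
  have Nr: "N k \<le> r k" for k unfolding r_def by (rule member_le_sum) auto
  have rmono: "r j \<le> r k" if "j \<le> k" for j k unfolding r_def by (rule sum_mono2) (use that in auto)
  have r: "L2_dist (F m) (F n) \<le> (1/2)^k" if "r k \<le> m" "r k \<le> n" for k m n
    using N[of k m n] Nr[of k] that by linarith
  have m[measurable]: "F n \<in> borel_measurable borel" for n using L2_measurable[OF mem] .
  define d where "d k x = norm (F (r (Suc k)) x - F (r k) x)" for k x
  have dm[measurable]: "d k \<in> borel_measurable borel" for k unfolding d_def using m by simp
  have "(\<lambda>x. 2^k * (d k x)\<^sup>2) \<in> borel_measurable lborel" for k using dm by simp
  note wm = measurable_compose[OF this measurable_ennreal]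
  have dint: "(\<integral>\<^sup>+x. ennreal ((d k x)\<^sup>2) \<partial>lborel) \<le> ennreal ((1/4)^k)" for k
  proof -
    have "(\<integral>\<^sup>+x. ennreal ((d k x)\<^sup>2) \<partial>lborel) = ennreal ((L2_dist (F (r (Suc k))) (F (r k)))\<^sup>2)"
      unfolding d_def by (rule L2_nn_integral) (intro L2_diff mem)
    also have "\<dots> \<le> ennreal (((1/2)^k)\<^sup>2)"
      by (intro ennreal_leI power_mono r) (auto intro: rmono)
    also have "((1/2)^k)\<^sup>2 = ((1/4)^k :: real)" by (simp add: power_mult[symmetric] power_mult_distrib power_divide mult.commute[of k] power_mult)
    finally show ?thesis .
  qed
  have fin: "(\<integral>\<^sup>+x. (\<Sum>k. ennreal (2^k * (d k x)\<^sup>2)) \<partial>lborel) < \<infinity>"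
  proof -
    have "(\<integral>\<^sup>+x. (\<Sum>k. ennreal (2^k * (d k x)\<^sup>2)) \<partial>lborel) = (\<Sum>k. \<integral>\<^sup>+x. ennreal (2^k * (d k x)\<^sup>2) \<partial>lborel)"
      by (rule nn_integral_suminf[OF wm])
    also have "\<dots> \<le> (\<Sum>k. ennreal ((1/2)^k))"
    proof (intro suminf_le allI)
      fix k
      have "(\<integral>\<^sup>+x. ennreal (2^k * (d k x)\<^sup>2) \<partial>lborel) = ennreal (2^k) * (\<integral>\<^sup>+x. ennreal ((d k x)\<^sup>2) \<partial>lborel)"
        by (subst nn_integral_cmult[symmetric]) (auto simp: ennreal_mult)
      also have "\<dots> \<le> ennreal (2^k) * ennreal ((1/4)^k)" by (intro mult_left_mono dint) simp
      also have "\<dots> = ennreal (2^k * (1/4)^k)" by (simp add: ennreal_mult)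
      also have "(2^k * (1/4)^k :: real) = (1/2)^k" by (simp add: power_mult_distrib[symmetric])
      finally show "(\<integral>\<^sup>+x. ennreal (2^k * (d k x)\<^sup>2) \<partial>lborel) \<le> ennreal ((1/2)^k)" .
    qed auto
    also have "\<dots> < \<infinity>"
    proof -
      have "(\<Sum>k. ennreal ((1/2)^k)) = ennreal (\<Sum>k. (1/2)^k)"
        by (rule suminf_ennreal2) (auto intro: summable_geometric)
      then show ?thesis by simp
    qed
    finally show ?thesis .
  qed
  have conv: "AE x in lborel. convergent (\<lambda>k. F (r k) x)"
  proof -
    have "(\<lambda>x. \<Sum>k. ennreal (2^k * (d k x)\<^sup>2)) \<in> borel_measurable lborel"
      by (rule borel_measurable_suminf_order[OF wm])
    from nn_integral_PInf_AE[OF this less_imp_neq[OF fin]]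
    have "AE x in lborel. (\<Sum>k. ennreal (2^k * (d k x)\<^sup>2)) \<noteq> \<infinity>" .
    then show ?thesis
    proof eventually_elim
      case (elim x)
      define C where "C = enn2real (\<Sum>k. ennreal (2^k * (d k x)\<^sup>2))"
      have "(\<Sum>k. ennreal (2^k * (d k x)\<^sup>2)) < top"
        using elim top.not_eq_extremum unfolding infinity_ennreal_def by blast
      then have C: "(\<Sum>k. ennreal (2^k * (d k x)\<^sup>2)) = ennreal C" "0 \<le> C"
        unfolding C_def by (simp_all only: ennreal_enn2real enn2real_nonneg)
      have "2^k * (d k x)\<^sup>2 \<le> C" for k
      proof -
        have "(\<Sum>i\<in>{k}. ennreal (2^i * (d i x)\<^sup>2)) \<le> ennreal C"
          unfolding C(1)[symmetric] by (rule sum_le_suminf) auto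
        then show ?thesis using C(2) by (simp add: ennreal_le_iff)
      qed
      then have sq: "(d k x)\<^sup>2 \<le> C * (1/2)^k" for k
        by (simp add: field_simps power_one_over)
      define q :: real where "q = sqrt (1/2)"
      have q: "norm q < 1" unfolding q_def using real_sqrt_less_mono[of "1/2" 1] real_sqrt_ge_zero[of "1/2"]
        unfolding real_norm_def real_sqrt_one by linarith
      have dq: "norm (d k x) \<le> sqrt C * q^k" for k
        using real_sqrt_le_mono[OF sq[of k]] unfolding q_def by (simp add: real_sqrt_mult real_sqrt_power d_def)
      have "summable (\<lambda>k. sqrt C * q^k)"
        by (rule summable_mult[OF summable_geometric[OF q]])
      from summable_comparison_test'[OF this dq] have "summable (\<lambda>k. d k x)" .
      then have "summable (\<lambda>k. F (r (Suc k)) x - F (r k) x)"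
        unfolding d_def by (rule summable_norm_cancel)
      then have "convergent (\<lambda>n. \<Sum>k<n. F (r (Suc k)) x - F (r k) x)"
        by (simp add: summable_iff_convergent)
      then have "convergent (\<lambda>n. (F (r n) x - F (r 0) x) + F (r 0) x)"
        unfolding sum_lessThan_telescope[of "\<lambda>k. F (r k) x"] by (intro convergent_add convergent_const)
      then show ?case by simp
    qed
  qed
  define g where "g x = lim (\<lambda>k. F (r k) x)" for x
  have gm[measurable]: "g \<in> borel_measurable borel" unfolding g_def by (rule borel_measurable_lim_metric) (rule m)
  have lim: "AE x in lborel. (\<lambda>k. F (r k) x) \<longlonglongrightarrow> g x"
    using conv by eventually_elim (simp add: g_def convergent_LIMSEQ_iff)
  have fatou: "mem_Lp 2 (\<lambda>x. F n x - g x)" "L2_dist (F n) g \<le> (1/2)^k" if "r k \<le> n" for n k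
  proof -
    have l: "AE x in lborel. (\<lambda>j. F n x - F (r j) x) \<longlonglongrightarrow> F n x - g x"
      using lim by eventually_elim (intro tendsto_intros)
    have b: "\<forall>\<^sub>F j in sequentially. L2_dist (F n) (F (r j)) \<le> (1/2)^k"
      using r that rmono unfolding eventually_sequentially by blast
    show "mem_Lp 2 (\<lambda>x. F n x - g x)" "L2_dist (F n) g \<le> (1/2)^k"
      by (rule L2_Fatou[OF _ _ l b]; use L2_diff(1)[OF mem mem] in simp)+
  qed
  have "mem_Lp 2 (\<lambda>x. F (r 0) x - (F (r 0) x - g x))"
    by (intro L2_diff mem fatou(1)[of 0]) simp
  then have "mem_Lp 2 g" by simp
  moreover have "(\<lambda>n. L2_dist (F n) g) \<longlonglongrightarrow> 0"
  proof (rule LIMSEQ_I)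
    fix e :: real assume "0 < e"
    then obtain k where "(1/2)^k < e" using real_arch_pow_inv[of e "1/2"] by auto
    then show "\<exists>no. \<forall>n\<ge>no. norm (L2_dist (F n) g - 0) < e"
      using fatou(2)[of k] by (intro exI[of _ "r k"]) fastforce
  qed
  ultimately show ?thesis by (rule that)
qed

lemma L2_affine:
  assumes "mem_Lp 2 f" "c \<noteq> 0"
  shows "mem_Lp 2 (\<lambda>x. f (t + c * x))" "\<bar>c\<bar> * (Lp_norm 2 (\<lambda>x. f (t + c * x)))\<^sup>2 = (Lp_norm 2 f)\<^sup>2"
proof -
  note [measurable] = L2_measurable[OF assms(1)]
  have "integrable lborel (\<lambda>x. (norm (f (t + c * x)))\<^sup>2)"
    using lborel_integrable_real_affine[OF L2_integrable_sq[OF assms(1)] assms(2)] .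
  then show "mem_Lp 2 (\<lambda>x. f (t + c * x))" by (simp add: mem_Lp_2_iff)
  show "\<bar>c\<bar> * (Lp_norm 2 (\<lambda>x. f (t + c * x)))\<^sup>2 = (Lp_norm 2 f)\<^sup>2"
    using lborel_integral_real_affine[OF assms(2), of "\<lambda>x. (norm (f x))\<^sup>2" t] unfolding L2_norm_sq by simp
qed

lemma L2_translate:
  assumes "mem_Lp 2 f"
  shows "mem_Lp 2 (\<lambda>x. f (x - a))" "Lp_norm 2 (\<lambda>x. f (x - a)) = Lp_norm 2 f"
proof -
  show "mem_Lp 2 (\<lambda>x. f (x - a))" using L2_affine(1)[OF assms, of 1 "-a"] by simp
  have "(Lp_norm 2 (\<lambda>x. f (x - a)))\<^sup>2 = (Lp_norm 2 f)\<^sup>2" using L2_affine(2)[OF assms, of 1 "-a"] by simp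
  then show "Lp_norm 2 (\<lambda>x. f (x - a)) = Lp_norm 2 f" by (simp add: power2_eq_iff_nonneg)
qed

lemma L2_reflect:
  assumes "mem_Lp 2 f"
  shows "mem_Lp 2 (\<lambda>x. f (- x))" "Lp_norm 2 (\<lambda>x. f (- x)) = Lp_norm 2 f"
proof -
  show "mem_Lp 2 (\<lambda>x. f (- x))" using L2_affine(1)[OF assms, of "-1" 0] by simp
  have "(Lp_norm 2 (\<lambda>x. f (- x)))\<^sup>2 = (Lp_norm 2 f)\<^sup>2" using L2_affine(2)[OF assms, of "-1" 0] by simp
  then show "Lp_norm 2 (\<lambda>x. f (- x)) = Lp_norm 2 f" by (simp add: power2_eq_iff_nonneg)
qed

lemma integrable_translate:
  fixes f :: "real \<Rightarrow> 'a::euclidean_space"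
  assumes "integrable lborel f"
  shows "integrable lborel (\<lambda>x. f (x - a))" "(LINT x|lborel. f (x - a)) = (LINT x|lborel. f x)"
  using lborel_integrable_real_affine[OF assms, of 1 "-a"] lborel_integral_real_affine[of 1 f "-a"] by auto

text \<open>The part of \<open>U\<close> that the translate loses tends to zero pointwise because \<open>U\<close> is open; the
  part that it gains has the same measure, because translation preserves the measure of \<open>U\<close>.\<close>

lemma translation_open_tendsto:
  fixes U :: "real set"
  assumes U: "open U" "emeasure lborel U < \<infinity>" and a: "a \<longlonglongrightarrow> 0"
  shows "(\<lambda>n. LINT x|lborel. \<bar>indicator U (x - a n) - indicator U x :: real\<bar>) \<longlonglongrightarrow> 0"
proof -
  define p where "p = (indicator U :: real \<Rightarrow> real)"
  have int: "integrable lborel p" unfolding p_def using U by (intro integrable_real_indicator) auto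
  note inta = integrable_translate[OF int]
  have eq: "(LINT x|lborel. \<bar>p (x - a n) - p x\<bar>) = 2 * (LINT x|lborel. max 0 (p x - p (x - a n)))" for n
  proof -
    have "(LINT x|lborel. \<bar>p (x - a n) - p x\<bar>)
        = (LINT x|lborel. 2 * max 0 (p x - p (x - a n)) - (p x - p (x - a n)))"
      by (intro Bochner_Integration.integral_cong) (auto simp: max_def)
    also have "\<dots> = 2 * (LINT x|lborel. max 0 (p x - p (x - a n)))"
      using int inta by (subst Bochner_Integration.integral_diff) auto
    finally show ?thesis .
  qed
  have "(\<lambda>n. LINT x|lborel. max 0 (p x - p (x - a n))) \<longlonglongrightarrow> (LINT x::real|lborel. (0::real))"
  proof (rule integral_dominated_convergence[where w=p])
    show "AE x in lborel. (\<lambda>n. max 0 (p x - p (x - a n))) \<longlonglongrightarrow> 0"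
    proof (rule AE_I2)
      fix x :: real
      show "(\<lambda>n. max 0 (p x - p (x - a n))) \<longlonglongrightarrow> 0"
      proof (cases "x \<in> U")
        case True
        have "(\<lambda>n. x - a n) \<longlonglongrightarrow> x - 0" by (intro tendsto_intros a)
        then have "\<forall>\<^sub>F n in sequentially. x - a n \<in> U" using True U(1) by (simp add: topological_tendstoD)
        then have "\<forall>\<^sub>F n in sequentially. max 0 (p x - p (x - a n)) = 0"
          by eventually_elim (simp add: p_def True)
        then show ?thesis by (rule tendsto_eventually)
      next
        case False
        then show ?thesis by (simp add: p_def)
      qed
    qed
    show "AE x in lborel. norm (max 0 (p x - p (x - a n))) \<le> p x" for n
      by (simp add: p_def indicator_def)
    show "(\<lambda>x. max 0 (p x - p (x - a n))) \<in> borel_measurable lborel" for n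
      using int inta(1) by (intro borel_measurable_max borel_measurable_diff) auto
  qed (use int in auto)
  then have "(\<lambda>n. 2 * (LINT x|lborel. max 0 (p x - p (x - a n)))) \<longlonglongrightarrow> 2 * 0"
    by (intro tendsto_mult_left) simp
  then show ?thesis unfolding eq[symmetric] by (simp add: p_def)
qed

text \<open>Outer regularity reduces indicator functions of Borel sets to those of open sets; linear combinations and dominated
  limits do the rest.\<close>

lemma integrable_translation_continuous:
  fixes f :: "real \<Rightarrow> 'a::euclidean_space"
  assumes "integrable lborel f" and a: "a \<longlonglongrightarrow> 0"
  shows "(\<lambda>n. LINT x|lborel. norm (f (x - a n) - f x)) \<longlonglongrightarrow> 0"
  using assms(1)
proof (induction rule: integrable_induct)
  case (base A c)
  have A: "A \<in> sets borel" using base by simp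
  show ?case
  proof (rule LIMSEQ_I)
    fix e :: real assume "0 < e"
    \<comment> \<open>Three error terms of size \<open>\<eta>\<close> will be multiplied by \<open>norm c\<close>.\<close>
    define \<eta> where "\<eta> = e / (4 * (norm c + 1))"
    have \<eta>: "0 < \<eta>" using \<open>0 < e\<close> by (simp add: \<eta>_def add_nonneg_pos)
    obtain U where U: "open U" "A \<subseteq> U" "emeasure lborel (U - A) < ennreal \<eta>"
      using outer_regular_lborel[OF A \<eta>] by blast
    have Ufin: "emeasure lborel U < \<infinity>"
    proof -
      have "emeasure lborel U = emeasure lborel A + emeasure lborel (U - A)"
        using U A by (subst plus_emeasure) (auto intro: arg_cong[of _ _ "emeasure lborel"])
      also have "\<dots> < \<infinity>" using base U(3) by (auto intro: order.strict_trans)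
      finally show ?thesis .
    qed
    define D where "D x = (indicator (U - A) x :: real)" for x
    define p where "p x = (indicator U x :: real)" for x
    have Dint: "integrable lborel D" unfolding D_def using U A
      by (intro integrable_real_indicator) (auto intro: order.strict_trans)
    have pint: "integrable lborel p" unfolding p_def using U Ufin by (intro integrable_real_indicator) auto
    have Dle: "(LINT x|lborel. D x) < \<eta>"
    proof -
      have "emeasure lborel (U - A) = ennreal (measure lborel (U - A))"
        using U(3) by (intro emeasure_eq_ennreal_measure) (auto simp: top_unique)
      then have "measure lborel (U - A) < \<eta>" using U(3) by (simp add: ennreal_less_iff)
      then show ?thesis unfolding D_def by simp
    qed
    obtain n0 where n0: "\<And>n. n \<ge> n0 \<Longrightarrow> (LINT x|lborel. \<bar>p (x - a n) - p x\<bar>) < \<eta>"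
      using LIMSEQ_D[OF translation_open_tendsto[OF U(1) Ufin a] \<eta>] by (auto simp: p_def)
    have "norm ((LINT x|lborel. norm (indicator A (x - a n) *\<^sub>R c - indicator A x *\<^sub>R c)) - 0) < e" if "n \<ge> n0" for n
    proof -
      note Dint' = integrable_translate[OF Dint, of "a n"] and pint' = integrable_translate[OF pint, of "a n"]
      have Ii: "integrable lborel (\<lambda>x. indicator A x *\<^sub>R c)" using base
        by (intro integrable_scaleR_left integrable_real_indicator) auto
      have "(LINT x|lborel. norm (indicator A (x - a n) *\<^sub>R c - indicator A x *\<^sub>R c))
          \<le> (LINT x|lborel. norm c * (D (x - a n) + \<bar>p (x - a n) - p x\<bar> + D x))"
      proof (rule integral_mono)
        show "integrable lborel (\<lambda>x. norm (indicator A (x - a n) *\<^sub>R c - indicator A x *\<^sub>R c))"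
          by (intro integrable_norm Bochner_Integration.integrable_diff integrable_translate(1)[OF Ii] Ii)
        show "integrable lborel (\<lambda>x. norm c * (D (x - a n) + \<bar>p (x - a n) - p x\<bar> + D x))"
          by (intro integrable_mult_right Bochner_Integration.integrable_add Bochner_Integration.integrable_diff integrable_abs Dint Dint' pint pint')
        fix x
        have "norm (indicator A (x - a n) *\<^sub>R c - indicator A x *\<^sub>R c) = norm c * \<bar>indicator A (x - a n) - indicator A x\<bar>"
          by (simp add: scaleR_left_diff_distrib[symmetric])
        also have "\<dots> \<le> norm c * (D (x - a n) + \<bar>p (x - a n) - p x\<bar> + D x)"
          by (intro mult_left_mono) (use U(2) in \<open>auto simp: D_def p_def indicator_def\<close>)
        finally show "norm (indicator A (x - a n) *\<^sub>R c - indicator A x *\<^sub>R c) \<le> norm c * (D (x - a n) + \<bar>p (x - a n) - p x\<bar> + D x)" .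
      qed
      also have "\<dots> = norm c * ((LINT x|lborel. D x) + (LINT x|lborel. \<bar>p (x - a n) - p x\<bar>) + (LINT x|lborel. D x))"
        using Dint Dint' pint pint' by simp
      also have "\<dots> \<le> norm c * (\<eta> + \<eta> + \<eta>)"
        using Dle n0[OF that] by (intro mult_left_mono) auto
      also have "\<dots> < e"
      proof -
        have "norm c * (\<eta> + \<eta> + \<eta>) < (norm c + 1) * (4 * \<eta>)" using \<eta> by (auto simp: algebra_simps intro!: add_nonneg_pos)
        also have "\<dots> = e" unfolding \<eta>_def using norm_ge_zero[of c] by (simp add: field_simps add_nonneg_eq_0_iff)
        finally show ?thesis .
      qed
      finally show ?thesis by simp
    qed
    then show "\<exists>no. \<forall>n\<ge>no. norm ((LINT x|lborel. norm (indicator A (x - a n) *\<^sub>R c - indicator A x *\<^sub>R c)) - 0) < e"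
      by blast
  qed
next
  case (add f g)
  show ?case
  proof (rule tendsto_sandwich[OF _ _ tendsto_const tendsto_add_zero[OF add.IH]])
    show "\<forall>\<^sub>F n in sequentially. 0 \<le> (LINT x|lborel. norm (f (x - a n) + g (x - a n) - (f x + g x)))" by simp
    have "(LINT x|lborel. norm (f (x - a n) + g (x - a n) - (f x + g x)))
       \<le> (LINT x|lborel. norm (f (x - a n) - f x) + norm (g (x - a n) - g x))" for n
      by (intro integral_mono Bochner_Integration.integrable_add Bochner_Integration.integrable_diff integrable_norm
          integrable_translate add.hyps norm_diff_triangle_ineq)
    also have "\<dots> n = (LINT x|lborel. norm (f (x - a n) - f x)) + (LINT x|lborel. norm (g (x - a n) - g x))" for n
      by (intro Bochner_Integration.integral_add Bochner_Integration.integrable_diff integrable_norm integrable_translate add.hyps)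
    finally show "\<forall>\<^sub>F n in sequentially. (LINT x|lborel. norm (f (x - a n) + g (x - a n) - (f x + g x)))
       \<le> (LINT x|lborel. norm (f (x - a n) - f x)) + (LINT x|lborel. norm (g (x - a n) - g x))" by simp
  qed
next
  case (lim f s)
  have L1: "(\<lambda>i. LINT x|lborel. norm (s i x - f x)) \<longlonglongrightarrow> (LINT x::real|lborel. (0::real))"
  proof (rule integral_dominated_convergence[where w="\<lambda>x. 3 * norm (f x)"])
    show "AE x in lborel. (\<lambda>i. norm (s i x - f x)) \<longlonglongrightarrow> 0"
      using lim.hyps(2) by (intro AE_I2 tendsto_norm_zero LIM_zero) auto
    show "AE x in lborel. norm (norm (s i x - f x)) \<le> 3 * norm (f x)" for i
    proof (rule AE_I2)
      fix x :: real
      show "norm (norm (s i x - f x)) \<le> 3 * norm (f x)"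
        using norm_triangle_ineq4[of "s i x" "f x"] lim.hyps(3)[of x i] by simp
    qed
  qed (use lim.hyps in auto)
  show ?case
  proof (rule LIMSEQ_I)
    fix e :: real assume "0 < e"
    obtain i where i: "(LINT x|lborel. norm (s i x - f x)) < e/3"
      using LIMSEQ_D[OF L1, of "e/3"] \<open>0 < e\<close> by force
    obtain n0 where n0: "\<And>n. n \<ge> n0 \<Longrightarrow> (LINT x|lborel. norm (s i (x - a n) - s i x)) < e/3"
      using LIMSEQ_D[OF lim.IH[of i], of "e/3"] \<open>0 < e\<close> by auto
    have "norm ((LINT x|lborel. norm (f (x - a n) - f x)) - 0) < e" if "n \<ge> n0" for n
    proof -
      define q where "q x = norm (s i x - f x)" for x
      have q: "integrable lborel q" unfolding q_def using lim.hyps by (intro integrable_norm Bochner_Integration.integrable_diff)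
      note q' = integrable_translate[OF q, of "a n"]
      note si = lim.hyps(1)[of i] integrable_translate(1)[OF lim.hyps(1)[of i], of "a n"] lim.hyps(4) integrable_translate(1)[OF lim.hyps(4), of "a n"]
      have "(LINT x|lborel. norm (f (x - a n) - f x))
          \<le> (LINT x|lborel. q (x - a n) + norm (s i (x - a n) - s i x) + q x)"
      proof (intro integral_mono integrable_norm Bochner_Integration.integrable_add Bochner_Integration.integrable_diff si q q'(1))
        fix x
        have "f (x - a n) - f x = - (s i (x - a n) - f (x - a n)) + (s i (x - a n) - s i x) + (s i x - f x)" by simp
        also have "norm \<dots> \<le> q (x - a n) + norm (s i (x - a n) - s i x) + q x"
          unfolding q_def by (metis (no_types, lifting) norm_minus_cancel norm_triangle_mono norm_triangle_ineq order_refl)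
        finally show "norm (f (x - a n) - f x) \<le> q (x - a n) + norm (s i (x - a n) - s i x) + q x" .
      qed
      also have "\<dots> = (LINT x|lborel. q x) + (LINT x|lborel. norm (s i (x - a n) - s i x)) + (LINT x|lborel. q x)"
        using q q' si by simp
      also have "\<dots> < e" using i n0[OF that] unfolding q_def by linarith
      finally show ?thesis by simp
    qed
    then show "\<exists>no. \<forall>n\<ge>no. norm ((LINT x|lborel. norm (f (x - a n) - f x)) - 0) < e" by blast
  qed
qed

section \<open>Fourier integrals of integrable functions\<close>

lemma norm_fourier_kernel: "cmod (exp (- \<i> * of_real t)) = 1"
  by (simp add: norm_exp_eq_Re)

lemma fourier_kernel_measurable:
  "(\<lambda>x. exp (- \<i> * of_real (x * \<xi>))) \<in> borel_measurable borel"
  by (intro borel_measurable_continuous_onI continuous_intros)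

lemma fourier_integrable:
  assumes "integrable lborel f"
  shows "integrable lborel (\<lambda>x. exp (- \<i> * of_real (x * \<xi>)) * f x)"
proof (rule Bochner_Integration.integrable_bound[OF assms])
  show "(\<lambda>x. exp (- \<i> * of_real (x * \<xi>)) * f x) \<in> borel_measurable lborel"
    using fourier_kernel_measurable assms by auto
  show "AE x in lborel. cmod (exp (- \<i> * of_real (x * \<xi>)) * f x) \<le> cmod (f x)"
    by (simp only: norm_mult norm_fourier_kernel) simp
qed

lemma fourier_kernel_measurable_pair:
  "(\<lambda>p. exp (- \<i> * of_real (fst p * snd p))) \<in> borel_measurable (lborel \<Otimes>\<^sub>M lborel :: (real \<times> real) measure)"
proof -
  have "(\<lambda>p. exp (- \<i> * of_real (fst p * snd p))) \<in> borel_measurable (borel :: (real \<times> real) measure)"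
    by (intro borel_measurable_continuous_onI continuous_intros)
  then show ?thesis by (simp add: lborel_prod)
qed

lemma fourier_int_measurable:
  assumes "f \<in> borel_measurable borel"
  shows "fourier_int f \<in> borel_measurable borel"
proof -
  have "(\<lambda>p. exp (- \<i> * of_real (fst p * snd p)) * f (snd p)) \<in> borel_measurable (lborel \<Otimes>\<^sub>M lborel :: (real \<times> real) measure)"
    using assms by (intro borel_measurable_times fourier_kernel_measurable_pair measurable_compose[OF measurable_snd]) simp
  then have "(\<lambda>\<xi>. LINT x|lborel. exp (- \<i> * of_real (\<xi> * x)) * f x) \<in> borel_measurable lborel"
    by (intro lborel.borel_measurable_lebesgue_integral) (simp add: case_prod_unfold)
  then show ?thesis unfolding fourier_int_def[abs_def] by (simp add: mult.commute)
qed

lemma fourier_int_bound: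
  assumes "integrable lborel f"
  shows "cmod (fourier_int f \<xi>) \<le> (LINT x|lborel. cmod (f x)) / sqrt (2 * pi)"
proof -
  have "cmod (LINT x|lborel. exp (- \<i> * of_real (x * \<xi>)) * f x) \<le> (LINT x|lborel. cmod (exp (- \<i> * of_real (x * \<xi>)) * f x))"
    by (rule integral_norm_bound)
  also have "\<dots> = (LINT x|lborel. cmod (f x))" by (simp only: norm_mult norm_fourier_kernel mult_1)
  finally show ?thesis by (simp add: fourier_int_def norm_divide divide_right_mono)
qed

lemma fourier_int_add:
  assumes "integrable lborel f" "integrable lborel g"
  shows "fourier_int (\<lambda>x. f x + g x) \<xi> = fourier_int f \<xi> + fourier_int g \<xi>"
  using fourier_integrable[OF assms(1), of \<xi>] fourier_integrable[OF assms(2), of \<xi>]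
  by (simp add: fourier_int_def distrib_left add_divide_distrib del: of_real_mult)

lemma fourier_int_cmult: "fourier_int (\<lambda>x. c * f x) \<xi> = c * fourier_int f \<xi>"
proof -
  have "(LINT x|lborel. exp (- \<i> * of_real (x * \<xi>)) * (c * f x)) = (LINT x|lborel. c * (exp (- \<i> * of_real (x * \<xi>)) * f x))"
    by (rule Bochner_Integration.integral_cong) (simp_all only: mult.left_commute)
  then show ?thesis by (simp add: fourier_int_def del: of_real_mult)
qed

lemma fourier_int_diff:
  assumes "integrable lborel f" "integrable lborel g"
  shows "fourier_int (\<lambda>x. f x - g x) \<xi> = fourier_int f \<xi> - fourier_int g \<xi>"
  using fourier_int_add[OF assms(1), of "\<lambda>x. (-1) * g x" \<xi>] assms(2) fourier_int_cmult[of "-1" g \<xi>] by simp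

lemma cnj_fourier_int: "cnj (fourier_int f \<xi>) = fourier_int (\<lambda>x. cnj (f (- x))) \<xi>"
proof -
  have "cnj (LINT x|lborel. exp (- \<i> * of_real (x * \<xi>)) * f x) = (LINT x|lborel. cnj (exp (- \<i> * of_real (x * \<xi>)) * f x))"
    by (rule Bochner_Integration.integral_cnj[symmetric])
  also have "\<dots> = (LINT x|lborel. cnj (exp (- \<i> * of_real ((0 + -1 * x) * \<xi>)) * f (0 + -1 * x)))"
    by (subst lborel_integral_real_affine[where c="-1" and t=0]) simp_all
  also have "\<dots> = (LINT x|lborel. exp (- \<i> * of_real (x * \<xi>)) * cnj (f (- x)))"
    by (simp add: exp_cnj)
  finally show ?thesis by (simp add: fourier_int_def)
qed

text \<open>Fubini's theorem: the kernel is symmetric in its two variables.\<close>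

lemma fourier_int_mult_formula:
  assumes f: "integrable lborel f" and g: "integrable lborel g"
  shows "(LINT \<xi>|lborel. fourier_int f \<xi> * g \<xi>) = (LINT x|lborel. f x * fourier_int g x)"
proof -
  define k where "k x y = exp (- \<i> * of_real (x * y)) * (f x * g y)" for x y :: real
  have fm: "f \<in> borel_measurable borel" "g \<in> borel_measurable borel" using f g by auto
  have km: "case_prod k \<in> borel_measurable (lborel \<Otimes>\<^sub>M lborel)"
  proof -
    have "(\<lambda>p::real\<times>real. f (fst p)) \<in> borel_measurable (lborel \<Otimes>\<^sub>M lborel)"
      "(\<lambda>p::real\<times>real. g (snd p)) \<in> borel_measurable (lborel \<Otimes>\<^sub>M lborel)"
      using fm by measurable
    then have "(\<lambda>p. exp (- \<i> * of_real (fst p * snd p)) * (f (fst p) * g (snd p))) \<in> borel_measurable (lborel \<Otimes>\<^sub>M lborel)"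
      by (intro borel_measurable_times fourier_kernel_measurable_pair)
    then show ?thesis by (simp add: k_def case_prod_unfold)
  qed
  have nk: "cmod (k x y) = cmod (f x) * cmod (g y)" for x y
    unfolding k_def by (simp only: norm_mult norm_fourier_kernel mult_1)
  have kint: "integrable (lborel \<Otimes>\<^sub>M lborel) (case_prod k)"
  proof (rule lborel_pair.Fubini_integrable[OF km])
    show "integrable lborel (\<lambda>x. LINT y|lborel. norm (case_prod k (x, y)))"
      using f g by (simp add: nk)
    show "AE x in lborel. integrable lborel (\<lambda>y. case_prod k (x, y))"
    proof (rule AE_I2)
      fix x
      have "integrable lborel (\<lambda>y. exp (- \<i> * of_real (y * x)) * (f x * g y))"
        by (intro fourier_integrable integrable_mult_right g)
      then show "integrable lborel (\<lambda>y. case_prod k (x, y))" by (simp add: k_def mult.commute[of x])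
    qed
  qed
  have 1: "(LINT x|lborel. k x y) = of_real (sqrt (2 * pi)) * (fourier_int f y * g y)" for y
  proof -
    have "(LINT x|lborel. k x y) = (LINT x|lborel. (exp (- \<i> * of_real (x * y)) * f x) * g y)"
      by (simp only: k_def mult.assoc)
    also have "\<dots> = (LINT x|lborel. exp (- \<i> * of_real (x * y)) * f x) * g y"
      by (rule integral_mult_left_zero)
    finally show ?thesis by (simp add: fourier_int_def del: of_real_mult)
  qed
  have 2: "(LINT y|lborel. k x y) = of_real (sqrt (2 * pi)) * (f x * fourier_int g x)" for x
  proof -
    have "(LINT y|lborel. k x y) = (LINT y|lborel. f x * (exp (- \<i> * of_real (y * x)) * g y))"
      unfolding k_def by (rule Bochner_Integration.integral_cong) (simp_all only: mult.left_commute mult.commute[of x])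
    also have "\<dots> = f x * (LINT y|lborel. exp (- \<i> * of_real (y * x)) * g y)"
      by (rule integral_mult_right_zero)
    finally show ?thesis by (simp add: fourier_int_def del: of_real_mult)
  qed
  have "of_real (sqrt (2 * pi)) * (LINT \<xi>|lborel. fourier_int f \<xi> * g \<xi>) = (LINT y|lborel. LINT x|lborel. k x y)"
    unfolding 1 by simp
  also have "\<dots> = (LINT x|lborel. LINT y|lborel. k x y)"
    by (rule lborel_pair.Fubini_integral[OF kint])
  also have "\<dots> = of_real (sqrt (2 * pi)) * (LINT x|lborel. f x * fourier_int g x)"
    unfolding 2 by simp
  finally show ?thesis by simp
qed

lemma gaussian_integrable: "s \<noteq> 0 \<Longrightarrow> integrable lborel (\<lambda>\<xi>::real. exp (- (s * \<xi>)\<^sup>2 / 2))"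
proof -
  assume s: "s \<noteq> 0"
  have "integrable lborel (\<lambda>x. sqrt (2 * pi) * std_normal_density (0 + s * x))"
    by (intro integrable_mult_right lborel_integrable_real_affine s integrable_normal_density zero_less_one)
  then show ?thesis by (simp add: std_normal_density_def)
qed

text \<open>The characteristic function of the standard normal distribution, rescaled.\<close>

lemma gaussian_fourier:
  assumes "s > 0"
  shows "(LINT \<xi>|lborel. exp (- \<i> * of_real (\<xi> * z)) * of_real (exp (- (s * \<xi>)\<^sup>2 / 2)))
    = of_real (2 * pi / s * std_normal_density (z / s))"
proof -
  have "char std_normal_distribution (- (z / s)) = of_real (exp (- (- (z / s))\<^sup>2 / 2))"
    by (simp only: char_std_normal_distribution)
  then have "(CLINT x|density lborel std_normal_density. iexp (- (z / s) * x)) = of_real (exp (- (z / s)\<^sup>2 / 2))"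
    by (simp add: char_def)
  moreover have "(CLINT x|density lborel std_normal_density. iexp (- (z / s) * x))
     = (LINT x|lborel. std_normal_density x *\<^sub>R iexp (- (z / s) * x))"
    by (rule integral_density) (auto simp del: of_real_mult)
  ultimately have 1: "(LINT x|lborel. std_normal_density x *\<^sub>R iexp (- (z / s) * x)) = of_real (exp (- (z / s)\<^sup>2 / 2))"
    by simp
  have "(LINT x|lborel. std_normal_density x *\<^sub>R iexp (- (z / s) * x))
     = \<bar>s\<bar> *\<^sub>R (LINT x|lborel. std_normal_density (0 + s * x) *\<^sub>R iexp (- (z / s) * (0 + s * x)))"
    using assms by (intro lborel_integral_real_affine) simp
  also have "(LINT x|lborel. std_normal_density (0 + s * x) *\<^sub>R iexp (- (z / s) * (0 + s * x)))
     = (LINT \<xi>|lborel. of_real (1 / sqrt (2 * pi)) * (exp (- \<i> * of_real (\<xi> * z)) * of_real (exp (- (s * \<xi>)\<^sup>2 / 2))))"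
  proof (rule Bochner_Integration.integral_cong[OF refl])
    fix x
    have "\<i> * of_real (- (z / s) * (0 + s * x)) = - \<i> * complex_of_real (x * z)"
      using assms by (simp add: field_simps)
    then show "std_normal_density (0 + s * x) *\<^sub>R iexp (- (z / s) * (0 + s * x))
      = of_real (1 / sqrt (2 * pi)) * (exp (- \<i> * of_real (x * z)) * of_real (exp (- (s * x)\<^sup>2 / 2)))"
      by (simp add: std_normal_density_def scaleR_conv_of_real)
  qed
  also have "\<dots> = of_real (1 / sqrt (2 * pi)) * (LINT \<xi>|lborel. exp (- \<i> * of_real (\<xi> * z)) * of_real (exp (- (s * \<xi>)\<^sup>2 / 2)))"
    by (rule integral_mult_right_zero)
  finally have "of_real (exp (- (z / s)\<^sup>2 / 2)) = of_real (s / sqrt (2 * pi)) * (LINT \<xi>|lborel. exp (- \<i> * of_real (\<xi> * z)) * of_real (exp (- (s * \<xi>)\<^sup>2 / 2)))"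
    unfolding 1 using assms by (simp add: scaleR_conv_of_real)
  then have "(LINT \<xi>|lborel. exp (- \<i> * of_real (\<xi> * z)) * of_real (exp (- (s * \<xi>)\<^sup>2 / 2)))
     = of_real (exp (- (z / s)\<^sup>2 / 2)) / complex_of_real (s / sqrt (2 * pi))"
    using assms by simp
  also have "\<dots> = of_real (exp (- (z / s)\<^sup>2 / 2) / (s / sqrt (2 * pi)))" by (simp only: of_real_divide)
  also have "exp (- (z / s)\<^sup>2 / 2) / (s / sqrt (2 * pi)) = 2 * pi / s * std_normal_density (z / s)"
  proof -
    have "2 * pi / sqrt (2 * pi) = sqrt (2 * pi)" by (rule real_div_sqrt) simp
    then show ?thesis unfolding std_normal_density_def using assms by (simp add: field_simps)
  qed
  finally show ?thesis .
qed

section \<open>Gaussian regularization and Bessel's inequality\<close>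

text \<open>Its value at \<open>0\<close> is the square of the norm of \<open>f\<close>, and its Fourier transform is, up to a
  constant, the power spectrum \<open>\<bar>F f\<bar>\<^sup>2\<close>. It gives access to \<open>\<integral> \<bar>F
  f\<bar>\<^sup>2\<close> once convergence is enforced by a Gaussian.\<close>

definition autocorrelation :: "(real \<Rightarrow> complex) \<Rightarrow> real \<Rightarrow> complex" where
  "autocorrelation f a = (LINT x|lborel. f x * cnj (f (x - a)))"

lemma L2_cnj:
  assumes "mem_Lp 2 f" shows "mem_Lp 2 (\<lambda>x. cnj (f x))" "Lp_norm 2 (\<lambda>x. cnj (f x)) = Lp_norm 2 f"
proof -
  have "(\<lambda>x. cnj (f x)) \<in> borel_measurable borel"
    using L2_measurable[OF assms] by (rule borel_measurable_continuous_on[OF continuous_on_cnj[OF continuous_on_id]])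
  then show "mem_Lp 2 (\<lambda>x. cnj (f x))" using assms by (simp add: mem_Lp_2_iff)
  show "Lp_norm 2 (\<lambda>x. cnj (f x)) = Lp_norm 2 f" by (simp add: Lp_norm_def)
qed

lemma autocorrelation_measurable:
  assumes "f \<in> borel_measurable borel"
  shows "(\<lambda>p. f (snd p) * cnj (f (snd p - s * fst p))) \<in> borel_measurable (lborel \<Otimes>\<^sub>M lborel :: (real \<times> real) measure)"
    and "autocorrelation f \<in> borel_measurable borel"
proof -
  have 1: "(\<lambda>p::real\<times>real. f (snd p)) \<in> borel_measurable borel"
    by (rule measurable_compose[OF _ assms]) (intro borel_measurable_continuous_onI continuous_intros)
  have 2: "(\<lambda>p::real\<times>real. cnj (f (snd p - s * fst p))) \<in> borel_measurable borel" for s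
    by (rule borel_measurable_continuous_on[OF continuous_on_cnj[OF continuous_on_id]], rule measurable_compose[OF _ assms])
       (intro borel_measurable_continuous_onI continuous_intros)
  have 3: "(\<lambda>p. f (snd p) * cnj (f (snd p - s * fst p))) \<in> borel_measurable (lborel \<Otimes>\<^sub>M lborel :: (real \<times> real) measure)" for s
    using borel_measurable_times[OF 1 2] by (simp add: lborel_prod)
  show "(\<lambda>p. f (snd p) * cnj (f (snd p - s * fst p))) \<in> borel_measurable (lborel \<Otimes>\<^sub>M lborel :: (real \<times> real) measure)"
    by (rule 3)
  have "(\<lambda>a. LINT x|lborel. f x * cnj (f (x - 1 * a))) \<in> borel_measurable lborel"
    by (rule lborel.borel_measurable_lebesgue_integral) (use 3[of 1] in \<open>simp add: case_prod_unfold\<close>)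
  then show "autocorrelation f \<in> borel_measurable borel" by (simp add: autocorrelation_def[abs_def])
qed

lemma autocorrelation_bound:
  assumes "mem_Lp 2 f"
  shows "cmod (autocorrelation f a) \<le> (Lp_norm 2 f)\<^sup>2"
    and "(LINT x|lborel. cmod (f x * cnj (f (x - a)))) \<le> (Lp_norm 2 f)\<^sup>2"
proof -
  note t = L2_cnj(1)[OF L2_translate(1)[OF assms, of a]]
  have n: "Lp_norm 2 (\<lambda>x. cnj (f (x - a))) = Lp_norm 2 f"
    using L2_cnj(2)[OF L2_translate(1)[OF assms, of a]] L2_translate(2)[OF assms, of a] by simp
  show "cmod (autocorrelation f a) \<le> (Lp_norm 2 f)\<^sup>2"
    using L2_mult_bound[OF assms t] n by (simp add: autocorrelation_def power2_eq_square)
  show "(LINT x|lborel. cmod (f x * cnj (f (x - a)))) \<le> (Lp_norm 2 f)\<^sup>2"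
    using L2_Cauchy_Schwarz[OF assms t] n by (simp add: power2_eq_square norm_mult)
qed

text \<open>The multiplication formula is used twice: to move the transform from \<open>f\<close> to \<open>A(\<xi>) = cnj (F
  f(\<xi>)) exp (-(s \<xi>)\<^sup>2/2)\<close>, and to compute the transform of \<open>A\<close>, which is the
  convolution of the conjugate of \<open>f\<close> with a Gaussian of width \<open>s\<close>. As \<open>s\<close>
  tends to \<open>0\<close> the left-hand side tends to \<open>\<integral> \<bar>F f\<bar>\<^sup>2\<close>, and the
  right-hand side to the autocorrelation at \<open>0\<close>, that is, to \<open>\<integral>
  \<bar>f\<bar>\<^sup>2\<close>.\<close>

lemma gaussian_identity:
  assumes f: "integrable lborel f" and f2: "mem_Lp 2 f" and s: "s > 0"
  shows "integrable lborel (\<lambda>\<xi>. (cmod (fourier_int f \<xi>))\<^sup>2 * exp (- (s * \<xi>)\<^sup>2 / 2))"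
    and "complex_of_real (LINT \<xi>|lborel. (cmod (fourier_int f \<xi>))\<^sup>2 * exp (- (s * \<xi>)\<^sup>2 / 2))
      = (LINT z|lborel. of_real (std_normal_density z) * autocorrelation f (s * z))"
proof -
  define c where "c = sqrt (2 * pi)"
  have c: "c > 0" "c * c = 2 * pi" by (auto simp: c_def)
  define k where "k \<xi> = complex_of_real (exp (- (s * \<xi>)\<^sup>2 / 2))" for \<xi>
  have kint: "integrable lborel k"
    unfolding k_def using gaussian_integrable[of s] s by (intro integrable_of_real) simp
  have fm: "f \<in> borel_measurable borel" using f by auto
  have Fm: "fourier_int f \<in> borel_measurable borel" by (rule fourier_int_measurable[OF fm])
  define C where "C = (LINT x|lborel. cmod (f x)) / c"
  have Fb: "cmod (fourier_int f \<xi>) \<le> C" for \<xi>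
    using fourier_int_bound[OF f] by (simp add: C_def c_def)
  have C0: "0 \<le> C" using norm_ge_zero Fb[of 0] order_trans by blast
  show "integrable lborel (\<lambda>\<xi>. (cmod (fourier_int f \<xi>))\<^sup>2 * exp (- (s * \<xi>)\<^sup>2 / 2))"
  proof (rule Bochner_Integration.integrable_bound)
    show "integrable lborel (\<lambda>\<xi>. C\<^sup>2 * exp (- (s * \<xi>)\<^sup>2 / 2))"
      using gaussian_integrable[of s] s by (intro integrable_mult_right) simp
    show "(\<lambda>\<xi>. (cmod (fourier_int f \<xi>))\<^sup>2 * exp (- (s * \<xi>)\<^sup>2 / 2)) \<in> borel_measurable lborel"
      using Fm by simp
    show "AE \<xi> in lborel. norm ((cmod (fourier_int f \<xi>))\<^sup>2 * exp (- (s * \<xi>)\<^sup>2 / 2)) \<le> norm (C\<^sup>2 * exp (- (s * \<xi>)\<^sup>2 / 2))"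
      using power_mono[OF Fb norm_ge_zero, of _ 2] by (intro AE_I2) (simp add: abs_mult mult_right_mono)
  qed
  define A where "A \<xi> = cnj (fourier_int f \<xi>) * k \<xi>" for \<xi>
  have km: "k \<in> borel_measurable borel" using kint by auto
  have cFm: "(\<lambda>\<xi>. cnj (fourier_int f \<xi>)) \<in> borel_measurable borel"
    using Fm by (rule borel_measurable_continuous_on[OF continuous_on_cnj[OF continuous_on_id]])
  have Aint: "integrable lborel A"
  proof (rule Bochner_Integration.integrable_bound)
    show "integrable lborel (\<lambda>\<xi>. of_real C * k \<xi>)" using kint by (rule integrable_mult_right)
    show "A \<in> borel_measurable lborel" unfolding A_def using cFm km by simp
    show "AE \<xi> in lborel. norm (A \<xi>) \<le> norm (of_real C * k \<xi>)"
      using Fb C0 by (intro AE_I2) (simp add: A_def norm_mult mult_right_mono)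
  qed
  define g where "g y = cnj (f (- y))" for y
  have gint: "integrable lborel g"
    unfolding g_def using lborel_integrable_real_affine[OF f, of "-1" 0] by (intro integrable_cnj) simp
  have FA: "fourier_int A x = (LINT z|lborel. cnj (f (x - s * z)) * of_real (std_normal_density z))" for x
  proof -
    define B where "B \<xi> = exp (- \<i> * of_real (\<xi> * x)) * k \<xi>" for \<xi>
    have Bint: "integrable lborel B" unfolding B_def by (rule fourier_integrable[OF kint])
    have FB: "fourier_int B y = of_real (std_normal_density ((x + y) / s) * c / s)" for y
    proof -
      have "(LINT \<xi>|lborel. exp (- \<i> * of_real (\<xi> * y)) * B \<xi>) = (LINT \<xi>|lborel. exp (- \<i> * of_real (\<xi> * (x + y))) * k \<xi>)"
      proof (rule Bochner_Integration.integral_cong[OF refl])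
        fix \<xi>
        have "- \<i> * complex_of_real (\<xi> * (x + y)) = - \<i> * of_real (\<xi> * y) + - \<i> * of_real (\<xi> * x)"
          by (simp add: algebra_simps)
        then show "exp (- \<i> * of_real (\<xi> * y)) * B \<xi> = exp (- \<i> * of_real (\<xi> * (x + y))) * k \<xi>"
          unfolding B_def by (simp only: exp_add mult.assoc)
      qed
      also have "\<dots> = of_real (2 * pi / s * std_normal_density ((x + y) / s))"
        unfolding k_def by (rule gaussian_fourier[OF s])
      finally have "fourier_int B y = of_real (2 * pi / s * std_normal_density ((x + y) / s)) / of_real c"
        unfolding fourier_int_def c_def by (simp only:)
      also have "\<dots> = of_real (2 * pi / s * std_normal_density ((x + y) / s) / c)" by (simp only: of_real_divide)
      also have "2 * pi / s * std_normal_density ((x + y) / s) / c = std_normal_density ((x + y) / s) * c / s"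
        unfolding c(2)[symmetric] using c(1) s by (simp add: field_simps)
      finally show ?thesis .
    qed
    have "fourier_int A x = (LINT \<xi>|lborel. fourier_int g \<xi> * B \<xi>) / of_real c"
    proof -
      have "exp (- \<i> * of_real (\<xi> * x)) * A \<xi> = fourier_int g \<xi> * B \<xi>" for \<xi>
        unfolding A_def B_def g_def cnj_fourier_int by (simp only: mult.left_commute)
      then show ?thesis unfolding fourier_int_def[of A] c_def by (simp only:)
    qed
    also have "(LINT \<xi>|lborel. fourier_int g \<xi> * B \<xi>) = (LINT y|lborel. g y * fourier_int B y)"
      by (rule fourier_int_mult_formula[OF gint Bint])
    also have "\<dots> / of_real c = (LINT y|lborel. g y * of_real (std_normal_density ((x + y) / s) / s))"
    proof -
      have "g y * fourier_int B y = (g y * of_real (std_normal_density ((x + y) / s) / s)) * of_real c" for y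
        unfolding FB by simp
      then have "(LINT y|lborel. g y * fourier_int B y) = (LINT y|lborel. g y * of_real (std_normal_density ((x + y) / s) / s)) * of_real c"
        by (simp only: integral_mult_left_zero)
      then show ?thesis using c(1) by simp
    qed
    also have "\<dots> = \<bar>s\<bar> *\<^sub>R (LINT z|lborel. g (- x + s * z) * of_real (std_normal_density ((x + (- x + s * z)) / s) / s))"
      using s by (intro lborel_integral_real_affine) simp
    also have "\<dots> = (LINT z|lborel. \<bar>s\<bar> *\<^sub>R (g (- x + s * z) * of_real (std_normal_density ((x + (- x + s * z)) / s) / s)))"
      by (rule integral_scaleR_right[symmetric])
    also have "\<dots> = (LINT z|lborel. cnj (f (x - s * z)) * of_real (std_normal_density z))"
      using s by (intro Bochner_Integration.integral_cong) (simp_all add: g_def scaleR_conv_of_real)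
    finally show ?thesis .
  qed
  define \<kappa> where "\<kappa> z x = of_real (std_normal_density z) * (f x * cnj (f (x - s * z)))" for z x
  have \<kappa>m: "case_prod \<kappa> \<in> borel_measurable (lborel \<Otimes>\<^sub>M lborel)"
  proof -
    have "(\<lambda>p. complex_of_real (std_normal_density (fst p))) \<in> borel_measurable (lborel \<Otimes>\<^sub>M lborel :: (real \<times> real) measure)"
      by (rule measurable_compose[OF measurable_fst, where g="\<lambda>z. complex_of_real (std_normal_density z)"]) simp
    from borel_measurable_times[OF this autocorrelation_measurable(1)[OF fm, of s]]
    show ?thesis by (simp add: \<kappa>_def case_prod_unfold)
  qed
  have \<kappa>n: "cmod (\<kappa> z x) = std_normal_density z * cmod (f x * cnj (f (x - s * z)))" for z x
    by (simp add: \<kappa>_def norm_mult)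
  have prodint: "integrable lborel (\<lambda>x. f x * cnj (f (x - a)))" for a
    by (intro L2_mult_integrable f2 L2_cnj L2_translate)
  have \<kappa>int: "integrable (lborel \<Otimes>\<^sub>M lborel) (case_prod \<kappa>)"
  proof (rule lborel_pair.Fubini_integrable[OF \<kappa>m])
    show "integrable lborel (\<lambda>z. LINT x|lborel. norm (case_prod \<kappa> (z, x)))"
    proof (rule Bochner_Integration.integrable_bound)
      show "integrable lborel (\<lambda>z. std_normal_density z * (Lp_norm 2 f)\<^sup>2)"
        by (intro integrable_mult_left integrable_normal_density) simp
      have "(\<lambda>p. norm (case_prod \<kappa> p)) \<in> borel_measurable (lborel \<Otimes>\<^sub>M lborel)"
        by (rule measurable_compose[OF \<kappa>m]) simp
      then show "(\<lambda>z. LINT x|lborel. norm (case_prod \<kappa> (z, x))) \<in> borel_measurable lborel"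
        by (intro lborel.borel_measurable_lebesgue_integral) (simp add: case_prod_unfold)
      show "AE z in lborel. norm (LINT x|lborel. norm (case_prod \<kappa> (z, x))) \<le> norm (std_normal_density z * (Lp_norm 2 f)\<^sup>2)"
        using autocorrelation_bound(2)[OF f2] by (intro AE_I2) (simp add: \<kappa>n mult_left_mono)
    qed
    show "AE z in lborel. integrable lborel (\<lambda>x. case_prod \<kappa> (z, x))"
      by (simp add: \<kappa>_def prodint)
  qed
  have "complex_of_real (LINT \<xi>|lborel. (cmod (fourier_int f \<xi>))\<^sup>2 * exp (- (s * \<xi>)\<^sup>2 / 2))
      = (LINT \<xi>|lborel. fourier_int f \<xi> * A \<xi>)"
    unfolding integral_complex_of_real[symmetric]
    by (rule Bochner_Integration.integral_cong)
       (simp_all only: A_def k_def of_real_mult complex_norm_square mult.assoc)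
  also have "\<dots> = (LINT x|lborel. f x * fourier_int A x)" by (rule fourier_int_mult_formula[OF f Aint])
  also have "\<dots> = (LINT x|lborel. LINT z|lborel. \<kappa> z x)"
  proof (rule Bochner_Integration.integral_cong[OF refl])
    fix x
    have "f x * fourier_int A x = (LINT z|lborel. f x * (cnj (f (x - s * z)) * of_real (std_normal_density z)))"
      unfolding FA by (rule integral_mult_right_zero[symmetric])
    also have "\<dots> = (LINT z|lborel. \<kappa> z x)"
      by (rule Bochner_Integration.integral_cong) (simp_all add: \<kappa>_def)
    finally show "f x * fourier_int A x = (LINT z|lborel. \<kappa> z x)" .
  qed
  also have "\<dots> = (LINT z|lborel. LINT x|lborel. \<kappa> z x)"
    by (rule lborel_pair.Fubini_integral[OF \<kappa>int])
  also have "\<dots> = (LINT z|lborel. of_real (std_normal_density z) * autocorrelation f (s * z))"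
    unfolding \<kappa>_def autocorrelation_def by (simp only: integral_mult_right_zero)
  finally show "complex_of_real (LINT \<xi>|lborel. (cmod (fourier_int f \<xi>))\<^sup>2 * exp (- (s * \<xi>)\<^sup>2 / 2))
      = (LINT z|lborel. of_real (std_normal_density z) * autocorrelation f (s * z))" .
qed

lemma gaussian_autocorrelation_integrable:
  assumes "mem_Lp 2 f"
  shows "integrable lborel (\<lambda>z. complex_of_real (std_normal_density z) * autocorrelation f (s * z))"
proof (rule Bochner_Integration.integrable_bound)
  show "integrable lborel (\<lambda>z. std_normal_density z * (Lp_norm 2 f)\<^sup>2)"
    by (intro integrable_mult_left integrable_normal_density) simp
  have "(\<lambda>z. autocorrelation f (s * z)) \<in> borel_measurable borel"
    by (rule measurable_compose[OF _ autocorrelation_measurable(2)[OF L2_measurable[OF assms]]]) simp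
  then show "(\<lambda>z. complex_of_real (std_normal_density z) * autocorrelation f (s * z)) \<in> borel_measurable lborel"
    by simp
  show "AE z in lborel. norm (complex_of_real (std_normal_density z) * autocorrelation f (s * z)) \<le> norm (std_normal_density z * (Lp_norm 2 f)\<^sup>2)"
    using autocorrelation_bound(1)[OF assms] by (intro AE_I2) (simp add: norm_mult mult_left_mono)
qed

text \<open>The autocorrelation is bounded by \<open>\<parallel>f\<parallel>\<^sup>2\<close> and the normal density has integral
  \<open>1\<close>, so the Gaussian means of \<open>\<bar>F f\<bar>\<^sup>2\<close> are at most
  \<open>\<parallel>f\<parallel>\<^sup>2\<close>; Fatou's lemma removes the Gaussian.\<close>

lemma Bessel_fourier_int:
  assumes f: "integrable lborel f" and f2: "mem_Lp 2 f"
  shows "mem_Lp 2 (fourier_int f)" "Lp_norm 2 (fourier_int f) \<le> Lp_norm 2 f"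
proof -
  define s where "s n = 1 / (real n + 1)" for n
  have s: "s n > 0" for n by (simp add: s_def)
  have sl: "s \<longlonglongrightarrow> 0" unfolding s_def using LIMSEQ_inverse_real_of_nat by (simp add: inverse_eq_divide add.commute)
  define F where "F n \<xi> = of_real (exp (- (s n * \<xi>)\<^sup>2 / 4)) * fourier_int f \<xi>" for n \<xi>
  have Fm: "fourier_int f \<in> borel_measurable borel" using f by (intro fourier_int_measurable) auto
  have Fnm: "F n \<in> borel_measurable borel" for n
  proof -
    have "(\<lambda>\<xi>. complex_of_real (exp (- (s n * \<xi>)\<^sup>2 / 4))) \<in> borel_measurable borel"
      by (intro borel_measurable_continuous_onI continuous_intros) auto
    from borel_measurable_times[OF this Fm] show ?thesis unfolding F_def .
  qed
  have sq: "(cmod (F n \<xi>))\<^sup>2 = (cmod (fourier_int f \<xi>))\<^sup>2 * exp (- (s n * \<xi>)\<^sup>2 / 2)" for n \<xi>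
  proof -
    have "(exp (- (s n * \<xi>)\<^sup>2 / 4))\<^sup>2 = exp (- (s n * \<xi>)\<^sup>2 / 2)"
      by (simp only: exp_double[symmetric]) simp
    then show ?thesis by (simp add: F_def norm_mult power_mult_distrib)
  qed
  have mem: "mem_Lp 2 (F n)" for n
    using gaussian_identity(1)[OF f f2 s[of n]] Fnm[of n] unfolding sq[symmetric] by (simp add: mem_Lp_2_iff)
  have bnd: "Lp_norm 2 (F n) \<le> Lp_norm 2 f" for n
  proof -
    have "complex_of_real ((Lp_norm 2 (F n))\<^sup>2) = (LINT z|lborel. of_real (std_normal_density z) * autocorrelation f (s n * z))"
      unfolding L2_norm_sq sq by (rule gaussian_identity(2)[OF f f2 s])
    then have "(Lp_norm 2 (F n))\<^sup>2 = cmod (LINT z|lborel. of_real (std_normal_density z) * autocorrelation f (s n * z))"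
      by (metis abs_of_nonneg norm_of_real zero_le_power2)
    also have "\<dots> \<le> (LINT z|lborel. cmod (of_real (std_normal_density z) * autocorrelation f (s n * z)))"
      by (rule integral_norm_bound)
    also have "\<dots> \<le> (LINT z|lborel. std_normal_density z * (Lp_norm 2 f)\<^sup>2)"
    proof (rule integral_mono)
      show "integrable lborel (\<lambda>z. cmod (of_real (std_normal_density z) * autocorrelation f (s n * z)))"
        by (rule integrable_norm[OF gaussian_autocorrelation_integrable[OF f2]])
      show "integrable lborel (\<lambda>z. std_normal_density z * (Lp_norm 2 f)\<^sup>2)"
        by (intro integrable_mult_left integrable_normal_density) simp
      show "cmod (of_real (std_normal_density z) * autocorrelation f (s n * z)) \<le> std_normal_density z * (Lp_norm 2 f)\<^sup>2" for z
        using autocorrelation_bound(1)[OF f2] by (simp add: norm_mult mult_left_mono)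
    qed
    also have "\<dots> = (Lp_norm 2 f)\<^sup>2" by simp
    finally show ?thesis by (rule power2_le_imp_le) simp
  qed
  have lim: "AE \<xi> in lborel. (\<lambda>n. F n \<xi>) \<longlonglongrightarrow> fourier_int f \<xi>"
  proof (rule AE_I2)
    fix \<xi>
    have "(\<lambda>n. of_real (exp (- (s n * \<xi>)\<^sup>2 / 4)) * fourier_int f \<xi>) \<longlonglongrightarrow> of_real (exp (- (0 * \<xi>)\<^sup>2 / 4)) * fourier_int f \<xi>"
      by (intro tendsto_intros sl) simp
    then show "(\<lambda>n. F n \<xi>) \<longlonglongrightarrow> fourier_int f \<xi>" by (simp add: F_def)
  qed
  show "mem_Lp 2 (fourier_int f)" "Lp_norm 2 (fourier_int f) \<le> Lp_norm 2 f"
    by (rule L2_Fatou[OF mem Fm lim, of "Lp_norm 2 f"]; simp add: bnd)+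
qed

text \<open>The reverse of Bessel's inequality needs the autocorrelation to be continuous at \<open>0\<close>. For bounded
  \<open>f\<close> this follows from the continuity of translations in \<open>L\<^sup>1\<close>, because
  \<open>\<bar>\<integral> f(x) cnj (f(x - a) - f(x)) dx\<bar> \<le> M \<integral> \<bar>f(x - a) - f(x)\<bar>
  dx\<close>. Bounded integrable functions are dense, so this case suffices.\<close>

lemma Plancherel_bounded:
  assumes f: "integrable lborel f" and b: "\<And>x. cmod (f x) \<le> M"
  shows "mem_Lp 2 f" "Lp_norm 2 (fourier_int f) = Lp_norm 2 f"
proof -
  have fm: "f \<in> borel_measurable borel" using f by auto
  have M: "0 \<le> M" using b norm_ge_zero order_trans by blast
  have "integrable lborel (\<lambda>x. (cmod (f x))\<^sup>2)"
  proof (rule Bochner_Integration.integrable_bound)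
    show "integrable lborel (\<lambda>x. M * cmod (f x))" using f by (intro integrable_mult_right integrable_norm)
    show "(\<lambda>x. (cmod (f x))\<^sup>2) \<in> borel_measurable lborel" using fm by simp
    show "AE x in lborel. norm ((cmod (f x))\<^sup>2) \<le> norm (M * cmod (f x))"
      using b M by (intro AE_I2) (simp add: power2_eq_square mult_right_mono)
  qed
  then show f2: "mem_Lp 2 f" using fm by (simp add: mem_Lp_2_iff)
  note F = Bessel_fourier_int[OF f f2]
  have cont: "(\<lambda>n. autocorrelation f (a n)) \<longlonglongrightarrow> of_real ((Lp_norm 2 f)\<^sup>2)" if a: "a \<longlonglongrightarrow> 0" for a
  proof -
    have a0: "of_real ((Lp_norm 2 f)\<^sup>2) = (LINT x|lborel. f x * cnj (f x))"
      unfolding L2_norm_sq integral_complex_of_real[symmetric] by (simp only: complex_norm_square)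
    have "cmod (autocorrelation f (a n) - of_real ((Lp_norm 2 f)\<^sup>2)) \<le> M * (LINT x|lborel. cmod (f (x - a n) - f x))" for n
    proof -
      have i: "integrable lborel (\<lambda>x. f x * cnj (f (x - a n)))" "integrable lborel (\<lambda>x. f x * cnj (f x))"
        by (intro L2_mult_integrable f2 L2_cnj L2_translate)+
      have "autocorrelation f (a n) - of_real ((Lp_norm 2 f)\<^sup>2) = (LINT x|lborel. f x * cnj (f (x - a n)) - f x * cnj (f x))"
        unfolding autocorrelation_def a0 using i by (rule Bochner_Integration.integral_diff[symmetric])
      also have "cmod \<dots> \<le> (LINT x|lborel. cmod (f x * cnj (f (x - a n)) - f x * cnj (f x)))"
        by (rule integral_norm_bound)
      also have "\<dots> \<le> (LINT x|lborel. M * cmod (f (x - a n) - f x))"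
      proof (rule integral_mono)
        show "integrable lborel (\<lambda>x. cmod (f x * cnj (f (x - a n)) - f x * cnj (f x)))"
          using i by (intro integrable_norm Bochner_Integration.integrable_diff)
        show "integrable lborel (\<lambda>x. M * cmod (f (x - a n) - f x))"
          by (intro integrable_mult_right integrable_norm Bochner_Integration.integrable_diff integrable_translate f)
        fix x
        have "f x * cnj (f (x - a n)) - f x * cnj (f x) = f x * cnj (f (x - a n) - f x)"
          by (simp add: right_diff_distrib)
        then have "cmod (f x * cnj (f (x - a n)) - f x * cnj (f x)) = cmod (f x) * cmod (f (x - a n) - f x)"
          by (simp only: norm_mult complex_mod_cnj)
        then show "cmod (f x * cnj (f (x - a n)) - f x * cnj (f x)) \<le> M * cmod (f (x - a n) - f x)"
          using b[of x] by (simp add: mult_right_mono)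
      qed
      finally show ?thesis by simp
    qed
    from Lim_null_comparison[OF always_eventually[OF allI[OF this]]
        tendsto_mult_right_zero[OF integrable_translation_continuous[OF f a]]]
    have "(\<lambda>n. autocorrelation f (a n) - of_real ((Lp_norm 2 f)\<^sup>2)) \<longlonglongrightarrow> 0" .
    then show ?thesis by (rule LIM_zero_cancel)
  qed
  define s where "s n = 1 / (real n + 1)" for n
  have s: "s n > 0" for n by (simp add: s_def)
  have sl: "s \<longlonglongrightarrow> 0" unfolding s_def using LIMSEQ_inverse_real_of_nat by (simp add: inverse_eq_divide add.commute)
  have "(\<lambda>n. LINT z|lborel. of_real (std_normal_density z) * autocorrelation f (s n * z))
     \<longlonglongrightarrow> (LINT z|lborel. complex_of_real (std_normal_density z) * of_real ((Lp_norm 2 f)\<^sup>2))"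
  proof (rule integral_dominated_convergence[where w="\<lambda>z. std_normal_density z * (Lp_norm 2 f)\<^sup>2"])
    show "(\<lambda>z. complex_of_real (std_normal_density z) * of_real ((Lp_norm 2 f)\<^sup>2)) \<in> borel_measurable lborel" by simp
    show "(\<lambda>z. complex_of_real (std_normal_density z) * autocorrelation f (s n * z)) \<in> borel_measurable lborel" for n
      by (rule borel_measurable_integrable[OF gaussian_autocorrelation_integrable[OF f2]])
    show "integrable lborel (\<lambda>z. std_normal_density z * (Lp_norm 2 f)\<^sup>2)"
      by (intro integrable_mult_left integrable_normal_density) simp
    show "AE z in lborel. (\<lambda>n. complex_of_real (std_normal_density z) * autocorrelation f (s n * z))
        \<longlonglongrightarrow> complex_of_real (std_normal_density z) * of_real ((Lp_norm 2 f)\<^sup>2)"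
      by (intro AE_I2 tendsto_mult_left cont tendsto_mult_left_zero sl)
    show "AE z in lborel. norm (complex_of_real (std_normal_density z) * autocorrelation f (s n * z)) \<le> std_normal_density z * (Lp_norm 2 f)\<^sup>2" for n
      using autocorrelation_bound(1)[OF f2] by (intro AE_I2) (simp add: norm_mult mult_left_mono)
  qed
  also have "(LINT z|lborel. complex_of_real (std_normal_density z) * of_real ((Lp_norm 2 f)\<^sup>2)) = of_real ((Lp_norm 2 f)\<^sup>2)"
    unfolding of_real_mult[symmetric] integral_complex_of_real by simp
  finally have lim: "(\<lambda>n. LINT \<xi>|lborel. (cmod (fourier_int f \<xi>))\<^sup>2 * exp (- (s n * \<xi>)\<^sup>2 / 2)) \<longlonglongrightarrow> (Lp_norm 2 f)\<^sup>2"
    unfolding gaussian_identity(2)[OF f f2 s, symmetric] by (simp only: tendsto_of_real_iff)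
  have "(LINT \<xi>|lborel. (cmod (fourier_int f \<xi>))\<^sup>2 * exp (- (s n * \<xi>)\<^sup>2 / 2)) \<le> (Lp_norm 2 (fourier_int f))\<^sup>2" for n
    unfolding L2_norm_sq
    by (rule integral_mono[OF gaussian_identity(1)[OF f f2 s] L2_integrable_sq[OF F(1)]]) (simp add: mult_left_le)
  then have "(Lp_norm 2 f)\<^sup>2 \<le> (Lp_norm 2 (fourier_int f))\<^sup>2"
    by (intro LIMSEQ_le_const2[OF lim]) auto
  then have "Lp_norm 2 f \<le> Lp_norm 2 (fourier_int f)" by (rule power2_le_imp_le) simp
  with F(2) show "Lp_norm 2 (fourier_int f) = Lp_norm 2 f" by simp
qed

section \<open>The Fourier transform of square integrable functions\<close>

lemma indicator_interval_L2: "mem_Lp 2 (indicator {- r..r} :: real \<Rightarrow> complex)"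
proof -
  have "integrable lborel (indicator {- r..r} :: real \<Rightarrow> real)"
    by (intro integrable_real_indicator) (auto simp: emeasure_lborel_Icc_eq)
  moreover have "(cmod (indicator {- r..r} x))\<^sup>2 = indicator {- r..r} x" for x :: real
    by (simp add: indicator_def)
  ultimately show ?thesis by (simp add: mem_Lp_2_iff)
qed

definition truncate :: "real \<Rightarrow> (real \<Rightarrow> complex) \<Rightarrow> real \<Rightarrow> complex" where
  "truncate r f x = indicator {- r..r} x * f x"

lemma truncate:
  assumes "mem_Lp 2 f"
  shows truncate_integrable: "integrable lborel (truncate r f)" and truncate_L2: "mem_Lp 2 (truncate r f)"
    and truncate_tendsto: "((\<lambda>r. L2_dist (truncate r f) f) \<longlongrightarrow> 0) at_top"
proof -
  show "integrable lborel (truncate r f)"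
    unfolding truncate_def[abs_def] by (rule L2_mult_integrable[OF indicator_interval_L2 assms])
  then show "mem_Lp 2 (truncate r f)"
    by (intro L2_dominated(1)[OF assms, where K=1]) (auto simp: truncate_def indicator_def)
  have "((\<lambda>r. indicator {- r..r} x :: real) \<longlongrightarrow> 1) at_top" for x :: real
  proof (rule tendsto_eventually)
    show "\<forall>\<^sub>F r in at_top. (indicator {- r..r} x :: real) = 1"
      using eventually_ge_at_top[of "\<bar>x\<bar>"] by eventually_elim (auto simp: indicator_def)
  qed
  then have "((\<lambda>r. Lp_norm 2 (\<lambda>x. (indicator {- r..r} x :: real) *\<^sub>R f x - f x)) \<longlongrightarrow> 0) at_top"
    by (intro L2_cutoff_tendsto[OF assms]) (auto simp: indicator_def)
  moreover have "(indicator {- r..r} x :: real) *\<^sub>R f x = truncate r f x" for r x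
    by (simp add: truncate_def indicator_def)
  ultimately show "((\<lambda>r. L2_dist (truncate r f) f) \<longlongrightarrow> 0) at_top" by simp
qed

lemma L2_zero_if_small:
  assumes "\<And>r::real. Lp_norm 2 D \<le> b r" "(b \<longlongrightarrow> 0) at_top"
  shows "Lp_norm 2 D = 0"
  by (intro antisym Lp_norm_nonneg tendsto_lowerbound[OF assms(2)] always_eventually allI assms(1)) simp

lemma fourier_int_diff_le:
  assumes "integrable lborel f" "mem_Lp 2 f" "integrable lborel g" "mem_Lp 2 g"
  shows "L2_dist (fourier_int f) (fourier_int g) \<le> L2_dist f g"
  unfolding fourier_int_diff[OF assms(1,3), symmetric]
  by (intro Bessel_fourier_int(2) Bochner_Integration.integrable_diff L2_diff assms)

text \<open>Bessel's inequality makes all functions involved square integrable, so the nonnegative integral in the definition is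
  the square of a norm.\<close>

lemma has_fourier_iff:
  assumes "mem_Lp 2 f"
  shows "has_fourier f g \<longleftrightarrow> mem_Lp 2 g \<and> ((\<lambda>r. L2_dist (fourier_int (truncate r f)) g) \<longlongrightarrow> 0) at_top"
proof (cases "mem_Lp 2 g")
  case True
  define N where "N r = L2_dist (fourier_int (truncate r f)) g" for r
  have "(\<integral>\<^sup>+\<xi>. ennreal ((cmod (fourier_int (truncate r f) \<xi> - g \<xi>))\<^sup>2) \<partial>lborel) = ennreal ((N r)\<^sup>2)" for r
    unfolding N_def by (intro L2_nn_integral L2_diff Bessel_fourier_int truncate assms True)
  then have "has_fourier f g \<longleftrightarrow> ((\<lambda>r. ennreal ((N r)\<^sup>2)) \<longlongrightarrow> ennreal 0) at_top"
    using True unfolding has_fourier_def truncate_def[abs_def] by simp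
  also have "\<dots> \<longleftrightarrow> ((\<lambda>r. (N r)\<^sup>2) \<longlongrightarrow> 0) at_top" by (rule tendsto_ennreal_iff) auto
  also have "\<dots> \<longleftrightarrow> (N \<longlongrightarrow> 0) at_top"
  proof
    assume "((\<lambda>r. (N r)\<^sup>2) \<longlongrightarrow> 0) at_top"
    then have "((\<lambda>r. sqrt ((N r)\<^sup>2)) \<longlongrightarrow> sqrt 0) at_top" by (rule tendsto_real_sqrt)
    moreover have "sqrt ((N r)\<^sup>2) = N r" for r by (simp add: N_def)
    ultimately show "(N \<longlongrightarrow> 0) at_top" by simp
  next
    assume "(N \<longlongrightarrow> 0) at_top"
    then have "((\<lambda>r. (N r)\<^sup>2) \<longlongrightarrow> 0\<^sup>2) at_top" by (rule tendsto_power)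
    then show "((\<lambda>r. (N r)\<^sup>2) \<longlongrightarrow> 0) at_top" by simp
  qed
  also have "N = (\<lambda>r. L2_dist (fourier_int (truncate r f)) g)"
    by (simp add: N_def fun_eq_iff)
  finally show ?thesis using True by blast
qed (simp add: has_fourier_def)

text \<open>By Bessel's inequality the Fourier integrals of the truncations form a Cauchy family, because the truncations
  themselves do.\<close>

lemma has_fourier_exists:
  assumes f: "mem_Lp 2 f"
  shows "\<exists>g. has_fourier f g"
proof -
  define T where "T r = L2_dist (truncate r f) f" for r
  have T: "(T \<longlongrightarrow> 0) at_top" unfolding T_def by (rule truncate_tendsto[OF f])
  have Tn: "(\<lambda>n. T (real n)) \<longlonglongrightarrow> 0"
    by (rule filterlim_compose[OF T filterlim_real_sequentially])
  have le: "L2_dist (fourier_int (truncate r f)) (fourier_int (truncate s f)) \<le> T r + T s" for r s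
  proof -
    have "L2_dist (fourier_int (truncate r f)) (fourier_int (truncate s f)) \<le> L2_dist (truncate r f) (truncate s f)"
      by (intro fourier_int_diff_le truncate f)
    also have "\<dots> \<le> L2_dist (truncate r f) f + L2_dist f (truncate s f)"
      by (intro L2_triangle truncate f)
    also have "\<dots> = T r + T s" unfolding T_def L2_norm_minus[of f] ..
    finally show ?thesis .
  qed
  have mem: "mem_Lp 2 (fourier_int (truncate r f))" for r
    by (intro Bessel_fourier_int truncate f)
  obtain g where g: "mem_Lp 2 g" "(\<lambda>n. L2_dist (fourier_int (truncate (real n) f)) g) \<longlonglongrightarrow> 0"
  proof (rule L2_complete[of "\<lambda>n. fourier_int (truncate (real n) f)"])
    fix e :: real assume "e > 0"
    then obtain N where N: "\<And>n. n \<ge> N \<Longrightarrow> T (real n) < e / 2"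
      using LIMSEQ_D[OF Tn, of "e/2"] by fastforce
    have "L2_dist (fourier_int (truncate (real m) f)) (fourier_int (truncate (real n) f)) \<le> e" if "m \<ge> N" "n \<ge> N" for m n
      using le[of "real m" "real n"] N[OF that(1)] N[OF that(2)] by linarith
    then show "\<exists>N. \<forall>m\<ge>N. \<forall>n\<ge>N. L2_dist (fourier_int (truncate (real m) f)) (fourier_int (truncate (real n) f)) \<le> e"
      by blast
  qed (use mem in auto)
  have "L2_dist (fourier_int (truncate r f)) g \<le> T r" for r
  proof (rule LIMSEQ_le_const)
    show "(\<lambda>n. (T r + T (real n)) + L2_dist (fourier_int (truncate (real n) f)) g) \<longlonglongrightarrow> T r"
      using tendsto_add[OF tendsto_add[OF tendsto_const Tn] g(2), of "T r"] by simp
    have "L2_dist (fourier_int (truncate r f)) g \<le> T r + T (real n) + L2_dist (fourier_int (truncate (real n) f)) g" for n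
      using L2_triangle[OF mem[of r] mem[of "real n"] g(1)] le[of r "real n"] by linarith
    then show "\<exists>N. \<forall>n\<ge>N. L2_dist (fourier_int (truncate r f)) g \<le> T r + T (real n) + L2_dist (fourier_int (truncate (real n) f)) g"
      by blast
  qed
  then have "((\<lambda>r. L2_dist (fourier_int (truncate r f)) g) \<longlongrightarrow> 0) at_top"
    by (intro tendsto_sandwich[OF _ _ tendsto_const T]) auto
  then show ?thesis using has_fourier_iff[OF f] g(1) by blast
qed

lemma fourier:
  assumes "mem_Lp 2 f"
  shows fourier_L2: "mem_Lp 2 (fourier f)"
    and fourier_tendsto: "((\<lambda>r. L2_dist (fourier_int (truncate r f)) (fourier f)) \<longlongrightarrow> 0) at_top"
  using someI_ex[OF has_fourier_exists[OF assms]] unfolding has_fourier_iff[OF assms] fourier_def by auto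

text \<open>Everything that is needed about the transform on \<open>L\<^sup>2\<close> is transferred from Fourier integrals by
  this estimate: any integrable approximation of \<open>f\<close> in norm gives an approximation of its transform.\<close>

lemma fourier_int_near:
  assumes h: "integrable lborel h" "mem_Lp 2 h" and f: "mem_Lp 2 f"
  shows "L2_dist (fourier_int h) (fourier f) \<le> L2_dist h f"
proof (rule tendsto_lowerbound)
  show "((\<lambda>r. L2_dist h f + L2_dist (truncate r f) f
       + L2_dist (fourier_int (truncate r f)) (fourier f)) \<longlongrightarrow> L2_dist h f) at_top"
    using tendsto_add[OF tendsto_add[OF tendsto_const truncate_tendsto[OF f]] fourier_tendsto[OF f]] by simp
  have "L2_dist (fourier_int h) (fourier f) \<le> L2_dist h f + L2_dist (truncate r f) f
       + L2_dist (fourier_int (truncate r f)) (fourier f)" for r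
  proof -
    note t = truncate(1,2)[OF f, of r]
    have "L2_dist (fourier_int h) (fourier f) \<le> L2_dist (fourier_int h) (fourier_int (truncate r f))
        + L2_dist (fourier_int (truncate r f)) (fourier f)"
      by (intro L2_triangle Bessel_fourier_int h t fourier f)
    moreover have "L2_dist (fourier_int h) (fourier_int (truncate r f)) \<le> L2_dist h (truncate r f)"
      by (intro fourier_int_diff_le h t)
    moreover have "L2_dist h (truncate r f) \<le> L2_dist h f + L2_dist f (truncate r f)"
      by (intro L2_triangle h t f)
    ultimately show ?thesis using L2_norm_minus[of f "truncate r f"] by linarith
  qed
  then show "\<forall>\<^sub>F r in at_top. L2_dist (fourier_int h) (fourier f) \<le> L2_dist h f + L2_dist (truncate r f) f
       + L2_dist (fourier_int (truncate r f)) (fourier f)" by simp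
qed simp

lemma fourier_eq_fourier_int:
  assumes "integrable lborel f" "mem_Lp 2 f"
  shows "AE \<xi> in lborel. fourier f \<xi> = fourier_int f \<xi>"
proof -
  have "L2_dist (fourier_int f) (fourier f) \<le> 0"
    using fourier_int_near[OF assms assms(2)] by (simp add: Lp_norm_def)
  then have "L2_dist (fourier_int f) (fourier f) = 0" by (intro antisym Lp_norm_nonneg)
  from L2_AE_eqI[OF Bessel_fourier_int(1)[OF assms] fourier_L2[OF assms(2)] this]
  show ?thesis by eventually_elim simp
qed

text \<open>The transform is determined only up to null sets, so its algebraic rules hold almost everywhere. They are checked on
  truncations.\<close>

lemma fourier_AE_eqI:
  assumes f: "mem_Lp 2 f" and g: "mem_Lp 2 g"
    and approx: "\<And>r. L2_dist (fourier_int (truncate r f)) g \<le> b r" and b: "(b \<longlongrightarrow> 0) at_top"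
  shows "AE \<xi> in lborel. fourier f \<xi> = g \<xi>"
proof (rule L2_AE_eqI[OF fourier_L2[OF f] g], rule L2_zero_if_small)
  fix r
  have "L2_dist (fourier f) g \<le> L2_dist (fourier f) (fourier_int (truncate r f))
     + L2_dist (fourier_int (truncate r f)) g"
    by (intro L2_triangle fourier Bessel_fourier_int truncate f g)
  also have "\<dots> \<le> L2_dist (fourier_int (truncate r f)) (fourier f) + b r"
    using approx[of r] L2_norm_minus[of "fourier f"] by simp
  finally show "L2_dist (fourier f) g \<le> L2_dist (fourier_int (truncate r f)) (fourier f) + b r" .
next
  show "((\<lambda>r. L2_dist (fourier_int (truncate r f)) (fourier f) + b r) \<longlongrightarrow> 0) at_top"
    using tendsto_add[OF fourier_tendsto[OF f] b] by simp
qed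

lemma fourier_add:
  assumes f: "mem_Lp 2 f" and g: "mem_Lp 2 g"
  shows "AE \<xi> in lborel. fourier (\<lambda>x. f x + g x) \<xi> = fourier f \<xi> + fourier g \<xi>"
proof (rule fourier_AE_eqI)
  fix r
  have "truncate r (\<lambda>x. f x + g x) = (\<lambda>x. truncate r f x + truncate r g x)"
    by (simp add: truncate_def fun_eq_iff distrib_left)
  then have "Lp_norm 2 (\<lambda>\<xi>. fourier_int (truncate r (\<lambda>x. f x + g x)) \<xi> - (fourier f \<xi> + fourier g \<xi>))
      = Lp_norm 2 (\<lambda>\<xi>. (fourier_int (truncate r f) \<xi> - fourier f \<xi>) + (fourier_int (truncate r g) \<xi> - fourier g \<xi>))"
    by (simp add: fourier_int_add truncate f g algebra_simps)
  also have "\<dots> \<le> L2_dist (fourier_int (truncate r f)) (fourier f) + L2_dist (fourier_int (truncate r g)) (fourier g)"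
    by (intro L2_add L2_diff Bessel_fourier_int truncate fourier f g)
  finally show "Lp_norm 2 (\<lambda>\<xi>. fourier_int (truncate r (\<lambda>x. f x + g x)) \<xi> - (fourier f \<xi> + fourier g \<xi>))
    \<le> L2_dist (fourier_int (truncate r f)) (fourier f) + L2_dist (fourier_int (truncate r g)) (fourier g)" .
next
  show "((\<lambda>r. L2_dist (fourier_int (truncate r f)) (fourier f) + L2_dist (fourier_int (truncate r g)) (fourier g)) \<longlongrightarrow> 0) at_top"
    using tendsto_add[OF fourier_tendsto[OF f] fourier_tendsto[OF g]] by simp
qed (intro L2_add fourier f g)+

lemma L2_cmult:
  fixes f :: "real \<Rightarrow> complex"
  assumes "mem_Lp 2 f"
  shows "mem_Lp 2 (\<lambda>x. c * f x)" "Lp_norm 2 (\<lambda>x. c * f x) \<le> cmod c * Lp_norm 2 f"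
  by (rule L2_dominated[OF assms, where K="cmod c"]; use L2_measurable[OF assms] in \<open>simp add: norm_mult\<close>)+

lemma fourier_cmult:
  assumes f: "mem_Lp 2 f"
  shows "AE \<xi> in lborel. fourier (\<lambda>x. c * f x) \<xi> = c * fourier f \<xi>"
proof (rule fourier_AE_eqI)
  fix r
  have "truncate r (\<lambda>x. c * f x) = (\<lambda>x. c * truncate r f x)"
    by (simp add: truncate_def fun_eq_iff)
  then have "Lp_norm 2 (\<lambda>\<xi>. fourier_int (truncate r (\<lambda>x. c * f x)) \<xi> - c * fourier f \<xi>)
      = Lp_norm 2 (\<lambda>\<xi>. c * (fourier_int (truncate r f) \<xi> - fourier f \<xi>))"
    by (simp add: fourier_int_cmult right_diff_distrib)
  also have "\<dots> \<le> cmod c * L2_dist (fourier_int (truncate r f)) (fourier f)"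
    by (intro L2_cmult L2_diff Bessel_fourier_int truncate fourier f)
  finally show "Lp_norm 2 (\<lambda>\<xi>. fourier_int (truncate r (\<lambda>x. c * f x)) \<xi> - c * fourier f \<xi>)
    \<le> cmod c * L2_dist (fourier_int (truncate r f)) (fourier f)" .
next
  show "((\<lambda>r. cmod c * L2_dist (fourier_int (truncate r f)) (fourier f)) \<longlongrightarrow> 0) at_top"
    by (rule tendsto_mult_right_zero[OF fourier_tendsto[OF f]])
qed (intro L2_cmult fourier f)+

lemma fourier_int_reflect: "fourier_int (\<lambda>x. f (- x)) \<xi> = fourier_int f (- \<xi>)"
proof -
  have "(LINT x|lborel. exp (- \<i> * of_real (x * (- \<xi>))) * f x) = (LINT x|lborel. exp (- \<i> * of_real ((0 + -1 * x) * (- \<xi>))) * f (0 + -1 * x))"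
    by (subst lborel_integral_real_affine[where c="-1" and t=0]) simp_all
  also have "\<dots> = (LINT x|lborel. exp (- \<i> * of_real (x * \<xi>)) * f (- x))" by simp
  finally show ?thesis by (simp add: fourier_int_def)
qed

lemma fourier_reflect:
  assumes f: "mem_Lp 2 f"
  shows "AE \<xi> in lborel. fourier (\<lambda>x. f (- x)) \<xi> = fourier f (- \<xi>)"
proof (rule fourier_AE_eqI[OF _ _ eq_refl fourier_tendsto[OF f]])
  fix r
  have "truncate r (\<lambda>x. f (- x)) = (\<lambda>x. truncate r f (- x))"
    by (auto simp add: truncate_def fun_eq_iff indicator_def)
  then have "Lp_norm 2 (\<lambda>\<xi>. fourier_int (truncate r (\<lambda>x. f (- x))) \<xi> - fourier f (- \<xi>))
      = Lp_norm 2 (\<lambda>\<xi>. (\<lambda>\<xi>. fourier_int (truncate r f) \<xi> - fourier f \<xi>) (- \<xi>))"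
    by (simp add: fourier_int_reflect)
  also have "\<dots> = L2_dist (fourier_int (truncate r f)) (fourier f)"
    by (rule L2_reflect) (intro L2_diff Bessel_fourier_int truncate fourier f)
  finally show "Lp_norm 2 (\<lambda>\<xi>. fourier_int (truncate r (\<lambda>x. f (- x))) \<xi> - fourier f (- \<xi>))
      = L2_dist (fourier_int (truncate r f)) (fourier f)" .
qed (intro L2_reflect fourier f)+

lemma fourier_cnj_reflect:
  assumes f: "mem_Lp 2 f"
  shows "AE \<xi> in lborel. fourier (\<lambda>x. cnj (f (- x))) \<xi> = cnj (fourier f \<xi>)"
proof (rule fourier_AE_eqI[OF _ _ eq_refl fourier_tendsto[OF f]])
  fix r
  have "truncate r (\<lambda>x. cnj (f (- x))) = (\<lambda>x. cnj (truncate r f (- x)))"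
    by (auto simp add: truncate_def fun_eq_iff indicator_def)
  then have "Lp_norm 2 (\<lambda>\<xi>. fourier_int (truncate r (\<lambda>x. cnj (f (- x)))) \<xi> - cnj (fourier f \<xi>))
      = Lp_norm 2 (\<lambda>\<xi>. cnj (fourier_int (truncate r f) \<xi> - fourier f \<xi>))"
    by (simp add: cnj_fourier_int)
  also have "\<dots> = L2_dist (fourier_int (truncate r f)) (fourier f)"
    by (simp only: Lp_norm_def complex_mod_cnj)
  finally show "Lp_norm 2 (\<lambda>\<xi>. fourier_int (truncate r (\<lambda>x. cnj (f (- x)))) \<xi> - cnj (fourier f \<xi>))
      = L2_dist (fourier_int (truncate r f)) (fourier f)" .
qed (intro L2_cnj L2_reflect fourier f)+

text \<open>Approximation by \<open>f\<close> cut off where its argument or its value is large, for which the identity is known.\<close>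

theorem Plancherel:
  assumes f: "mem_Lp 2 f"
  shows "Lp_norm 2 (fourier f) = Lp_norm 2 f"
proof -
  define c where "c r x = (indicator {x. \<bar>x\<bar> \<le> r \<and> cmod (f x) \<le> r} x :: real)" for r x
  have [measurable]: "f \<in> borel_measurable borel" by (rule L2_measurable[OF f])
  have cm: "c r \<in> borel_measurable borel" for r unfolding c_def by measurable
  have cl: "((\<lambda>r. c r x) \<longlongrightarrow> 1) at_top" for x
  proof (rule tendsto_eventually)
    show "\<forall>\<^sub>F r in at_top. c r x = 1"
      using eventually_ge_at_top[of "\<bar>x\<bar>"] eventually_ge_at_top[of "cmod (f x)"]
      by eventually_elim (auto simp: c_def indicator_def)
  qed
  define h where "h r x = c r x *\<^sub>R f x" for r x
  have T: "((\<lambda>r. L2_dist (h r) f) \<longlongrightarrow> 0) at_top"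
    unfolding h_def by (rule L2_cutoff_tendsto[OF f cm _ cl]) (simp add: c_def indicator_def)
  have h2: "mem_Lp 2 (h r)" for r
    by (rule L2_dominated(1)[OF f, where K=1])
       (use cm[of r] in \<open>auto simp: h_def[abs_def] c_def indicator_def\<close>)
  have hb: "cmod (h r x) \<le> \<bar>r\<bar>" for r x by (auto simp: h_def c_def indicator_def)
  have hint: "integrable lborel (h r)" for r
  proof -
    have "h r = truncate r (h r)" by (auto simp: h_def c_def truncate_def fun_eq_iff indicator_def)
    then show ?thesis using truncate_integrable[OF h2[of r], of r] by simp
  qed
  have "\<bar>Lp_norm 2 (fourier f) - Lp_norm 2 f\<bar> \<le> 0"
  proof (rule tendsto_lowerbound)
    show "((\<lambda>r. L2_dist (h r) f + L2_dist (h r) f) \<longlongrightarrow> 0) at_top"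
      using tendsto_add[OF T T] by simp
    have "\<bar>Lp_norm 2 (fourier f) - Lp_norm 2 f\<bar> \<le> L2_dist (h r) f + L2_dist (h r) f" for r
      using L2_norm_reverse_triangle[OF Bessel_fourier_int(1)[OF hint[of r] h2[of r]] fourier_L2[OF f]]
        L2_norm_reverse_triangle[OF h2[of r] f] fourier_int_near[OF hint[of r] h2[of r] f]
        Plancherel_bounded(2)[OF hint[of r] hb[of r]] by linarith
    then show "\<forall>\<^sub>F r in at_top. \<bar>Lp_norm 2 (fourier f) - Lp_norm 2 f\<bar> \<le> L2_dist (h r) f + L2_dist (h r) f"
      by simp
  qed simp
  then show ?thesis by simp
qed

lemma fourier_diff:
  assumes f: "mem_Lp 2 f" and g: "mem_Lp 2 g"
  shows "AE \<xi> in lborel. fourier (\<lambda>x. f x - g x) \<xi> = fourier f \<xi> - fourier g \<xi>"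
  using fourier_add[OF f L2_cmult(1)[OF g, of "-1"]] fourier_cmult[OF g, of "-1"]
  by eventually_elim simp

lemma fourier_dist:
  assumes f: "mem_Lp 2 f" and g: "mem_Lp 2 g"
  shows "L2_dist (fourier f) (fourier g) = L2_dist f g"
proof -
  have "L2_dist (fourier f) (fourier g) = Lp_norm 2 (fourier (\<lambda>x. f x - g x))"
  proof (rule L2_norm_cong_AE)
    show "AE \<xi> in lborel. cmod (fourier f \<xi> - fourier g \<xi>) = cmod (fourier (\<lambda>x. f x - g x) \<xi>)"
      using fourier_diff[OF f g] by eventually_elim simp
  qed (intro L2_measurable L2_diff fourier f g)+
  then show ?thesis by (simp only: Plancherel[OF L2_diff(1)[OF f g]])
qed

lemma fourier_cong_AE:
  assumes f: "mem_Lp 2 f" and g: "mem_Lp 2 g" and eq: "AE x in lborel. f x = g x"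
  shows "AE \<xi> in lborel. fourier f \<xi> = fourier g \<xi>"
proof (rule L2_AE_eqI)
  have "(LINT x|lborel. (cmod (f x - g x))\<^sup>2) = 0"
    by (rule integral_eq_zero_AE) (use eq in \<open>eventually_elim, simp\<close>)
  then show "L2_dist (fourier f) (fourier g) = 0"
    unfolding fourier_dist[OF f g] L2_norm_sq[symmetric] by simp
qed (intro fourier f g)+

lemma L2_norm_sq_add:
  fixes f g :: "real \<Rightarrow> complex"
  assumes f: "mem_Lp 2 f" and g: "mem_Lp 2 g"
  shows "(Lp_norm 2 (\<lambda>x. f x + g x))\<^sup>2 = (Lp_norm 2 f)\<^sup>2 + (Lp_norm 2 g)\<^sup>2 + 2 * Re (LINT x|lborel. cnj (f x) * g x)"
proof -
  have i: "integrable lborel (\<lambda>x. cnj (f x) * g x)" by (intro L2_mult_integrable L2_cnj f g)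
  define q where "q x = Re (cnj (f x) * g x)" for x
  have q: "integrable lborel q" "Re (LINT x|lborel. cnj (f x) * g x) = (LINT x|lborel. q x)"
    unfolding q_def by (rule integrable_Re[OF i], rule integral_Re[OF i, symmetric])
  have "(cmod (f x + g x))\<^sup>2 = (cmod (f x))\<^sup>2 + (cmod (g x))\<^sup>2 + 2 * q x" for x
    unfolding cmod_power2 q_def by (simp add: power2_eq_square algebra_simps)
  then show ?thesis unfolding L2_norm_sq q(2)
    using L2_integrable_sq[OF f] L2_integrable_sq[OF g] q(1) by simp
qed

text \<open>Polarization: the real parts agree by Plancherel's identity for \<open>f + g\<close>, and the imaginary parts by the
  same argument for \<open>-\<i> g\<close>.\<close>

theorem Parseval:
  assumes f: "mem_Lp 2 f" and g: "mem_Lp 2 g"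
  shows "(LINT \<xi>|lborel. cnj (fourier f \<xi>) * fourier g \<xi>) = (LINT x|lborel. cnj (f x) * g x)"
proof -
  have re: "Re (LINT \<xi>|lborel. cnj (fourier f \<xi>) * fourier g \<xi>) = Re (LINT x|lborel. cnj (f x) * g x)"
    if g: "mem_Lp 2 g" for g
  proof -
    have "Lp_norm 2 (\<lambda>\<xi>. fourier f \<xi> + fourier g \<xi>) = Lp_norm 2 (fourier (\<lambda>x. f x + g x))"
    proof (rule L2_norm_cong_AE)
      show "AE \<xi> in lborel. cmod (fourier f \<xi> + fourier g \<xi>) = cmod (fourier (\<lambda>x. f x + g x) \<xi>)"
        using fourier_add[OF f g] by eventually_elim simp
    qed (intro L2_measurable L2_add fourier f g)+
    also have "\<dots> = Lp_norm 2 (\<lambda>x. f x + g x)" by (rule Plancherel) (intro L2_add f g)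
    finally show ?thesis
      using L2_norm_sq_add[OF f g] L2_norm_sq_add[OF fourier_L2[OF f] fourier_L2[OF g]] Plancherel[OF f] Plancherel[OF g]
      by simp
  qed
  have "Im (LINT \<xi>|lborel. cnj (fourier f \<xi>) * fourier g \<xi>) = Im (LINT x|lborel. cnj (f x) * g x)"
  proof -
    have "(LINT \<xi>|lborel. cnj (fourier f \<xi>) * fourier (\<lambda>x. - \<i> * g x) \<xi>) = (LINT \<xi>|lborel. - \<i> * (cnj (fourier f \<xi>) * fourier g \<xi>))"
    proof (rule integral_cong_AE)
      show "AE \<xi> in lborel. cnj (fourier f \<xi>) * fourier (\<lambda>x. - \<i> * g x) \<xi> = - \<i> * (cnj (fourier f \<xi>) * fourier g \<xi>)"
        using fourier_cmult[OF g, of "- \<i>"] by eventually_elim (simp only: mult.left_commute)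
    qed (intro borel_measurable_integrable integrable_mult_right L2_mult_integrable L2_cnj L2_cmult fourier f g)+
    also have "\<dots> = - \<i> * (LINT \<xi>|lborel. cnj (fourier f \<xi>) * fourier g \<xi>)" by (rule integral_mult_right_zero)
    finally have 1: "Re (LINT \<xi>|lborel. cnj (fourier f \<xi>) * fourier (\<lambda>x. - \<i> * g x) \<xi>) = Im (LINT \<xi>|lborel. cnj (fourier f \<xi>) * fourier g \<xi>)"
      by simp
    have "(LINT x|lborel. cnj (f x) * (- \<i> * g x)) = - \<i> * (LINT x|lborel. cnj (f x) * g x)"
      by (simp only: integral_mult_right_zero mult.left_commute[of _ "- \<i>"])
    then have 2: "Re (LINT x|lborel. cnj (f x) * (- \<i> * g x)) = Im (LINT x|lborel. cnj (f x) * g x)" by simp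
    show ?thesis using re[OF L2_cmult(1)[OF g, of "- \<i>"]] 1 2 by simp
  qed
  with re[OF g] show ?thesis by (rule complex_eqI)
qed

lemma L2_mult_tendsto:
  fixes a b :: "real \<Rightarrow> real \<Rightarrow> complex"
  assumes a: "\<And>r. mem_Lp 2 (a r)" "mem_Lp 2 A" "((\<lambda>r. L2_dist (a r) A) \<longlongrightarrow> 0) at_top"
    and b: "\<And>r. mem_Lp 2 (b r)" "mem_Lp 2 B" "((\<lambda>r. L2_dist (b r) B) \<longlongrightarrow> 0) at_top"
  shows "((\<lambda>r. LINT x|lborel. a r x * b r x) \<longlongrightarrow> (LINT x|lborel. A x * B x)) at_top"
proof (rule LIM_zero_cancel, rule Lim_null_comparison)
  define \<alpha> \<beta> where "\<alpha> r = L2_dist (a r) A" and "\<beta> r = L2_dist (b r) B" for r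
  have "cmod ((LINT x|lborel. a r x * b r x) - (LINT x|lborel. A x * B x)) \<le> \<alpha> r * (\<beta> r + Lp_norm 2 B) + Lp_norm 2 A * \<beta> r" for r
  proof -
    note m = L2_diff(1)[OF a(1)[of r] a(2)] L2_diff(1)[OF b(1)[of r] b(2)]
    note i = L2_mult_integrable[OF m(1) b(1)[of r]] L2_mult_integrable[OF a(2) m(2)]
    have "(LINT x|lborel. a r x * b r x) - (LINT x|lborel. A x * B x) = (LINT x|lborel. a r x * b r x - A x * B x)"
      by (rule Bochner_Integration.integral_diff[symmetric]) (intro L2_mult_integrable a b)+
    also have "\<dots> = (LINT x|lborel. (a r x - A x) * b r x + A x * (b r x - B x))"
      by (rule Bochner_Integration.integral_cong) (simp_all add: algebra_simps)
    also have "\<dots> = (LINT x|lborel. (a r x - A x) * b r x) + (LINT x|lborel. A x * (b r x - B x))"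
      by (rule Bochner_Integration.integral_add[OF i])
    also have "cmod \<dots> \<le> \<alpha> r * Lp_norm 2 (b r) + Lp_norm 2 A * \<beta> r"
      unfolding \<alpha>_def \<beta>_def
      by (rule norm_triangle_mono[OF L2_mult_bound[OF m(1) b(1)] L2_mult_bound[OF a(2) m(2)]])
    also have "\<dots> \<le> \<alpha> r * (\<beta> r + Lp_norm 2 B) + Lp_norm 2 A * \<beta> r"
      using L2_norm_reverse_triangle[OF b(1)[of r] b(2)]
      by (intro add_right_mono mult_left_mono) (auto simp: \<alpha>_def \<beta>_def)
    finally show ?thesis .
  qed
  then show "\<forall>\<^sub>F r in at_top. cmod ((LINT x|lborel. a r x * b r x) - (LINT x|lborel. A x * B x)) \<le> \<alpha> r * (\<beta> r + Lp_norm 2 B) + Lp_norm 2 A * \<beta> r"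
    by simp
  have "((\<lambda>r. \<alpha> r * (\<beta> r + Lp_norm 2 B) + Lp_norm 2 A * \<beta> r) \<longlongrightarrow> 0 * (0 + Lp_norm 2 B) + Lp_norm 2 A * 0) at_top"
    unfolding \<alpha>_def \<beta>_def by (intro tendsto_intros a(3) b(3))
  then show "((\<lambda>r. \<alpha> r * (\<beta> r + Lp_norm 2 B) + Lp_norm 2 A * \<beta> r) \<longlongrightarrow> 0) at_top" by simp
qed

lemma fourier_mult_formula:
  assumes f: "mem_Lp 2 f" and g: "mem_Lp 2 g"
  shows "(LINT \<xi>|lborel. fourier f \<xi> * g \<xi>) = (LINT x|lborel. f x * fourier g x)"
proof (rule tendsto_unique)
  show "((\<lambda>r. LINT \<xi>|lborel. fourier_int (truncate r f) \<xi> * truncate r g \<xi>) \<longlongrightarrow> (LINT \<xi>|lborel. fourier f \<xi> * g \<xi>)) at_top"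
    by (intro L2_mult_tendsto Bessel_fourier_int truncate fourier f g)
  show "((\<lambda>r. LINT \<xi>|lborel. fourier_int (truncate r f) \<xi> * truncate r g \<xi>) \<longlongrightarrow> (LINT x|lborel. f x * fourier g x)) at_top"
    unfolding fourier_int_mult_formula[OF truncate_integrable[OF f] truncate_integrable[OF g]]
    by (intro L2_mult_tendsto Bessel_fourier_int truncate fourier f g)
qed simp

text \<open>Write \<open>F\<close> for the transform and \<open>J\<close> for the reflection. The multiplication formula says
  that \<open>J F\<close> is the adjoint of \<open>F\<close>, and Parseval's identity that \<open>F\<close> is an
  isometry; so \<open>J F F\<close> is the identity.\<close>

theorem fourier_inversion:
  assumes h: "mem_Lp 2 h"
  shows "AE x in lborel. fourier (fourier h) (- x) = h x"
proof -
  define g where "g x = fourier (fourier h) (- x)" for x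
  have g: "mem_Lp 2 g" unfolding g_def by (intro L2_reflect fourier h)
  have eq: "(LINT x|lborel. cnj (a x) * g x) = (LINT x|lborel. cnj (a x) * h x)" if a: "mem_Lp 2 a" for a
  proof -
    have "(LINT x|lborel. cnj (a x) * g x) = (LINT x|lborel. cnj (a (- x)) * fourier (fourier h) x)"
      using lborel_integral_real_affine[of "-1" "\<lambda>x. cnj (a x) * g x" 0] by (simp add: g_def)
    also have "\<dots> = (LINT \<xi>|lborel. fourier (\<lambda>x. cnj (a (- x))) \<xi> * fourier h \<xi>)"
      by (rule fourier_mult_formula[symmetric]) (intro L2_cnj L2_reflect a fourier h)+
    also have "\<dots> = (LINT \<xi>|lborel. cnj (fourier a \<xi>) * fourier h \<xi>)"
    proof (rule integral_cong_AE)
      show "AE \<xi> in lborel. fourier (\<lambda>x. cnj (a (- x))) \<xi> * fourier h \<xi> = cnj (fourier a \<xi>) * fourier h \<xi>"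
        using fourier_cnj_reflect[OF a] by eventually_elim simp
    qed (intro borel_measurable_integrable L2_mult_integrable fourier L2_cnj L2_reflect a h)+
    also have "\<dots> = (LINT x|lborel. cnj (a x) * h x)" by (rule Parseval[OF a h])
    finally show ?thesis .
  qed
  define d where "d x = g x - h x" for x
  have d: "mem_Lp 2 d" unfolding d_def by (intro L2_diff g h)
  have "complex_of_real ((Lp_norm 2 d)\<^sup>2) = (LINT x|lborel. cnj (d x) * d x)"
    unfolding L2_norm_sq integral_complex_of_real[symmetric] by (simp only: complex_norm_square mult.commute)
  also have "\<dots> = (LINT x|lborel. cnj (d x) * g x) - (LINT x|lborel. cnj (d x) * h x)"
    unfolding d_def[of "_"] right_diff_distrib using d[unfolded d_def]
    by (intro Bochner_Integration.integral_diff L2_mult_integrable L2_cnj g h)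
  also have "\<dots> = 0" using eq[OF d] by simp
  finally have "Lp_norm 2 d = 0" by simp
  from L2_norm_zero_AE[OF d this] show ?thesis by eventually_elim (simp add: d_def g_def)
qed

corollary fourier_surj:
  assumes h: "mem_Lp 2 h"
  obtains g where "mem_Lp 2 g" "AE \<xi> in lborel. fourier g \<xi> = h \<xi>"
proof
  show "mem_Lp 2 (\<lambda>x. fourier h (- x))" by (intro L2_reflect fourier h)
  show "AE \<xi> in lborel. fourier (\<lambda>x. fourier h (- x)) \<xi> = h \<xi>"
    using fourier_reflect[OF fourier_L2[OF h]] fourier_inversion[OF h] by eventually_elim simp
qed

section \<open>Fourier multipliers and the functional in physical space\<close>

lemma L2_of_real:
  assumes "mem_Lp 2 u"
  shows "mem_Lp 2 (\<lambda>x. complex_of_real (u x))" "Lp_norm 2 (\<lambda>x. complex_of_real (u x)) = Lp_norm 2 u"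
  using assms by (auto simp: mem_Lp_2_iff Lp_norm_def)

lemma fourier_real_symmetric:
  assumes u: "mem_Lp 2 u"
  shows "AE \<xi> in lborel. fourier (\<lambda>x. complex_of_real (u x)) (- \<xi>) = cnj (fourier (\<lambda>x. complex_of_real (u x)) \<xi>)"
  using fourier_reflect[OF L2_of_real(1)[OF u]] fourier_cnj_reflect[OF L2_of_real(1)[OF u]]
  by eventually_elim simp

text \<open>The transform is onto, so the function that the choice operator selects in the definition exists.\<close>

lemma fourier_multiplier:
  assumes f: "mem_Lp 2 f" and m: "m \<in> borel_measurable borel" and b: "\<And>\<xi>. cmod (m \<xi>) \<le> C"
  shows "mem_Lp 2 (fourier_multiplier m f)"
    and "AE \<xi> in lborel. fourier (fourier_multiplier m f) \<xi> = m \<xi> * fourier f \<xi>"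
proof -
  have C: "0 \<le> C" using b norm_ge_zero order_trans by blast
  have "mem_Lp 2 (\<lambda>\<xi>. m \<xi> * fourier f \<xi>)"
  proof (rule L2_dominated(1)[OF fourier_L2[OF f] _ C])
    show "(\<lambda>\<xi>. m \<xi> * fourier f \<xi>) \<in> borel_measurable borel"
      by (intro borel_measurable_times m L2_measurable fourier f)
    show "AE \<xi> in lborel. cmod (m \<xi> * fourier f \<xi>) \<le> C * cmod (fourier f \<xi>)"
      by (intro AE_I2) (simp add: norm_mult mult_right_mono b)
  qed
  then obtain g where "mem_Lp 2 g" "AE \<xi> in lborel. fourier g \<xi> = m \<xi> * fourier f \<xi>"
    by (rule fourier_surj)
  then have "\<exists>g. mem_Lp 2 g \<and> (AE \<xi> in lborel. fourier g \<xi> = m \<xi> * fourier f \<xi>)" by blast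
  from someI_ex[OF this] show "mem_Lp 2 (fourier_multiplier m f)"
    "AE \<xi> in lborel. fourier (fourier_multiplier m f) \<xi> = m \<xi> * fourier f \<xi>"
    unfolding fourier_multiplier_def by auto
qed

text \<open>The symbol of \<open>\<partial>\<^sub>x (1 - 4 \<partial>\<^sub>x\<^sup>2)\<^sup>-\<^sup>1\<close>.\<close>

definition smoothing_symbol :: "real \<Rightarrow> complex" where
  "smoothing_symbol \<xi> = \<i> * of_real \<xi> / of_real (1 + 4 * \<xi>\<^sup>2)"

lemma one_plus_sq_pos: "0 < 1 + 4 * \<xi>\<^sup>2" for \<xi> :: real
  by (rule add_pos_nonneg) auto

lemma smoothing_symbol:
  shows "smoothing_symbol \<in> borel_measurable borel" and "cmod (smoothing_symbol \<xi>) \<le> 1"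
    and "smoothing_symbol (- \<xi>) = - smoothing_symbol \<xi>" and "cnj (smoothing_symbol \<xi>) = - smoothing_symbol \<xi>"
proof -
  have "1 + 4 * \<xi>\<^sup>2 \<noteq> 0" for \<xi> :: real using one_plus_sq_pos[of \<xi>] by linarith
  then have "complex_of_real (1 + 4 * \<xi>\<^sup>2) \<noteq> 0" for \<xi> :: real by (simp only: of_real_eq_0_iff not_False_eq_True)
  then show "smoothing_symbol \<in> borel_measurable borel"
    unfolding smoothing_symbol_def[abs_def]
    by (intro borel_measurable_continuous_onI continuous_intros) auto
  have "cmod (smoothing_symbol \<xi>) = \<bar>\<xi>\<bar> / (1 + 4 * \<xi>\<^sup>2)"
    unfolding smoothing_symbol_def norm_divide norm_mult norm_of_real using one_plus_sq_pos[of \<xi>] by simp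
  also have "\<dots> \<le> 1"
  proof -
    have "0 \<le> (2 * \<bar>\<xi>\<bar> - 1)\<^sup>2" by simp
    then have "4 * \<bar>\<xi>\<bar> \<le> 1 + 4 * \<xi>\<^sup>2" by (simp add: power2_eq_square algebra_simps)
    then show ?thesis using one_plus_sq_pos[of \<xi>] by (simp add: divide_le_eq_1)
  qed
  finally show "cmod (smoothing_symbol \<xi>) \<le> 1" .
  show "smoothing_symbol (- \<xi>) = - smoothing_symbol \<xi>" "cnj (smoothing_symbol \<xi>) = - smoothing_symbol \<xi>"
    by (simp_all add: smoothing_symbol_def)
qed

lemma P_tilde_form:
  "(\<Sum>i\<in>UNIV. cnj (Y $ i) * (P_tilde \<xi> *v Y) $ i)
    = of_real ((cmod (Y $ 1))\<^sup>2 + (cmod (Y $ 2))\<^sup>2)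
      - 2 * (cnj (Y $ 1) * (smoothing_symbol \<xi> * Y $ 2)) - 2 * cnj (cnj (Y $ 1) * (smoothing_symbol \<xi> * Y $ 2))"
proof -
  have p: "P_tilde \<xi> $ 1 $ 1 = 1" "P_tilde \<xi> $ 1 $ 2 = - (2 * smoothing_symbol \<xi>)"
    "P_tilde \<xi> $ 2 $ 1 = 2 * smoothing_symbol \<xi>" "P_tilde \<xi> $ 2 $ 2 = 1"
    by (simp_all add: P_tilde_def smoothing_symbol_def)
  show ?thesis
    unfolding matrix_vector_mult_def sum_2 complex_cnj_mult smoothing_symbol(4) complex_cnj_cnj of_real_add complex_norm_square
    by (simp add: p sum_2 algebra_simps)
qed

text \<open>By Parseval's identity the off-diagonal part of the quadratic form is \<open>- 2 I - 2 cnj I\<close>, where \<open>I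
  = \<integral> u g\<close> and \<open>g\<close> is the image of \<open>v\<close> under the multiplier. As
  \<open>u\<close> and \<open>v\<close> are real, the substitution of \<open>-\<xi>\<close> for \<open>\<xi>\<close>
  conjugates the integrand, so \<open>I\<close> is real and the off-diagonal part is \<open>-4 I\<close>.\<close>

theorem H3_physical_space:
  assumes u: "mem_Lp 2 u" and v: "mem_Lp 2 v"
  shows "H3 u v = of_real ((Lp_norm 2 u)\<^sup>2) + of_real ((Lp_norm 2 v)\<^sup>2)
    - 4 * (LINT x|lborel. of_real (u x) * fourier_multiplier smoothing_symbol (\<lambda>x. of_real (v x)) x)"
proof -
  define U V where "U = fourier (\<lambda>x. complex_of_real (u x))" and "V = fourier (\<lambda>x. complex_of_real (v x))"
  have U: "mem_Lp 2 U" and V: "mem_Lp 2 V" unfolding U_def V_def by (intro fourier L2_of_real u v)+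
  define g where "g = fourier_multiplier smoothing_symbol (\<lambda>x. of_real (v x))"
  note g = fourier_multiplier[OF L2_of_real(1)[OF v] smoothing_symbol(1,2), folded g_def V_def]
  define W where "W \<xi> = cnj (U \<xi>) * (smoothing_symbol \<xi> * V \<xi>)" for \<xi>
  have mV: "mem_Lp 2 (\<lambda>\<xi>. smoothing_symbol \<xi> * V \<xi>)"
  proof (rule L2_dominated(1)[OF V, where K=1])
    show "(\<lambda>\<xi>. smoothing_symbol \<xi> * V \<xi>) \<in> borel_measurable borel"
      by (intro borel_measurable_times smoothing_symbol L2_measurable V)
    show "AE \<xi> in lborel. cmod (smoothing_symbol \<xi> * V \<xi>) \<le> 1 * cmod (V \<xi>)"
      by (intro AE_I2) (unfold norm_mult, intro mult_right_mono smoothing_symbol(2) norm_ge_zero)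
  qed simp
  have W: "integrable lborel W" unfolding W_def by (intro L2_mult_integrable L2_cnj U mV)
  have "(LINT x|lborel. of_real (u x) * g x) = (LINT x|lborel. cnj (of_real (u x)) * g x)" by simp
  also have "\<dots> = (LINT \<xi>|lborel. cnj (U \<xi>) * fourier g \<xi>)"
    unfolding U_def by (rule Parseval[OF L2_of_real(1)[OF u] g(1), symmetric])
  also have "\<dots> = (LINT \<xi>|lborel. W \<xi>)"
  proof (rule integral_cong_AE)
    show "AE \<xi> in lborel. cnj (U \<xi>) * fourier g \<xi> = W \<xi>"
      using g(2) by eventually_elim (simp add: W_def)
    show "(\<lambda>\<xi>. cnj (U \<xi>) * fourier g \<xi>) \<in> borel_measurable lborel"
      by (intro borel_measurable_integrable L2_mult_integrable L2_cnj U fourier g)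
  qed (use W in auto)
  finally have Ig: "(LINT x|lborel. of_real (u x) * g x) = (LINT \<xi>|lborel. W \<xi>)" .
  have real: "cnj (LINT \<xi>|lborel. W \<xi>) = (LINT \<xi>|lborel. W \<xi>)"
  proof -
    have "(LINT \<xi>|lborel. W \<xi>) = (LINT \<xi>|lborel. W (0 + -1 * \<xi>))"
      by (subst lborel_integral_real_affine[where c="-1" and t=0]) simp_all
    also have "\<dots> = (LINT \<xi>|lborel. cnj (W \<xi>))"
    proof (rule integral_cong_AE)
      show "AE \<xi> in lborel. W (0 + -1 * \<xi>) = cnj (W \<xi>)"
        using fourier_real_symmetric[OF u] fourier_real_symmetric[OF v]
        by eventually_elim (simp add: W_def U_def V_def smoothing_symbol(3,4))
      show "(\<lambda>\<xi>. W (0 + -1 * \<xi>)) \<in> borel_measurable lborel"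
        by (intro borel_measurable_integrable lborel_integrable_real_affine W) simp
      show "(\<lambda>\<xi>. cnj (W \<xi>)) \<in> borel_measurable lborel"
        by (intro borel_measurable_integrable integrable_cnj W)
    qed
    finally show ?thesis by (simp only: Bochner_Integration.integral_cnj)
  qed
  have "H3 u v = (LINT \<xi>|lborel. of_real ((cmod (U \<xi>))\<^sup>2 + (cmod (V \<xi>))\<^sup>2) - 2 * W \<xi> - 2 * cnj (W \<xi>))"
    unfolding H3_def P_tilde_form W_def by (simp add: fourier_pair_def U_def V_def)
  also have "\<dots> = (LINT \<xi>|lborel. complex_of_real ((cmod (U \<xi>))\<^sup>2 + (cmod (V \<xi>))\<^sup>2)) - (LINT \<xi>|lborel. 2 * W \<xi>) - (LINT \<xi>|lborel. 2 * cnj (W \<xi>))"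
  proof -
    have "integrable lborel (\<lambda>\<xi>. complex_of_real ((cmod (U \<xi>))\<^sup>2 + (cmod (V \<xi>))\<^sup>2))"
      by (intro integrable_of_real Bochner_Integration.integrable_add L2_integrable_sq U V)
    then show ?thesis
      using W integrable_cnj[OF W] by (simp only: Bochner_Integration.integral_diff Bochner_Integration.integrable_diff integrable_mult_right)
  qed
  also have "\<dots> = of_real ((Lp_norm 2 U)\<^sup>2 + (Lp_norm 2 V)\<^sup>2) - 4 * (LINT \<xi>|lborel. W \<xi>)"
    unfolding integral_complex_of_real integral_mult_right_zero Bochner_Integration.integral_cnj real L2_norm_sq
    using L2_integrable_sq[OF U] L2_integrable_sq[OF V] by simp
  also have "Lp_norm 2 U = Lp_norm 2 u" unfolding U_def by (simp only: Plancherel L2_of_real u)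
  also have "Lp_norm 2 V = Lp_norm 2 v" unfolding V_def by (simp only: Plancherel L2_of_real v)
  finally show ?thesis unfolding Ig[symmetric] g_def by simp
qed

section \<open>Weak derivatives on the Fourier side\<close>

lemma has_derivative_pos_part_sq:
  "((\<lambda>s::real. (max 0 s)\<^sup>2) has_real_derivative 2 * max 0 s) (at s)"
proof -
  consider "s > 0" | "s < 0" | "s = 0" by linarith
  then show ?thesis
  proof cases
    case 1
    have "((\<lambda>s. s\<^sup>2) has_real_derivative 2 * s) (at s)" by (auto intro!: derivative_eq_intros)
    then have "((\<lambda>s. (max 0 s)\<^sup>2) has_real_derivative 2 * s) (at s)"
      by (rule has_field_derivative_transform_within_open[where S="{0<..}"]) (use 1 in auto)
    with 1 show ?thesis by simp
  next
    case 2
    have "((\<lambda>s. 0) has_real_derivative 0) (at s)" by (auto intro!: derivative_eq_intros)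
    then have "((\<lambda>s. (max 0 s)\<^sup>2) has_real_derivative 0) (at s)"
      by (rule has_field_derivative_transform_within_open[where S="{..<0}"]) (use 2 in auto)
    with 2 show ?thesis by simp
  next
    case 3
    have "((\<lambda>h. ((max 0 (0 + h))\<^sup>2 - (max 0 0)\<^sup>2) / h) \<longlongrightarrow> (0::real)) (at 0)"
    proof (rule Lim_null_comparison)
      show "\<forall>\<^sub>F h in at 0. norm (((max 0 (0 + h))\<^sup>2 - (max 0 0)\<^sup>2) / h) \<le> \<bar>h\<bar>" for h :: real
        by (rule always_eventually) (auto simp: max_def power2_eq_square)
      show "((\<lambda>h::real. \<bar>h\<bar>) \<longlongrightarrow> 0) (at 0)" by (intro tendsto_rabs_zero tendsto_ident_at)
    qed
    with 3 show ?thesis by (simp add: DERIV_def)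
  qed
qed

text \<open>A cutoff that is continuously differentiable, has support in \<open>[-r, r]\<close>, and has a derivative of order
  \<open>1/r\<close>. The square makes the positive part of the parabola continuously differentiable at its zeros.\<close>

definition bump :: "real \<Rightarrow> real \<Rightarrow> real" where
  "bump r x = (max 0 (1 - (x / r)\<^sup>2))\<^sup>2"

definition bump_deriv :: "real \<Rightarrow> real \<Rightarrow> real" where
  "bump_deriv r x = 2 * max 0 (1 - (x / r)\<^sup>2) * (- (2 * x / r\<^sup>2))"

lemma bump_has_derivative: "(bump r has_real_derivative bump_deriv r x) (at x)"
proof -
  have "((\<lambda>x. 1 - (x / r)\<^sup>2) has_real_derivative - (2 * x / r\<^sup>2)) (at x)"
    by (cases "r = 0") (auto intro!: derivative_eq_intros simp: power2_eq_square)
  from DERIV_chain2[OF has_derivative_pos_part_sq this] show ?thesis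
    unfolding bump_def[abs_def] bump_deriv_def .
qed

lemma bump_continuous: "continuous_on UNIV (bump r)" "continuous_on UNIV (bump_deriv r)"
  unfolding bump_def[abs_def] bump_deriv_def[abs_def] divide_inverse by (intro continuous_intros)+

lemma bump_abs_le_1: "\<bar>bump r x\<bar> \<le> 1"
proof -
  have "max 0 (1 - (x / r)\<^sup>2) \<le> 1" by simp
  then have "bump r x \<le> 1" unfolding bump_def by (intro power_le_one) auto
  then show ?thesis by (simp add: bump_def)
qed

lemma bump_outside:
  assumes "r > 0" "\<bar>x\<bar> > r" shows "bump r x = 0" "bump_deriv r x = 0"
proof -
  have "1 \<le> (\<bar>x\<bar> / r)\<^sup>2" by (intro one_le_power) (use assms in \<open>simp add: le_divide_eq\<close>)
  then have "1 - (x / r)\<^sup>2 \<le> 0" by (simp add: power_divide)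
  then show "bump r x = 0" "bump_deriv r x = 0" by (simp_all add: bump_def bump_deriv_def)
qed

lemma bump_deriv_bound:
  assumes "r > 0" shows "\<bar>bump_deriv r x\<bar> \<le> 4 / r"
proof (cases "\<bar>x\<bar> > r")
  case True
  then show ?thesis using bump_outside[OF assms] assms by simp
next
  case False
  have "\<bar>bump_deriv r x\<bar> = 2 * max 0 (1 - (x / r)\<^sup>2) * (2 * \<bar>x\<bar> / r\<^sup>2)"
    by (simp add: bump_deriv_def abs_mult)
  also have "\<dots> \<le> 2 * 1 * (2 * r / r\<^sup>2)"
    using False assms by (intro mult_mono divide_right_mono) auto
  also have "\<dots> = 4 / r" using assms by (simp add: power2_eq_square)
  finally show ?thesis .
qed

lemma bump_tendsto: "((\<lambda>r. bump r x) \<longlongrightarrow> 1) at_top"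
proof -
  have "((\<lambda>r. x / r) \<longlongrightarrow> 0) at_top"
    by (rule real_tendsto_divide_at_top[OF tendsto_const filterlim_ident])
  then have "((\<lambda>r. (max 0 (1 - (x / r)\<^sup>2))\<^sup>2) \<longlongrightarrow> (max 0 (1 - 0\<^sup>2))\<^sup>2) at_top"
    by (intro tendsto_intros)
  then show ?thesis by (simp add: bump_def)
qed

lemma L2_supported_integrable:
  fixes h :: "real \<Rightarrow> complex"
  assumes "mem_Lp 2 h" "\<And>x. \<bar>x\<bar> > r \<Longrightarrow> h x = 0"
  shows "integrable lborel h"
proof -
  have "h = truncate r h"
    using assms(2) by (auto simp: truncate_def fun_eq_iff indicator_def abs_le_iff not_le) (metis abs_le_iff minus_le_iff not_le)+
  then show ?thesis using truncate_integrable[OF assms(1), of r] by simp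
qed

lemma bump_mult:
  assumes f: "mem_Lp 2 f" and r: "r > 0"
  shows "mem_Lp 2 (\<lambda>x. complex_of_real (bump r x) * of_real (f x))"
    and "integrable lborel (\<lambda>x. complex_of_real (bump r x) * of_real (f x))"
    and "mem_Lp 2 (\<lambda>x. complex_of_real (bump_deriv r x) * of_real (f x))"
    and "Lp_norm 2 (\<lambda>x. complex_of_real (bump_deriv r x) * of_real (f x)) \<le> 4 / r * Lp_norm 2 f"
    and "integrable lborel (\<lambda>x. complex_of_real (bump_deriv r x) * of_real (f x))"
proof -
  have m: "(\<lambda>x. complex_of_real (bump r x) * of_real (f x)) \<in> borel_measurable borel"
    "(\<lambda>x. complex_of_real (bump_deriv r x) * of_real (f x)) \<in> borel_measurable borel"
    using L2_measurable[OF f] bump_continuous[of r, THEN borel_measurable_continuous_onI] by auto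
  have b: "AE x in lborel. cmod (complex_of_real (bump r x) * of_real (f x)) \<le> 1 * norm (f x)"
    unfolding norm_mult norm_of_real real_norm_def by (intro AE_I2 mult_right_mono bump_abs_le_1) simp
  have b': "AE x in lborel. cmod (complex_of_real (bump_deriv r x) * of_real (f x)) \<le> 4 / r * norm (f x)"
    unfolding norm_mult norm_of_real real_norm_def by (intro AE_I2 mult_right_mono bump_deriv_bound r) simp
  show 1: "mem_Lp 2 (\<lambda>x. complex_of_real (bump r x) * of_real (f x))"
    by (rule L2_dominated(1)[OF f m(1) _ b]) simp
  show 2: "mem_Lp 2 (\<lambda>x. complex_of_real (bump_deriv r x) * of_real (f x))"
    by (rule L2_dominated(1)[OF f m(2) _ b']) (use r in simp)
  show "Lp_norm 2 (\<lambda>x. complex_of_real (bump_deriv r x) * of_real (f x)) \<le> 4 / r * Lp_norm 2 f"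
    by (rule L2_dominated(2)[OF f m(2) _ b']) (use r in simp)
  show "integrable lborel (\<lambda>x. complex_of_real (bump r x) * of_real (f x))"
    by (rule L2_supported_integrable[OF 1, of r]) (simp add: bump_outside[OF r])
  show "integrable lborel (\<lambda>x. complex_of_real (bump_deriv r x) * of_real (f x))"
    by (rule L2_supported_integrable[OF 2, of r]) (simp add: bump_outside[OF r])
qed

lemma weak_deriv_test:
  assumes wd: "weak_deriv f g" and r: "r > 0"
    and c: "\<And>x. (c has_real_derivative c' x) (at x)" and c': "continuous_on UNIV c'"
  shows "(LINT x|lborel. f x * (bump_deriv r x * c x + bump r x * c' x)) = - (LINT x|lborel. g x * (bump r x * c x))"
proof -
  define \<phi> where "\<phi> x = bump r x * c x" for x
  have d: "(\<phi> has_real_derivative bump_deriv r x * c x + bump r x * c' x) (at x)" for x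
    unfolding \<phi>_def using DERIV_mult[OF bump_has_derivative c] by (simp add: algebra_simps)
  have "continuous_on UNIV c"
    using c by (meson DERIV_isCont continuous_at_imp_continuous_on)
  then have "continuous_on UNIV (\<lambda>x. bump_deriv r x * c x + bump r x * c' x)"
    by (intro continuous_intros bump_continuous c')
  with d have "\<phi> C1_differentiable_on UNIV"
    unfolding C1_differentiable_on_def has_real_derivative_iff_has_vector_derivative
    by (intro exI[of _ "\<lambda>x. bump_deriv r x * c x + bump r x * c' x"]) auto
  moreover have "compact (closure {x. \<phi> x \<noteq> 0})"
  proof -
    have "{x. \<phi> x \<noteq> 0} \<subseteq> cball 0 r"
      using bump_outside(1)[OF r] by (auto simp: \<phi>_def) (meson not_le)
    then show ?thesis unfolding compact_closure by (rule bounded_subset[OF bounded_cball])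
  qed
  ultimately have "(LINT x|lborel. f x * deriv \<phi> x) = - (LINT x|lborel. g x * \<phi> x)"
    using wd unfolding weak_deriv_def by blast
  then show ?thesis using DERIV_imp_deriv[OF d] by (simp add: \<phi>_def)
qed

text \<open>The definition of the weak derivative, tested with the real and the imaginary part of \<open>x \<mapsto> bump r x *
  exp (-\<i> x \<xi>)\<close>.\<close>

lemma fourier_int_weak_deriv:
  assumes f: "mem_Lp 2 f" and g: "mem_Lp 2 g" and wd: "weak_deriv f g" and r: "r > 0"
  shows "fourier_int (\<lambda>x. of_real (bump_deriv r x) * of_real (f x)) \<xi>
      - \<i> * of_real \<xi> * fourier_int (\<lambda>x. of_real (bump r x) * of_real (f x)) \<xi>
    = - fourier_int (\<lambda>x. of_real (bump r x) * of_real (g x)) \<xi>"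
proof -
  define e where "e x = exp (- \<i> * complex_of_real (x * \<xi>))" for x
  have e: "Re (e x) = cos (x * \<xi>)" "Im (e x) = - sin (x * \<xi>)" for x
    by (simp_all add: e_def Re_exp Im_exp)
  define a b c where "a x = e x * (of_real (bump_deriv r x) * of_real (f x))"
    and "b x = e x * (of_real (bump r x) * of_real (f x))"
    and "c x = e x * (of_real (bump r x) * of_real (g x))" for x
  have i: "integrable lborel a" "integrable lborel b" "integrable lborel c"
    unfolding a_def b_def c_def e_def by (intro fourier_integrable bump_mult f g r)+
  define h where "h x = a x - \<i> * of_real \<xi> * b x" for x
  have hi: "integrable lborel h" unfolding h_def by (intro Bochner_Integration.integrable_diff integrable_mult_right i)
  have "(LINT x|lborel. h x) = - (LINT x|lborel. c x)"
  proof (rule complex_eqI)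
    have "Re (LINT x|lborel. h x) = (LINT x|lborel. Re (h x))" by (rule integral_Re[OF hi, symmetric])
    also have "\<dots> = (LINT x|lborel. f x * (bump_deriv r x * cos (x * \<xi>) + bump r x * (- sin (x * \<xi>) * \<xi>)))"
      by (rule Bochner_Integration.integral_cong) (simp_all add: h_def a_def b_def e algebra_simps)
    also have "\<dots> = - (LINT x|lborel. g x * (bump r x * cos (x * \<xi>)))"
      by (rule weak_deriv_test[OF wd r]) (auto intro!: derivative_eq_intros continuous_intros)
    also have "(LINT x|lborel. g x * (bump r x * cos (x * \<xi>))) = (LINT x|lborel. Re (c x))"
      by (rule Bochner_Integration.integral_cong) (simp_all add: c_def e algebra_simps)
    also have "\<dots> = Re (LINT x|lborel. c x)" by (rule integral_Re[OF i(3)])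
    finally show "Re (LINT x|lborel. h x) = Re (- (LINT x|lborel. c x))" by simp
    have "Im (LINT x|lborel. h x) = (LINT x|lborel. Im (h x))" by (rule integral_Im[OF hi, symmetric])
    also have "\<dots> = (LINT x|lborel. f x * (bump_deriv r x * (- sin (x * \<xi>)) + bump r x * (- cos (x * \<xi>) * \<xi>)))"
      by (rule Bochner_Integration.integral_cong) (simp_all add: h_def a_def b_def e algebra_simps)
    also have "\<dots> = - (LINT x|lborel. g x * (bump r x * (- sin (x * \<xi>))))"
      by (rule weak_deriv_test[OF wd r]) (auto intro!: derivative_eq_intros continuous_intros)
    also have "(LINT x|lborel. g x * (bump r x * (- sin (x * \<xi>)))) = (LINT x|lborel. Im (c x))"
      by (rule Bochner_Integration.integral_cong) (simp_all add: c_def e algebra_simps)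
    also have "\<dots> = Im (LINT x|lborel. c x)" by (rule integral_Im[OF i(3)])
    finally show "Im (LINT x|lborel. h x) = Im (- (LINT x|lborel. c x))" by simp
  qed
  moreover have "(LINT x|lborel. h x) = (LINT x|lborel. a x) - \<i> * of_real \<xi> * (LINT x|lborel. b x)"
    unfolding h_def using i by (simp only: Bochner_Integration.integral_diff integrable_mult_right integral_mult_right_zero)
  ultimately have "(LINT x|lborel. a x) - \<i> * of_real \<xi> * (LINT x|lborel. b x) = - (LINT x|lborel. c x)" by simp
  then have "((LINT x|lborel. a x) - \<i> * of_real \<xi> * (LINT x|lborel. b x)) / of_real (sqrt (2 * pi)) = - (LINT x|lborel. c x) / of_real (sqrt (2 * pi))"
    by (simp only:)
  then show ?thesis unfolding fourier_int_def a_def b_def c_def e_def by (simp only: diff_divide_distrib times_divide_eq_right minus_divide_left)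
qed

text \<open>In the identity for the cut-off functions the term with the derivative of the cutoff has norm \<open>O(1/r)\<close>,
  and the other two terms converge. Since \<open>\<xi>\<close> is unbounded, the convergence takes place after
  division by \<open>1 + \<bar>\<xi>\<bar>\<close>.\<close>

theorem fourier_weak_deriv:
  assumes f: "mem_Lp 2 f" and g: "mem_Lp 2 g" and wd: "weak_deriv f g"
  shows "AE \<xi> in lborel. fourier (\<lambda>x. of_real (g x)) \<xi> = \<i> * of_real \<xi> * fourier (\<lambda>x. of_real (f x)) \<xi>"
proof -
  define F G where "F = fourier (\<lambda>x. complex_of_real (f x))" and "G = fourier (\<lambda>x. complex_of_real (g x))"
  note cf = L2_of_real(1)[OF f] and cg = L2_of_real(1)[OF g]
  have F: "mem_Lp 2 F" and G: "mem_Lp 2 G" unfolding F_def G_def by (intro fourier cf cg)+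
  \<comment> \<open>The weight makes both \<open>w\<close> and \<open>w(\<xi>) \<xi>\<close> bounded by \<open>1\<close>, and it has no zeros.\<close>
  define w where "w \<xi> = complex_of_real (1 / (1 + \<bar>\<xi>\<bar>))" for \<xi> :: real
  define D where "D \<xi> = w \<xi> * (\<i> * of_real \<xi> * F \<xi> - G \<xi>)" for \<xi>
  have wm: "w \<in> borel_measurable borel"
    unfolding w_def by (intro borel_measurable_continuous_onI continuous_intros) auto
  have Dm: "D \<in> borel_measurable borel" unfolding D_def
    using wm L2_measurable[OF F] L2_measurable[OF G] by simp
  have wb: "cmod (w \<xi>) \<le> 1" "cmod (w \<xi>) * \<bar>\<xi>\<bar> \<le> 1" for \<xi>
    unfolding w_def norm_of_real by (auto simp: divide_le_eq)
  define fb f' gb where "fb r x = complex_of_real (bump r x) * of_real (f x)"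
    and "f' r x = complex_of_real (bump_deriv r x) * of_real (f x)"
    and "gb r x = complex_of_real (bump r x) * of_real (g x)" for r x
  have bm: "bump r \<in> borel_measurable borel" for r by (rule borel_measurable_continuous_onI[OF bump_continuous(1)])
  have lim: "((\<lambda>r. Lp_norm 2 (\<lambda>x. fb r x - of_real (f x))) \<longlongrightarrow> 0) at_top" "((\<lambda>r. Lp_norm 2 (\<lambda>x. gb r x - of_real (g x))) \<longlongrightarrow> 0) at_top"
    using L2_cutoff_tendsto[OF cf bm bump_abs_le_1 bump_tendsto] L2_cutoff_tendsto[OF cg bm bump_abs_le_1 bump_tendsto]
    by (simp_all add: fb_def gb_def scaleR_conv_of_real)
  have lim': "((\<lambda>r. 4 / r * Lp_norm 2 f) \<longlongrightarrow> 0) at_top"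
    by (rule tendsto_mult_left_zero[OF real_tendsto_divide_at_top[OF tendsto_const filterlim_ident]])
  have bound: "Lp_norm 2 D \<le> Lp_norm 2 (\<lambda>x. fb r x - of_real (f x)) + 4 / r * Lp_norm 2 f + Lp_norm 2 (\<lambda>x. gb r x - of_real (g x))"
    if r: "r > 0" for r
  proof -
    note b = bump_mult[OF f r] bump_mult(1,2)[OF g r]
    define A B C where "A \<xi> = fourier_int (fb r) \<xi> - F \<xi>" and "B = fourier_int (f' r)"
      and "C \<xi> = fourier_int (gb r) \<xi> - G \<xi>" for \<xi>
    have A: "mem_Lp 2 A" "Lp_norm 2 A \<le> Lp_norm 2 (\<lambda>x. fb r x - of_real (f x))"
      unfolding A_def fb_def F_def by (intro L2_diff Bessel_fourier_int fourier b cf fourier_int_near)+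
    have C: "mem_Lp 2 C" "Lp_norm 2 C \<le> Lp_norm 2 (\<lambda>x. gb r x - of_real (g x))"
      unfolding C_def gb_def G_def by (intro L2_diff Bessel_fourier_int fourier b cg fourier_int_near)+
    have B: "mem_Lp 2 B" "Lp_norm 2 B \<le> 4 / r * Lp_norm 2 f"
      unfolding B_def f'_def using Bessel_fourier_int[OF b(5,3)] b(4) by auto
    have N: "mem_Lp 2 (\<lambda>\<xi>. cmod (X \<xi>))" "Lp_norm 2 (\<lambda>\<xi>. cmod (X \<xi>)) = Lp_norm 2 X" if "mem_Lp 2 X" for X
      using that by (auto simp: mem_Lp_2_iff Lp_norm_def)
    have AB: "mem_Lp 2 (\<lambda>\<xi>. cmod (A \<xi>) + cmod (B \<xi>))" by (intro L2_add N A B)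
    have ABC: "mem_Lp 2 (\<lambda>\<xi>. cmod (A \<xi>) + cmod (B \<xi>) + cmod (C \<xi>))" by (intro L2_add AB N C)
    have "Lp_norm 2 D \<le> 1 * Lp_norm 2 (\<lambda>\<xi>. cmod (A \<xi>) + cmod (B \<xi>) + cmod (C \<xi>))"
    proof (rule L2_dominated(2)[OF ABC Dm])
      show "AE \<xi> in lborel. cmod (D \<xi>) \<le> 1 * norm (cmod (A \<xi>) + cmod (B \<xi>) + cmod (C \<xi>))"
      proof (rule AE_I2)
        fix \<xi>
        have eq: "\<i> * of_real \<xi> * F \<xi> - G \<xi> = - (\<i> * of_real \<xi> * A \<xi>) + (B \<xi> + C \<xi>)"
          using fourier_int_weak_deriv[OF f g wd r, of \<xi>]
          unfolding A_def B_def C_def fb_def f'_def gb_def by (simp add: algebra_simps)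
        have "D \<xi> = - (w \<xi> * of_real \<xi> * (\<i> * A \<xi>)) + (w \<xi> * B \<xi> + w \<xi> * C \<xi>)"
          unfolding D_def eq by (simp add: algebra_simps)
        then have "cmod (D \<xi>) \<le> cmod (w \<xi> * of_real \<xi> * (\<i> * A \<xi>)) + (cmod (w \<xi> * B \<xi>) + cmod (w \<xi> * C \<xi>))"
          by (metis norm_minus_cancel norm_triangle_mono norm_triangle_ineq order_refl)
        also have "cmod (w \<xi> * of_real \<xi> * (\<i> * A \<xi>)) = (cmod (w \<xi>) * \<bar>\<xi>\<bar>) * cmod (A \<xi>)" by (simp add: norm_mult)
        also have "\<dots> \<le> 1 * cmod (A \<xi>)" by (intro mult_right_mono wb) simp
        also have "cmod (w \<xi> * B \<xi>) \<le> 1 * cmod (B \<xi>)" unfolding norm_mult by (intro mult_right_mono wb) simp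
        also have "cmod (w \<xi> * C \<xi>) \<le> 1 * cmod (C \<xi>)" unfolding norm_mult by (intro mult_right_mono wb) simp
        finally show "cmod (D \<xi>) \<le> 1 * norm (cmod (A \<xi>) + cmod (B \<xi>) + cmod (C \<xi>))" by simp
      qed
    qed simp
    also have "\<dots> \<le> Lp_norm 2 A + Lp_norm 2 B + Lp_norm 2 C"
      using L2_add(2)[OF AB N(1)[OF C(1)]] L2_add(2)[OF N(1)[OF A(1)] N(1)[OF B(1)]] N(2) A(1) B(1) C(1) by simp
    finally show ?thesis using A(2) B(2) C(2) by linarith
  qed
  have D2: "mem_Lp 2 D"
  proof -
    have FG: "mem_Lp 2 (\<lambda>\<xi>. cmod (F \<xi>) + cmod (G \<xi>))"
      by (intro L2_add) (use F G in \<open>auto simp: mem_Lp_2_iff\<close>)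
    show ?thesis
    proof (rule L2_dominated(1)[OF FG Dm, of 1])
      show "AE \<xi> in lborel. cmod (D \<xi>) \<le> 1 * norm (cmod (F \<xi>) + cmod (G \<xi>))"
      proof (rule AE_I2)
        fix \<xi>
        have "D \<xi> = w \<xi> * of_real \<xi> * (\<i> * F \<xi>) - w \<xi> * G \<xi>" unfolding D_def by (simp add: algebra_simps)
        then have "cmod (D \<xi>) \<le> cmod (w \<xi> * of_real \<xi> * (\<i> * F \<xi>)) + cmod (w \<xi> * G \<xi>)"
          by (simp add: norm_triangle_ineq4)
        also have "cmod (w \<xi> * of_real \<xi> * (\<i> * F \<xi>)) = (cmod (w \<xi>) * \<bar>\<xi>\<bar>) * cmod (F \<xi>)" by (simp add: norm_mult)
        also have "\<dots> \<le> 1 * cmod (F \<xi>)" by (intro mult_right_mono wb) simp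
        also have "cmod (w \<xi> * G \<xi>) \<le> 1 * cmod (G \<xi>)" unfolding norm_mult by (intro mult_right_mono wb) simp
        finally show "cmod (D \<xi>) \<le> 1 * norm (cmod (F \<xi>) + cmod (G \<xi>))" by simp
      qed
    qed simp
  qed
  have "Lp_norm 2 D \<le> 0"
  proof (rule tendsto_lowerbound)
    show "((\<lambda>r. Lp_norm 2 (\<lambda>x. fb r x - of_real (f x)) + 4 / r * Lp_norm 2 f + Lp_norm 2 (\<lambda>x. gb r x - of_real (g x))) \<longlongrightarrow> 0) at_top"
      using tendsto_add[OF tendsto_add[OF lim(1) lim'] lim(2)] by simp
    show "\<forall>\<^sub>F r in at_top. Lp_norm 2 D \<le> Lp_norm 2 (\<lambda>x. fb r x - of_real (f x)) + 4 / r * Lp_norm 2 f + Lp_norm 2 (\<lambda>x. gb r x - of_real (g x))"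
      using eventually_gt_at_top[of 0] by eventually_elim (rule bound)
  qed simp
  then have "Lp_norm 2 D = 0" by (intro antisym Lp_norm_nonneg)
  from L2_norm_zero_AE[OF D2 this] show ?thesis
  proof eventually_elim
    case (elim \<xi>)
    have "w \<xi> \<noteq> 0" unfolding w_def of_real_eq_0_iff by simp
    with elim show ?case by (simp add: D_def F_def G_def)
  qed
qed

section \<open>Differentiation with respect to the square norm\<close>

lemma measure_degenerate: "K \<subseteq> {c} \<Longrightarrow> measure lborel K = 0" for c :: real
  by (auto simp: subset_singleton_iff)

lemma has_L2_integral_degenerate:
  assumes "has_L2_integral y w 0 0"
  shows "Lp_norm 2 w = 0"
proof -
  have le: "Lp_norm 2 w \<le> 0 + \<epsilon>" if "\<epsilon> > 0" for \<epsilon>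
  proof -
    from mp[OF spec[OF conjunct2[OF assms[unfolded has_L2_integral_def]]] that]
    obtain \<delta> where d: "\<delta> > 0" "\<forall>D. D tagged_division_of {0..0} \<and> (\<lambda>s. ball s \<delta>) fine D \<longrightarrow>
        Lp_norm 2 (\<lambda>x. (\<Sum>(s, K)\<in>D. measure lborel K *\<^sub>R y s x) - w x) < \<epsilon>"
      by (elim exE conjE)
    obtain D where D: "D tagged_division_of {0..0::real}" "(\<lambda>s. ball s \<delta>) fine D"
      using fine_division_exists_real[OF gauge_ball[OF d(1)]] by blast
    have "(\<Sum>(s, K)\<in>D. measure lborel K *\<^sub>R y s x) = 0" for x
    proof (rule sum.neutral, clarify)
      fix s K assume "(s, K) \<in> D"
      then have "K \<subseteq> {0}" using tagged_division_ofD(3)[OF D(1)] by auto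
      then show "measure lborel K *\<^sub>R y s x = 0" by (simp add: measure_degenerate)
    qed
    then have "Lp_norm 2 (\<lambda>x. 0 - w x) < \<epsilon>" using mp[OF spec[OF d(2)] conjI[OF D]] by (simp only:)
    then show ?thesis by (simp add: Lp_norm_def)
  qed
  have "Lp_norm 2 w \<le> 0" by (rule field_le_epsilon[OF le])
  then show ?thesis by (intro antisym Lp_norm_nonneg)
qed

text \<open>A fine tagged division of \<open>[0, a]\<close> and one of \<open>[a, b]\<close> form a fine tagged division of
  \<open>[0, b]\<close>. So the increment of the integral is approximated by Riemann sums over \<open>[a, b]\<close>,
  and these differ from \<open>(b - a) y\<^sub>c\<close> by at most \<open>b - a\<close> times the oscillation of
  \<open>y\<close>.\<close>

lemma has_L2_integral_increment:
  assumes ab: "0 \<le> a" "a \<le> b" and c: "0 \<le> c"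
    and wa: "has_L2_integral y wa 0 a" and wb: "has_L2_integral y wb 0 b"
    and y: "\<And>s. 0 \<le> s \<Longrightarrow> mem_Lp 2 (y s)"
    and \<eta>: "\<And>s. a \<le> s \<Longrightarrow> s \<le> b \<Longrightarrow> L2_dist (y s) (y c) \<le> \<eta>"
  shows "Lp_norm 2 (\<lambda>x. wb x - wa x - (b - a) *\<^sub>R y c x) \<le> (b - a) * \<eta>"
proof (rule field_le_epsilon)
  fix \<epsilon> :: real assume "\<epsilon> > 0"
  then have e2: "\<epsilon> / 2 > 0" by simp
  obtain \<delta>1 where d1: "\<delta>1 > 0" "\<And>D. D tagged_division_of {0..a} \<Longrightarrow> (\<lambda>s. ball s \<delta>1) fine D \<Longrightarrow>
      Lp_norm 2 (\<lambda>x. (\<Sum>(s, K)\<in>D. measure lborel K *\<^sub>R y s x) - wa x) < \<epsilon> / 2"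
    using wa e2 unfolding has_L2_integral_def by blast
  obtain \<delta>2 where d2: "\<delta>2 > 0" "\<And>D. D tagged_division_of {0..b} \<Longrightarrow> (\<lambda>s. ball s \<delta>2) fine D \<Longrightarrow>
      Lp_norm 2 (\<lambda>x. (\<Sum>(s, K)\<in>D. measure lborel K *\<^sub>R y s x) - wb x) < \<epsilon> / 2"
    using wb e2 unfolding has_L2_integral_def by blast
  define \<delta> where "\<delta> = min \<delta>1 \<delta>2"
  have \<delta>: "\<delta> > 0" "\<And>s. ball s \<delta> \<subseteq> ball s \<delta>1" "\<And>s. ball s \<delta> \<subseteq> ball s \<delta>2"
    using d1(1) d2(1) by (auto simp: \<delta>_def)
  obtain D1 where D1: "D1 tagged_division_of {0..a}" "(\<lambda>s. ball s \<delta>) fine D1"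
    using fine_division_exists_real[OF gauge_ball[OF \<delta>(1)]] by blast
  obtain D2 where D2: "D2 tagged_division_of {a..b}" "(\<lambda>s. ball s \<delta>) fine D2"
    using fine_division_exists_real[OF gauge_ball[OF \<delta>(1)]] by blast
  have fin: "finite D1" "finite D2" using D1(1) D2(1) by auto
  have "{0..a} \<union> {a..b} = {0..b}" using ab by auto
  then have D: "D1 \<union> D2 tagged_division_of {0..b}"
    using tagged_division_Un[OF D1(1) D2(1)] by (simp add: disjoint_iff)
  have f1: "(\<lambda>s. ball s \<delta>1) fine D1" using D1(2) \<delta>(2) unfolding fine_def by blast
  have "(\<lambda>s. ball s \<delta>2) fine D1" using D1(2) \<delta>(3) unfolding fine_def by blast
  moreover have "(\<lambda>s. ball s \<delta>2) fine D2" using D2(2) \<delta>(3) unfolding fine_def by blast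
  ultimately have f2: "(\<lambda>s. ball s \<delta>2) fine (D1 \<union> D2)" by (rule fine_Un)
  define R where "R D x = (\<Sum>(s, K)\<in>D. measure lborel K *\<^sub>R y s x)" for D :: "(real \<times> real set) set" and x
  have Rm: "mem_Lp 2 (R D)" if "finite D" "\<And>s K. (s, K) \<in> D \<Longrightarrow> 0 \<le> s" for D
    unfolding R_def case_prod_unfold using that by (intro conjunct1[OF L2_sum] L2_scaleR y) auto
  have tag1: "(s, K) \<in> D1 \<Longrightarrow> 0 \<le> s \<and> K \<subseteq> {0..a}" for s K using tagged_division_ofD(2,3)[OF D1(1)] by fastforce
  have tag2: "(s, K) \<in> D2 \<Longrightarrow> a \<le> s \<and> s \<le> b \<and> K \<subseteq> {a..b}" for s K using tagged_division_ofD(2,3)[OF D2(1)] by fastforce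
  have R1: "mem_Lp 2 (R D1)" using Rm[OF fin(1)] tag1 by blast
  have R2: "mem_Lp 2 (R D2)" using Rm[OF fin(2)] tag2 ab by fastforce
  have R12: "R (D1 \<union> D2) x = R D1 x + R D2 x" for x
    unfolding R_def
  proof (rule sum.union_inter_neutral[OF fin], clarify)
    fix s K assume "(s, K) \<in> D1" "(s, K) \<in> D2"
    then have "K \<subseteq> {a}" using tag1 tag2 by fastforce
    then show "measure lborel K *\<^sub>R y s x = 0" by (simp add: measure_degenerate)
  qed
  have wm: "mem_Lp 2 wa" "mem_Lp 2 wb" using wa wb unfolding has_L2_integral_def by auto
  have le1: "L2_dist (R D1) wa \<le> \<epsilon> / 2" using d1(2)[OF D1(1) f1] by (simp add: R_def)
  have le2: "Lp_norm 2 (\<lambda>x. wb x - (R D1 x + R D2 x)) \<le> \<epsilon> / 2"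
    using d2(2)[OF D f2] unfolding R_def[symmetric] R12 by (subst L2_norm_minus) simp
  have content: "(\<Sum>(s, K)\<in>D2. measure lborel K) = b - a"
    using additive_content_tagged_division[of D2 a b] D2(1) ab by simp
  have "R D2 x - (b - a) *\<^sub>R y c x = (\<Sum>p\<in>D2. measure lborel (snd p) *\<^sub>R (y (fst p) x - y c x))" for x
    unfolding R_def content[symmetric] case_prod_unfold
    by (simp only: scaleR_right_diff_distrib sum_subtractf scaleR_left.sum)
  then have "Lp_norm 2 (\<lambda>x. R D2 x - (b - a) *\<^sub>R y c x)
      = Lp_norm 2 (\<lambda>x. \<Sum>p\<in>D2. measure lborel (snd p) *\<^sub>R (y (fst p) x - y c x))" by simp
  also have "\<dots> \<le> (\<Sum>p\<in>D2. Lp_norm 2 (\<lambda>x. measure lborel (snd p) *\<^sub>R (y (fst p) x - y c x)))"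
    using tag2 ab c by (intro conjunct2[OF L2_sum] fin L2_scaleR L2_diff y) fastforce+
  also have "\<dots> \<le> (\<Sum>p\<in>D2. measure lborel (snd p) * \<eta>)"
  proof (rule sum_mono)
    fix p assume "p \<in> D2"
    then have p: "a \<le> fst p" "fst p \<le> b" using tag2[of "fst p" "snd p"] by auto
    have "Lp_norm 2 (\<lambda>x. measure lborel (snd p) *\<^sub>R (y (fst p) x - y c x)) \<le> \<bar>measure lborel (snd p)\<bar> * L2_dist (y (fst p)) (y c)"
      using p ab c by (intro L2_scaleR L2_diff y) auto
    also have "\<dots> \<le> measure lborel (snd p) * \<eta>" using \<eta>[OF p] by (simp add: mult_left_mono)
    finally show "Lp_norm 2 (\<lambda>x. measure lborel (snd p) *\<^sub>R (y (fst p) x - y c x)) \<le> measure lborel (snd p) * \<eta>" .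
  qed
  also have "\<dots> = (b - a) * \<eta>" unfolding content[symmetric] sum_distrib_right by (simp add: case_prod_unfold)
  finally have le3: "Lp_norm 2 (\<lambda>x. R D2 x - (b - a) *\<^sub>R y c x) \<le> (b - a) * \<eta>" .
  note m = L2_diff(1)[OF wm(2) L2_add(1)[OF R1 R2]] L2_diff(1)[OF R1 wm(1)] L2_diff(1)[OF R2 L2_scaleR(1)[OF y[OF c], of "b - a"]]
  have "Lp_norm 2 (\<lambda>x. wb x - wa x - (b - a) *\<^sub>R y c x)
      = Lp_norm 2 (\<lambda>x. ((wb x - (R D1 x + R D2 x)) + (R D1 x - wa x)) + (R D2 x - (b - a) *\<^sub>R y c x))"
    by (simp add: algebra_simps)
  also have "\<dots> \<le> (\<epsilon> / 2 + \<epsilon> / 2) + (b - a) * \<eta>"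
    using L2_add(2)[OF L2_add(1)[OF m(1,2)] m(3)] L2_add(2)[OF m(1,2)] le1 le2 le3 by linarith
  finally show "Lp_norm 2 (\<lambda>x. wb x - wa x - (b - a) *\<^sub>R y c x) \<le> (b - a) * \<eta> + \<epsilon>" by simp
qed

abbreviation L2_remainder :: "(real \<Rightarrow> real \<Rightarrow> 'a::real_normed_vector) \<Rightarrow> (real \<Rightarrow> 'a) \<Rightarrow> real \<Rightarrow> real \<Rightarrow> real" where
  "L2_remainder X X' s t \<equiv> Lp_norm 2 (\<lambda>x. X s x - X t x - (s - t) *\<^sub>R X' x)"

text \<open>Differentiability at \<open>t\<close> of a curve in \<open>L\<^sup>2\<close>, one-sided at \<open>t = 0\<close>.
  Curves are families of functions and not of equivalence classes, which is why the derivative is stated with the norm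
  of the remainder.\<close>

definition L2_deriv :: "(real \<Rightarrow> real \<Rightarrow> 'a::euclidean_space) \<Rightarrow> (real \<Rightarrow> 'a) \<Rightarrow> real \<Rightarrow> bool" where
  "L2_deriv X X' t \<longleftrightarrow>
    (\<forall>\<epsilon>>0. \<exists>\<delta>>0. \<forall>s\<ge>0. \<bar>s - t\<bar> < \<delta> \<longrightarrow> L2_remainder X X' s t \<le> \<epsilon> * \<bar>s - t\<bar>)"

text \<open>The fundamental theorem of calculus. It holds at every \<open>t\<close> because the integrand is continuous.\<close>

lemma L2_integral_deriv:
  assumes y: "continuous_L2 y" and w: "\<And>s. s \<ge> 0 \<Longrightarrow> has_L2_integral y (w s) 0 s" and t: "t \<ge> 0"
  shows "L2_deriv w (y t) t"
  unfolding L2_deriv_def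
proof (intro allI impI)
  fix \<epsilon> :: real assume e: "\<epsilon> > 0"
  have ym: "mem_Lp 2 (y s)" if "0 \<le> s" for s using y that unfolding continuous_L2_def by blast
  have "((\<lambda>s. L2_dist (y s) (y t)) \<longlongrightarrow> 0) (at t within {0..})"
    using y t unfolding continuous_L2_def by blast
  from tendstoD[OF this e] obtain \<delta> where d: "\<delta> > 0"
    "\<And>s. s \<ge> 0 \<Longrightarrow> s \<noteq> t \<Longrightarrow> \<bar>s - t\<bar> < \<delta> \<Longrightarrow> L2_dist (y s) (y t) < \<epsilon>"
    unfolding eventually_at dist_real_def by auto
  have le: "L2_dist (y s) (y t) \<le> \<epsilon>" if "s \<ge> 0" "\<bar>s - t\<bar> < \<delta>" for s
    using d(2)[OF that(1) _ that(2)] e by (cases "s = t") (auto simp: Lp_norm_def)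
  have "L2_remainder w (y t) s t \<le> \<epsilon> * \<bar>s - t\<bar>" if s: "s \<ge> 0" "\<bar>s - t\<bar> < \<delta>" for s
  proof (cases "t \<le> s")
    case True
    have "L2_remainder w (y t) s t \<le> (s - t) * \<epsilon>"
      by (rule has_L2_integral_increment[OF t True t w[OF t] w[OF s(1)] ym le]) (use s True t in auto)
    then show ?thesis using True by (simp add: mult.commute)
  next
    case False
    have "L2_remainder w (y t) s t = Lp_norm 2 (\<lambda>x. w t x - w s x - (t - s) *\<^sub>R y t x)"
    proof -
      have "w s x - w t x - (s - t) *\<^sub>R y t x = - (w t x - w s x - (t - s) *\<^sub>R y t x)" for x
        by (simp add: algebra_simps)
      then show ?thesis by (simp only: Lp_norm_def norm_minus_cancel)
    qed
    also have "\<dots> \<le> (t - s) * \<epsilon>"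
      by (rule has_L2_integral_increment[OF s(1) _ t w[OF s(1)] w[OF t] ym le]) (use s False in auto)
    finally show ?thesis using False by (simp add: mult.commute)
  qed
  with d(1) show "\<exists>\<delta>>0. \<forall>s\<ge>0. \<bar>s - t\<bar> < \<delta> \<longrightarrow> L2_remainder w (y t) s t \<le> \<epsilon> * \<bar>s - t\<bar>"
    by blast
qed

text \<open>Bounded linear operations preserve differentiability; they enter through the norm of the remainder, so that
  operations defined only up to null sets, like the Fourier transform, are covered.\<close>

lemma L2_deriv_lipschitz:
  fixes X :: "real \<Rightarrow> real \<Rightarrow> 'a::euclidean_space" and Y :: "real \<Rightarrow> real \<Rightarrow> 'b::euclidean_space"
  assumes X: "L2_deriv X X' t" and K: "0 \<le> K"
    and le: "\<And>s. s \<ge> 0 \<Longrightarrow> L2_remainder Y Y' s t \<le> K * L2_remainder X X' s t"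
  shows "L2_deriv Y Y' t"
  unfolding L2_deriv_def
proof (intro allI impI)
  fix \<epsilon> :: real assume "\<epsilon> > 0"
  then have "\<epsilon> / (K + 1) > 0" using K by simp
  then obtain \<delta> where d: "\<delta> > 0" "\<And>s. s \<ge> 0 \<Longrightarrow> \<bar>s - t\<bar> < \<delta> \<Longrightarrow>
      L2_remainder X X' s t \<le> \<epsilon> / (K + 1) * \<bar>s - t\<bar>"
    using X unfolding L2_deriv_def by blast
  have "L2_remainder Y Y' s t \<le> \<epsilon> * \<bar>s - t\<bar>" if s: "s \<ge> 0" "\<bar>s - t\<bar> < \<delta>" for s
  proof -
    have "L2_remainder Y Y' s t \<le> K * (\<epsilon> / (K + 1) * \<bar>s - t\<bar>)"
      using le[OF s(1)] mult_left_mono[OF d(2)[OF s] K] by linarith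
    also have "\<dots> \<le> (K + 1) * (\<epsilon> / (K + 1) * \<bar>s - t\<bar>)" using K \<open>\<epsilon> > 0\<close> by (intro mult_right_mono) auto
    also have "\<dots> = \<epsilon> * \<bar>s - t\<bar>" using K by simp
    finally show ?thesis .
  qed
  with d(1) show "\<exists>\<delta>>0. \<forall>s\<ge>0. \<bar>s - t\<bar> < \<delta> \<longrightarrow> L2_remainder Y Y' s t \<le> \<epsilon> * \<bar>s - t\<bar>"
    by blast
qed

lemma L2_deriv_add:
  fixes X Y :: "real \<Rightarrow> real \<Rightarrow> 'a::euclidean_space"
  assumes X: "L2_deriv X X' t" and Y: "L2_deriv Y Y' t" and t: "t \<ge> 0"
    and m: "\<And>s. s \<ge> 0 \<Longrightarrow> mem_Lp 2 (X s)" "mem_Lp 2 X'" "\<And>s. s \<ge> 0 \<Longrightarrow> mem_Lp 2 (Y s)" "mem_Lp 2 Y'"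
  shows "L2_deriv (\<lambda>s x. X s x + Y s x) (\<lambda>x. X' x + Y' x) t"
  unfolding L2_deriv_def
proof (intro allI impI)
  fix \<epsilon> :: real assume "\<epsilon> > 0"
  then have e: "\<epsilon> / 2 > 0" by simp
  obtain \<delta>1 where d1: "\<delta>1 > 0" "\<And>s. s \<ge> 0 \<Longrightarrow> \<bar>s - t\<bar> < \<delta>1 \<Longrightarrow>
      L2_remainder X X' s t \<le> \<epsilon> / 2 * \<bar>s - t\<bar>"
    using X e unfolding L2_deriv_def by blast
  obtain \<delta>2 where d2: "\<delta>2 > 0" "\<And>s. s \<ge> 0 \<Longrightarrow> \<bar>s - t\<bar> < \<delta>2 \<Longrightarrow>
      L2_remainder Y Y' s t \<le> \<epsilon> / 2 * \<bar>s - t\<bar>"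
    using Y e unfolding L2_deriv_def by blast
  have "Lp_norm 2 (\<lambda>x. X s x + Y s x - (X t x + Y t x) - (s - t) *\<^sub>R (X' x + Y' x)) \<le> \<epsilon> * \<bar>s - t\<bar>"
    if s: "s \<ge> 0" "\<bar>s - t\<bar> < min \<delta>1 \<delta>2" for s
  proof -
    have "Lp_norm 2 (\<lambda>x. X s x + Y s x - (X t x + Y t x) - (s - t) *\<^sub>R (X' x + Y' x))
        = Lp_norm 2 (\<lambda>x. (X s x - X t x - (s - t) *\<^sub>R X' x) + (Y s x - Y t x - (s - t) *\<^sub>R Y' x))"
      by (simp add: algebra_simps)
    also have "\<dots> \<le> L2_remainder X X' s t + L2_remainder Y Y' s t"
      by (intro L2_add L2_diff L2_scaleR m s t)
    also have "\<dots> \<le> \<epsilon> / 2 * \<bar>s - t\<bar> + \<epsilon> / 2 * \<bar>s - t\<bar>" using d1(2) d2(2) s by (intro add_mono) auto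
    finally show ?thesis by simp
  qed
  then show "\<exists>\<delta>>0. \<forall>s\<ge>0. \<bar>s - t\<bar> < \<delta> \<longrightarrow>
      Lp_norm 2 (\<lambda>x. X s x + Y s x - (X t x + Y t x) - (s - t) *\<^sub>R (X' x + Y' x)) \<le> \<epsilon> * \<bar>s - t\<bar>"
    using d1(1) d2(1) by (intro exI[of _ "min \<delta>1 \<delta>2"]) auto
qed

lemma L2_deriv_remainder_tendsto:
  assumes X: "L2_deriv X X' t" and t: "t \<ge> 0"
  shows "((\<lambda>s. L2_remainder X X' s t / \<bar>s - t\<bar>) \<longlongrightarrow> 0) (at t within {0..})"
proof (rule tendstoI)
  fix e :: real assume "e > 0"
  then have "e / 2 > 0" by simp
  then obtain \<delta> where d: "\<delta> > 0" "\<And>s. s \<ge> 0 \<Longrightarrow> \<bar>s - t\<bar> < \<delta> \<Longrightarrow>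
      L2_remainder X X' s t \<le> e / 2 * \<bar>s - t\<bar>"
    using X unfolding L2_deriv_def by blast
  show "\<forall>\<^sub>F s in at t within {0..}. dist (L2_remainder X X' s t / \<bar>s - t\<bar>) 0 < e"
    unfolding eventually_at
  proof (intro exI[of _ \<delta>] conjI ballI impI d(1))
    fix s assume "s \<in> {0..}" and s: "s \<noteq> t \<and> dist s t < \<delta>"
    then have "L2_remainder X X' s t \<le> e / 2 * \<bar>s - t\<bar>"
      using d(2)[of s] by (simp add: dist_real_def)
    then have "L2_remainder X X' s t / \<bar>s - t\<bar> \<le> e / 2"
      using s by (simp add: divide_le_eq)
    then have "L2_remainder X X' s t / \<bar>s - t\<bar> < e"
      using \<open>e > 0\<close> by linarith
    moreover have "0 \<le> L2_remainder X X' s t / \<bar>s - t\<bar>" by simp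
    ultimately show "dist (L2_remainder X X' s t / \<bar>s - t\<bar>) 0 < e"
      by (simp only: dist_real_def diff_0_right abs_of_nonneg)
  qed
qed

text \<open>The product rule for the sesquilinear form \<open>\<integral> cnj X Y\<close>: the increment of the form is
  \<open>\<integral> cnj \<rho> Y + \<integral> cnj X \<sigma> + \<integral> cnj \<alpha> \<beta>\<close> beyond its
  linear part, with remainders \<open>\<rho>\<close>, \<open>\<sigma>\<close> and increments \<open>\<alpha>\<close>,
  \<open>\<beta>\<close>, all estimated by the Cauchy--Schwarz inequality.\<close>

lemma L2_deriv_product:
  fixes X Y :: "real \<Rightarrow> real \<Rightarrow> complex"
  assumes X: "L2_deriv X X' t" and Y: "L2_deriv Y Y' t" and t: "t \<ge> 0"
    and m: "\<And>s. s \<ge> 0 \<Longrightarrow> mem_Lp 2 (X s)" "mem_Lp 2 X'" "\<And>s. s \<ge> 0 \<Longrightarrow> mem_Lp 2 (Y s)" "mem_Lp 2 Y'"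
  shows "((\<lambda>s. LINT x|lborel. cnj (X s x) * Y s x) has_vector_derivative
     (LINT x|lborel. cnj (X' x) * Y t x + cnj (X t x) * Y' x)) (at t within {0..})"
proof -
  define \<rho> where "\<rho> s x = X s x - X t x - (s - t) *\<^sub>R X' x" for s x
  define \<sigma> where "\<sigma> s x = Y s x - Y t x - (s - t) *\<^sub>R Y' x" for s x
  note mt = m(1)[OF t] m(3)[OF t]
  have \<rho>m: "mem_Lp 2 (\<rho> s)" and \<sigma>m: "mem_Lp 2 (\<sigma> s)" if "s \<ge> 0" for s
    unfolding \<rho>_def \<sigma>_def by (intro L2_diff L2_scaleR m that t)+
  define r where "r s = Lp_norm 2 (\<rho> s) / \<bar>s - t\<bar>" for s
  define q where "q s = Lp_norm 2 (\<sigma> s) / \<bar>s - t\<bar>" for s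
  have r: "(r \<longlongrightarrow> 0) (at t within {0..})" and q: "(q \<longlongrightarrow> 0) (at t within {0..})"
    unfolding r_def q_def \<rho>_def \<sigma>_def by (rule L2_deriv_remainder_tendsto[OF X t], rule L2_deriv_remainder_tendsto[OF Y t])
  define L where "L = (LINT x|lborel. cnj (X' x) * Y t x + cnj (X t x) * Y' x)"
  define P where "P s = (LINT x|lborel. cnj (X s x) * Y s x)" for s
  define B where "B s = r s * Lp_norm 2 (Y t) + (Lp_norm 2 (X t)) * q s
      + \<bar>s - t\<bar> * (Lp_norm 2 X' + r s) * (Lp_norm 2 Y' + q s)" for s
  have bound: "norm ((P s - P t - (s - t) *\<^sub>R L) /\<^sub>R \<bar>s - t\<bar>) \<le> B s" if s: "s \<ge> 0" "s \<noteq> t" for s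
  proof -
    define h where "h = s - t"
    have h: "\<bar>h\<bar> > 0" using s by (simp add: h_def)
    have rs: "Lp_norm 2 (\<rho> s) = \<bar>h\<bar> * r s" "Lp_norm 2 (\<sigma> s) = \<bar>h\<bar> * q s" using h by (simp_all add: r_def q_def h_def)
    define \<alpha> \<beta> where "\<alpha> x = h *\<^sub>R X' x + \<rho> s x" and "\<beta> x = h *\<^sub>R Y' x + \<sigma> s x" for x
    have \<alpha>: "mem_Lp 2 \<alpha>" "Lp_norm 2 \<alpha> \<le> \<bar>h\<bar> * (Lp_norm 2 X' + r s)"
      using L2_add[OF L2_scaleR(1)[OF m(2), of h] \<rho>m[OF s(1)]] L2_scaleR(2)[OF m(2), of h] rs(1)
      unfolding \<alpha>_def by (auto simp: distrib_left)
    have \<beta>: "mem_Lp 2 \<beta>" "Lp_norm 2 \<beta> \<le> \<bar>h\<bar> * (Lp_norm 2 Y' + q s)"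
      using L2_add[OF L2_scaleR(1)[OF m(4), of h] \<sigma>m[OF s(1)]] L2_scaleR(2)[OF m(4), of h] rs(2)
      unfolding \<beta>_def by (auto simp: distrib_left)
    note i = L2_mult_integrable[OF L2_cnj(1)[OF \<rho>m[OF s(1)]] mt(2)] L2_mult_integrable[OF L2_cnj(1)[OF mt(1)] \<sigma>m[OF s(1)]]
      L2_mult_integrable[OF L2_cnj(1)[OF \<alpha>(1)] \<beta>(1)]
    have iL: "integrable lborel (\<lambda>x. cnj (X' x) * Y t x + cnj (X t x) * Y' x)"
      by (intro Bochner_Integration.integrable_add L2_mult_integrable L2_cnj m t)
    have iP: "integrable lborel (\<lambda>x. cnj (X s x) * Y s x)" "integrable lborel (\<lambda>x. cnj (X t x) * Y t x)"
      by (intro L2_mult_integrable L2_cnj m t s)+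
    have "P s - P t - h *\<^sub>R L = (LINT x|lborel. cnj (X s x) * Y s x - cnj (X t x) * Y t x - h *\<^sub>R (cnj (X' x) * Y t x + cnj (X t x) * Y' x))"
      unfolding P_def L_def using iP iL
      by (simp only: Bochner_Integration.integral_diff Bochner_Integration.integrable_diff integral_scaleR_right integrable_scaleR_right)
    also have "\<dots> = (LINT x|lborel. cnj (\<rho> s x) * Y t x + cnj (X t x) * \<sigma> s x + cnj (\<alpha> x) * \<beta> x)"
    proof (rule Bochner_Integration.integral_cong[OF refl])
      fix x
      have e: "X s x = X t x + \<alpha> x" "Y s x = Y t x + \<beta> x" by (simp_all add: \<alpha>_def \<beta>_def \<rho>_def \<sigma>_def h_def)
      show "cnj (X s x) * Y s x - cnj (X t x) * Y t x - h *\<^sub>R (cnj (X' x) * Y t x + cnj (X t x) * Y' x)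
        = cnj (\<rho> s x) * Y t x + cnj (X t x) * \<sigma> s x + cnj (\<alpha> x) * \<beta> x"
        unfolding e by (simp add: \<alpha>_def \<beta>_def scaleR_conv_of_real algebra_simps)
    qed
    also have "\<dots> = (LINT x|lborel. cnj (\<rho> s x) * Y t x) + (LINT x|lborel. cnj (X t x) * \<sigma> s x) + (LINT x|lborel. cnj (\<alpha> x) * \<beta> x)"
      using i by (simp only: Bochner_Integration.integral_add Bochner_Integration.integrable_add)
    also have "norm \<dots> \<le> Lp_norm 2 (\<rho> s) * Lp_norm 2 (Y t) + Lp_norm 2 (X t) * Lp_norm 2 (\<sigma> s) + Lp_norm 2 \<alpha> * Lp_norm 2 \<beta>"
      using L2_mult_bound[OF L2_cnj(1)[OF \<rho>m[OF s(1)]] mt(2)] L2_mult_bound[OF L2_cnj(1)[OF mt(1)] \<sigma>m[OF s(1)]]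
        L2_mult_bound[OF L2_cnj(1)[OF \<alpha>(1)] \<beta>(1)]
      unfolding L2_cnj(2)[OF \<rho>m[OF s(1)]] L2_cnj(2)[OF mt(1)] L2_cnj(2)[OF \<alpha>(1)]
      by (intro norm_triangle_mono)
    also have "\<dots> \<le> \<bar>h\<bar> * r s * Lp_norm 2 (Y t) + Lp_norm 2 (X t) * (\<bar>h\<bar> * q s) + (\<bar>h\<bar> * (Lp_norm 2 X' + r s)) * (\<bar>h\<bar> * (Lp_norm 2 Y' + q s))"
      unfolding rs using order_trans[OF Lp_norm_nonneg \<alpha>(2)] by (intro add_left_mono mult_mono \<alpha> \<beta>) auto
    also have "\<dots> = \<bar>h\<bar> * B s" unfolding B_def h_def[symmetric] by (simp add: algebra_simps)
    finally have "norm (P s - P t - h *\<^sub>R L) \<le> \<bar>h\<bar> * B s" .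
    then have "norm (P s - P t - h *\<^sub>R L) / \<bar>h\<bar> \<le> B s" using h by (simp add: divide_le_eq mult.commute)
    then show ?thesis by (simp add: h_def divide_inverse mult.commute)
  qed
  have "((\<lambda>s. s - t) \<longlongrightarrow> t - t) (at t within {0..})" by (intro tendsto_intros)
  then have h0: "((\<lambda>s. \<bar>s - t\<bar>) \<longlongrightarrow> 0) (at t within {0..})" by (simp add: tendsto_rabs_zero)
  have "(B \<longlongrightarrow> 0 * Lp_norm 2 (Y t) + Lp_norm 2 (X t) * 0 + 0 * (Lp_norm 2 X' + 0) * (Lp_norm 2 Y' + 0)) (at t within {0..})"
    unfolding B_def[abs_def] by (intro tendsto_intros r q h0)
  then have B0: "(B \<longlongrightarrow> 0) (at t within {0..})" by simp
  have "((\<lambda>s. (P s - P t - (s - t) *\<^sub>R L) /\<^sub>R \<bar>s - t\<bar>) \<longlongrightarrow> 0) (at t within {0..})"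
  proof (rule Lim_null_comparison[OF _ B0])
    show "\<forall>\<^sub>F s in at t within {0..}. norm ((P s - P t - (s - t) *\<^sub>R L) /\<^sub>R \<bar>s - t\<bar>) \<le> B s"
      unfolding eventually_at by (intro exI[of _ 1] conjI ballI impI bound) auto
  qed
  moreover have "(1 / norm (s - t)) *\<^sub>R (P s - (P t + (s - t) *\<^sub>R L)) = (P s - P t - (s - t) *\<^sub>R L) /\<^sub>R \<bar>s - t\<bar>" for s
    by (simp only: diff_diff_eq inverse_eq_divide real_norm_def)
  ultimately have "((\<lambda>s. (1 / norm (s - t)) *\<^sub>R (P s - (P t + (s - t) *\<^sub>R L))) \<longlongrightarrow> 0) (at t within {0..})"
    by (simp only:)
  then have "(P has_vector_derivative L) (at t within {0..})"
    unfolding has_vector_derivative_def has_derivative_within using bounded_linear_scaleR_left by blast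
  then show ?thesis unfolding P_def L_def .
qed

section \<open>The Lyapunov inequality for a single frequency\<close>

text \<open>The off-diagonal entries of the matrix \<^const>\<open>P_tilde\<close> are \<open>-\<i>\<close> and
  \<open>\<i>\<close> times this number; its eigenvalues are \<open>1 - coupling \<xi>\<close> and \<open>1 + coupling
  \<xi>\<close>.\<close>

definition coupling :: "real \<Rightarrow> real" where
  "coupling \<xi> = 2 * \<xi> / (1 + 4 * \<xi>\<^sup>2)"

text \<open>The quadratic form of \<^const>\<open>P_tilde\<close> at the vector \<open>(z, w)\<close>.\<close>

definition energy_density :: "real \<Rightarrow> complex \<Rightarrow> complex \<Rightarrow> real" where
  "energy_density \<xi> z w = (cmod z)\<^sup>2 + (cmod w)\<^sup>2 + 2 * coupling \<xi> * Im (cnj z * w)"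

lemma abs_Im_cnj_mult_le: "\<bar>Im (cnj z * w)\<bar> \<le> cmod z * cmod w"
  using abs_Im_le_cmod[of "cnj z * w"] by (simp add: norm_mult)

lemma energy_density_bounds:
  "(1 - \<bar>coupling \<xi>\<bar>) * ((cmod z)\<^sup>2 + (cmod w)\<^sup>2) \<le> energy_density \<xi> z w"
  "energy_density \<xi> z w \<le> (1 + \<bar>coupling \<xi>\<bar>) * ((cmod z)\<^sup>2 + (cmod w)\<^sup>2)"
proof -
  have "2 * \<bar>Im (cnj z * w)\<bar> \<le> (cmod z)\<^sup>2 + (cmod w)\<^sup>2"
    using abs_Im_cnj_mult_le[of z w] sum_squares_bound[of "cmod z" "cmod w"] by linarith
  then have "\<bar>coupling \<xi>\<bar> * (2 * \<bar>Im (cnj z * w)\<bar>) \<le> \<bar>coupling \<xi>\<bar> * ((cmod z)\<^sup>2 + (cmod w)\<^sup>2)"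
    by (rule mult_left_mono) simp
  then have "\<bar>2 * coupling \<xi> * Im (cnj z * w)\<bar> \<le> \<bar>coupling \<xi>\<bar> * ((cmod z)\<^sup>2 + (cmod w)\<^sup>2)"
    by (simp only: abs_mult abs_numeral mult.left_commute mult.assoc)
  from abs_le_D1[OF this] abs_le_D2[OF this]
  show "(1 - \<bar>coupling \<xi>\<bar>) * ((cmod z)\<^sup>2 + (cmod w)\<^sup>2) \<le> energy_density \<xi> z w"
    "energy_density \<xi> z w \<le> (1 + \<bar>coupling \<xi>\<bar>) * ((cmod z)\<^sup>2 + (cmod w)\<^sup>2)"
    unfolding energy_density_def left_diff_distrib distrib_right[of 1] mult_1 by auto
qed

lemma abs_coupling_le_half: "\<bar>coupling \<xi>\<bar> \<le> 1 / 2"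
proof -
  have "0 \<le> (2 * \<bar>\<xi>\<bar> - 1)\<^sup>2" by simp
  then have "4 * \<bar>\<xi>\<bar> \<le> 1 + 4 * \<xi>\<^sup>2" by (simp add: power2_eq_square algebra_simps)
  then show ?thesis using one_plus_sq_pos[of \<xi>] unfolding coupling_def by (simp add: abs_mult divide_le_eq)
qed

lemma energy_density_nonneg: "0 \<le> energy_density \<xi> z w"
proof -
  have "0 \<le> (1 - \<bar>coupling \<xi>\<bar>) * ((cmod z)\<^sup>2 + (cmod w)\<^sup>2)"
    using abs_coupling_le_half[of \<xi>] by (intro mult_nonneg_nonneg) auto
  then show ?thesis using energy_density_bounds(1) order_trans by blast
qed

text \<open>The left-hand side is minus the quadratic form of \<open>C\<^sup>* P + P C\<close>, where \<open>P\<close> is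
  \<^const>\<open>P_tilde\<close> and \<open>C = ((0, \<i>\<xi>), (\<i>\<xi>, 1))\<close> generates the mode at
  frequency \<open>\<xi>\<close>. The matrix \<open>C\<^sup>* P + P C - 2 \<mu> P\<close> has the diagonal entries
  \<open>\<alpha>\<close> and \<open>\<gamma>\<close> and off-diagonal entries of modulus
  \<open>\<bar>\<beta>\<bar>\<close>. Its determinant vanishes, because \<open>1 - 2 \<mu>\<close> is \<open>1 / sqrt
  s\<close> with \<open>s = (1 + 4 \<xi>\<^sup>2)\<^sup>2 - 4 \<xi>\<^sup>2\<close>, and its diagonal is nonnegative.
  So it is positive semidefinite.\<close>

lemma lyapunov_inequality:
  "- 2 * (cmod w)\<^sup>2 + 2 * coupling \<xi> * \<xi> * (cmod w)\<^sup>2 - 2 * coupling \<xi> * \<xi> * (cmod z)\<^sup>2 - 2 * coupling \<xi> * Im (cnj z * w)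
    \<le> - 2 * mu_tilde \<xi> * energy_density \<xi> z w"
proof -
  define d s a \<mu> b where "d = 1 + 4 * \<xi>\<^sup>2" and "s = 1 + 4 * \<xi>\<^sup>2 * (1 + 4 * \<xi>\<^sup>2)"
    and "a = coupling \<xi>" and "\<mu> = mu_tilde \<xi>" and "b = coupling \<xi> * \<xi>"
  have d: "d > 0" unfolding d_def by (rule one_plus_sq_pos)
  have s_eq: "s = d\<^sup>2 - 4 * \<xi>\<^sup>2" unfolding s_def d_def by (simp add: power2_eq_square algebra_simps)
  have s1: "1 \<le> s" unfolding s_def by simp
  have sd: "s \<le> d\<^sup>2" unfolding s_eq by simp
  have \<mu>: "1 - 2 * \<mu> = 1 / sqrt s" unfolding \<mu>_def mu_tilde_def s_def[symmetric] by (simp add: field_simps)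
  have b: "1 - 2 * b = 1 / d" using d unfolding b_def coupling_def d_def[symmetric]
    by (simp add: field_simps power2_eq_square) (simp add: d_def power2_eq_square)
  have "sqrt s \<le> d" using real_sqrt_le_mono[OF sd] d by simp
  then have "1 / d \<le> 1 / sqrt s" using s1 by (intro divide_left_mono) (auto intro: mult_pos_pos d)
  then have b\<mu>: "\<mu> \<le> b" using \<mu> b by linarith
  have "0 < 1 / d" "0 \<le> 1 / sqrt s" using d s1 by auto
  then have b\<mu>1: "0 \<le> 1 - b - \<mu>" using \<mu> b by linarith
  define \<alpha> \<gamma> \<beta> where "\<alpha> = 2 * (b - \<mu>)" and "\<gamma> = 2 * (1 - b - \<mu>)" and "\<beta> = a * (1 - 2 * \<mu>)"
  have \<alpha>\<gamma>: "0 \<le> \<alpha>" "0 \<le> \<gamma>" unfolding \<alpha>_def \<gamma>_def using b\<mu> b\<mu>1 by auto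
  have "\<alpha> * \<gamma> = (1 - 2 * \<mu>)\<^sup>2 - (1 - 2 * b)\<^sup>2"
    unfolding \<alpha>_def \<gamma>_def by (simp add: power2_eq_square algebra_simps)
  also have "\<dots> = 1 / s - 1 / d\<^sup>2" unfolding \<mu> b using s1 by (simp add: power_divide)
  also have "\<dots> = (d\<^sup>2 - s) / (s * d\<^sup>2)" using s1 d by (simp add: field_simps)
  also have "\<dots> = (4 * \<xi>\<^sup>2 / d\<^sup>2) * (1 / s)" unfolding s_eq by simp
  also have "\<dots> = \<beta>\<^sup>2"
    unfolding \<beta>_def \<mu> a_def coupling_def d_def[symmetric] power_mult_distrib power_divide using s1 by simp
  finally have det: "\<alpha> * \<gamma> = \<beta>\<^sup>2" .
  have "sqrt \<alpha> * sqrt \<gamma> = \<bar>\<beta>\<bar>" using det by (simp add: real_sqrt_mult[symmetric])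
  have "\<bar>\<beta> * Im (cnj z * w)\<bar> \<le> \<bar>\<beta>\<bar> * (cmod z * cmod w)"
    unfolding abs_mult by (intro mult_left_mono abs_Im_cnj_mult_le) simp
  also have "\<dots> = (sqrt \<alpha> * cmod z) * (sqrt \<gamma> * cmod w)"
    unfolding \<open>sqrt \<alpha> * sqrt \<gamma> = \<bar>\<beta>\<bar>\<close>[symmetric] by simp
  finally have "2 * \<bar>\<beta> * Im (cnj z * w)\<bar> \<le> (sqrt \<alpha> * cmod z)\<^sup>2 + (sqrt \<gamma> * cmod w)\<^sup>2"
    using sum_squares_bound[of "sqrt \<alpha> * cmod z" "sqrt \<gamma> * cmod w"] by linarith
  also have "\<dots> = \<alpha> * (cmod z)\<^sup>2 + \<gamma> * (cmod w)\<^sup>2" using \<alpha>\<gamma> by (simp add: power_mult_distrib)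
  finally have "0 \<le> \<alpha> * (cmod z)\<^sup>2 + \<gamma> * (cmod w)\<^sup>2 + 2 * (\<beta> * Im (cnj z * w))" by linarith
  moreover have "\<alpha> * (cmod z)\<^sup>2 + \<gamma> * (cmod w)\<^sup>2 + 2 * (\<beta> * Im (cnj z * w))
     = - 2 * \<mu> * energy_density \<xi> z w - (- 2 * (cmod w)\<^sup>2 + 2 * b * (cmod w)\<^sup>2 - 2 * b * (cmod z)\<^sup>2 - 2 * a * Im (cnj z * w))"
    unfolding \<alpha>_def \<gamma>_def \<beta>_def energy_density_def a_def[symmetric] by (simp add: algebra_simps)
  ultimately show ?thesis unfolding a_def b_def \<mu>_def by (simp add: mult.assoc)
qed

text \<open>With this factor the energy density is the real part of \<open>\<bar>z\<bar>\<^sup>2 + \<bar>w\<bar>\<^sup>2 + cnj z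
  (polarizer \<xi> w)\<close>, a sum of three sesquilinear terms, so that the product rule applies.\<close>

definition polarizer :: "real \<Rightarrow> complex" where
  "polarizer \<xi> = - 2 * \<i> * of_real (coupling \<xi>)"

lemma polarizer: "polarizer \<in> borel_measurable borel" "cmod (polarizer \<xi>) \<le> 1"
proof -
  have "1 + 4 * \<xi>\<^sup>2 \<noteq> 0" for \<xi> :: real using one_plus_sq_pos[of \<xi>] by linarith
  then show "polarizer \<in> borel_measurable borel"
    unfolding polarizer_def[abs_def] coupling_def
    by (intro borel_measurable_continuous_onI continuous_intros) auto
  show "cmod (polarizer \<xi>) \<le> 1" using abs_coupling_le_half[of \<xi>] by (simp add: polarizer_def norm_mult)
qed

lemma energy_density_complex:
  "Re (cnj z * z + cnj w * w + cnj z * (polarizer \<xi> * w)) = energy_density \<xi> z w"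
  unfolding energy_density_def polarizer_def cmod_power2 by (simp add: power2_eq_square algebra_simps)

text \<open>The time derivative of the energy density along a solution \<open>(z, w)\<close> of the mode equation, in the form
  in which the product rule produces it.\<close>

lemma energy_density_derivative:
  assumes "z' = - \<i> * of_real \<xi> * w" "w' = - \<i> * of_real \<xi> * z - w"
  shows "Re ((cnj z' * z + cnj z * z') + (cnj w' * w + cnj w * w') + (cnj z' * (polarizer \<xi> * w) + cnj z * (polarizer \<xi> * w')))
    \<le> - 2 * mu_tilde \<xi> * energy_density \<xi> z w"
proof -
  have "Re ((cnj z' * z + cnj z * z') + (cnj w' * w + cnj w * w') + (cnj z' * (polarizer \<xi> * w) + cnj z * (polarizer \<xi> * w')))
    = - 2 * (cmod w)\<^sup>2 + 2 * coupling \<xi> * \<xi> * (cmod w)\<^sup>2 - 2 * coupling \<xi> * \<xi> * (cmod z)\<^sup>2 - 2 * coupling \<xi> * Im (cnj z * w)"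
    unfolding assms polarizer_def cmod_power2 by (simp add: power2_eq_square algebra_simps)
  then show ?thesis using lyapunov_inequality by (simp only:)
qed

section \<open>Decay of the energy in a set of frequencies\<close>

lemma L2_bounded_mult:
  fixes g X :: "real \<Rightarrow> complex"
  assumes "mem_Lp 2 X" "g \<in> borel_measurable borel" "\<And>x. cmod (g x) \<le> K"
  shows "mem_Lp 2 (\<lambda>x. g x * X x)" "Lp_norm 2 (\<lambda>x. g x * X x) \<le> K * Lp_norm 2 X"
proof -
  have K: "0 \<le> K" using assms(3) norm_ge_zero order_trans by blast
  have m: "(\<lambda>x. g x * X x) \<in> borel_measurable borel"
    by (intro borel_measurable_times assms(2) L2_measurable assms(1))
  have b: "AE x in lborel. cmod (g x * X x) \<le> K * cmod (X x)"
    unfolding norm_mult by (intro AE_I2 mult_right_mono assms(3)) simp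
  show "mem_Lp 2 (\<lambda>x. g x * X x)" "Lp_norm 2 (\<lambda>x. g x * X x) \<le> K * Lp_norm 2 X"
    by (rule L2_dominated[OF assms(1) m K b])+
qed

lemma L2_deriv_mult:
  fixes g :: "real \<Rightarrow> complex"
  assumes X: "L2_deriv X X' t" and t: "t \<ge> 0"
    and m: "\<And>s. s \<ge> 0 \<Longrightarrow> mem_Lp 2 (X s)" "mem_Lp 2 X'" and g: "g \<in> borel_measurable borel" "\<And>x. cmod (g x) \<le> K"
  shows "L2_deriv (\<lambda>s x. g x * X s x) (\<lambda>x. g x * X' x) t"
proof (rule L2_deriv_lipschitz[OF X])
  show "0 \<le> K" using g(2) norm_ge_zero order_trans by blast
  fix s :: real assume s: "s \<ge> 0"
  have "g x * X s x - g x * X t x - (s - t) *\<^sub>R (g x * X' x) = g x * (X s x - X t x - (s - t) *\<^sub>R X' x)" for x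
    by (simp add: scaleR_conv_of_real algebra_simps)
  then show "Lp_norm 2 (\<lambda>x. g x * X s x - g x * X t x - (s - t) *\<^sub>R (g x * X' x)) \<le> K * L2_remainder X X' s t"
    using L2_bounded_mult(2)[OF L2_diff(1)[OF L2_diff(1)[OF m(1)[OF s] m(1)[OF t]] L2_scaleR(1)[OF m(2)]] g] by simp
qed

lemma L2_deriv_cong_AE:
  fixes X Y :: "real \<Rightarrow> real \<Rightarrow> complex"
  assumes X: "L2_deriv X X' t" and t: "t \<ge> 0"
    and m: "\<And>s. s \<ge> 0 \<Longrightarrow> mem_Lp 2 (X s)" "mem_Lp 2 X'" "\<And>s. s \<ge> 0 \<Longrightarrow> mem_Lp 2 (Y s)"
    and eq: "\<And>s. s \<ge> 0 \<Longrightarrow> AE x in lborel. Y s x = c x + X s x"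
  shows "L2_deriv Y X' t"
proof (rule L2_deriv_lipschitz[OF X, of 1])
  fix s :: real assume s: "s \<ge> 0"
  have "L2_remainder Y X' s t = L2_remainder X X' s t"
  proof (rule L2_norm_cong_AE)
    show "AE x in lborel. cmod (Y s x - Y t x - (s - t) *\<^sub>R X' x) = cmod (X s x - X t x - (s - t) *\<^sub>R X' x)"
      using eq[OF s] eq[OF t] by eventually_elim simp
  qed (intro L2_measurable L2_diff L2_scaleR m s t)+
  then show "L2_remainder Y X' s t \<le> 1 * L2_remainder X X' s t" by simp
qed simp

text \<open>The Fourier transform of the integrated Goldstein--Taylor equation: \<open>U\<close>, \<open>V\<close> are the
  transforms of the solution and \<open>Wu\<close>, \<open>Wv\<close> those of its time integrals. For fixed
  \<open>\<xi>\<close> nothing is known about the dependence on \<open>t\<close>, since the exceptional null sets may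
  depend on \<open>t\<close>; the equation can be differentiated only in norm, and only on bounded sets of
  frequencies.\<close>

locale telegraph_modes =
  fixes U V Wu Wv :: "real \<Rightarrow> real \<Rightarrow> complex" and U0 V0 :: "real \<Rightarrow> complex"
  assumes mem: "\<And>t. t \<ge> 0 \<Longrightarrow> mem_Lp 2 (U t)" "\<And>t. t \<ge> 0 \<Longrightarrow> mem_Lp 2 (V t)"
      "\<And>t. t \<ge> 0 \<Longrightarrow> mem_Lp 2 (Wu t)" "\<And>t. t \<ge> 0 \<Longrightarrow> mem_Lp 2 (Wv t)"
    and eqU: "\<And>t. t \<ge> 0 \<Longrightarrow> AE \<xi> in lborel. U t \<xi> = U0 \<xi> - \<i> * of_real \<xi> * Wv t \<xi>"
    and eqV: "\<And>t. t \<ge> 0 \<Longrightarrow> AE \<xi> in lborel. V t \<xi> = V0 \<xi> - \<i> * of_real \<xi> * Wu t \<xi> - Wv t \<xi>"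
    and derU: "\<And>t. t \<ge> 0 \<Longrightarrow> L2_deriv Wu (U t) t" and derV: "\<And>t. t \<ge> 0 \<Longrightarrow> L2_deriv Wv (V t) t"
begin

definition energy :: "real set \<Rightarrow> real \<Rightarrow> real" where
  "energy S t = (LINT \<xi>|lborel. indicator S \<xi> * energy_density \<xi> (U t \<xi>) (V t \<xi>))"

lemma energy_density_integrable:
  assumes "t \<ge> 0" "S \<in> sets borel"
  shows "integrable lborel (\<lambda>\<xi>. indicator S \<xi> * energy_density \<xi> (U t \<xi>) (V t \<xi>))"
proof -
  have "integrable lborel (\<lambda>\<xi>. cnj (U t \<xi>) * U t \<xi> + cnj (V t \<xi>) * V t \<xi> + cnj (U t \<xi>) * (polarizer \<xi> * V t \<xi>))"
    by (intro Bochner_Integration.integrable_add L2_mult_integrable L2_cnj L2_bounded_mult(1)[OF _ polarizer] mem assms)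
  from integrable_Re[OF this] have 1: "integrable lborel (\<lambda>\<xi>. energy_density \<xi> (U t \<xi>) (V t \<xi>))"
    unfolding energy_density_complex .
  show ?thesis using integrable_mult_indicator[OF _ 1, of S] assms(2) by simp
qed

text \<open>On \<open>S\<close> the factor \<open>\<xi>\<close> is bounded, so the equations express \<open>U\<close> and
  \<open>V\<close> on \<open>S\<close> by bounded operations applied to \<open>Wu\<close> and \<open>Wv\<close>. These
  are differentiable in norm, with derivatives \<open>U\<close> and \<open>V\<close>; so \<open>U\<close> and
  \<open>V\<close> are differentiable on \<open>S\<close> and satisfy the mode equation there. The product rule and
  the Lyapunov inequality give the bound.\<close>

lemma energy_has_derivative:
  assumes S: "S \<in> sets borel" "\<And>\<xi>. \<xi> \<in> S \<Longrightarrow> \<bar>\<xi>\<bar> \<le> N" "\<And>\<xi>. \<xi> \<in> S \<Longrightarrow> m \<le> mu_tilde \<xi>" and t: "t \<ge> 0"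
  obtains D where "(energy S has_real_derivative D) (at t within {0..})" "D \<le> - 2 * m * energy S t"
proof -
  define \<theta> where "\<theta> \<xi> = (indicator S \<xi> :: complex)" for \<xi>
  have \<theta>: "\<theta> \<in> borel_measurable borel" "\<And>\<xi>. cmod (\<theta> \<xi>) \<le> 1"
    unfolding \<theta>_def using S(1) by (auto simp: indicator_def)
  \<comment> \<open>Multiplication by \<open>-\<i>\<xi>\<close> becomes a bounded operation on \<open>S\<close>.\<close>
  define \<zeta> where "\<zeta> \<xi> = - \<i> * of_real \<xi> * \<theta> \<xi>" for \<xi>
  have \<zeta>m: "\<zeta> \<in> borel_measurable borel"
  proof -
    have "(\<lambda>\<xi>. - \<i> * complex_of_real \<xi>) \<in> borel_measurable borel"
      by (intro borel_measurable_continuous_onI continuous_intros)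
    from borel_measurable_times[OF this \<theta>(1)] show ?thesis unfolding \<zeta>_def .
  qed
  have \<zeta>b: "cmod (\<zeta> \<xi>) \<le> \<bar>N\<bar>" for \<xi>
    using S(2)[of \<xi>] unfolding \<zeta>_def \<theta>_def by (auto simp: norm_mult indicator_def)
  define X Y Z where "X s \<xi> = \<theta> \<xi> * U s \<xi>" and "Y s \<xi> = \<theta> \<xi> * V s \<xi>" and "Z s \<xi> = polarizer \<xi> * Y s \<xi>" for s \<xi>
  define X' Y' Z' where "X' \<xi> = \<zeta> \<xi> * V t \<xi>" and "Y' \<xi> = \<zeta> \<xi> * U t \<xi> + (- \<theta> \<xi>) * V t \<xi>"
    and "Z' \<xi> = polarizer \<xi> * Y' \<xi>" for \<xi>
  have m\<theta>: "(\<lambda>\<xi>. - \<theta> \<xi>) \<in> borel_measurable borel" "\<And>\<xi>. cmod (- \<theta> \<xi>) \<le> 1" using \<theta> by auto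
  have Xm: "mem_Lp 2 (X s)" and Ym: "mem_Lp 2 (Y s)" if "s \<ge> 0" for s
    unfolding X_def Y_def using that by (intro L2_bounded_mult(1)[OF _ \<theta>] mem; simp)+
  have Zm: "mem_Lp 2 (Z s)" if "s \<ge> 0" for s unfolding Z_def by (rule L2_bounded_mult(1)[OF Ym[OF that] polarizer])
  have X'm: "mem_Lp 2 X'" unfolding X'_def by (rule L2_bounded_mult(1)[OF mem(2)[OF t] \<zeta>m \<zeta>b])
  have Y'm: "mem_Lp 2 Y'" unfolding Y'_def
    by (rule L2_add(1)[OF L2_bounded_mult(1)[OF mem(1)[OF t] \<zeta>m \<zeta>b] L2_bounded_mult(1)[OF mem(2)[OF t] m\<theta>]])
  have Z'm: "mem_Lp 2 Z'" unfolding Z'_def by (rule L2_bounded_mult(1)[OF Y'm polarizer])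
  have dX: "L2_deriv X X' t"
  proof (rule L2_deriv_cong_AE[where c="\<lambda>\<xi>. \<theta> \<xi> * U0 \<xi>" and X="\<lambda>s \<xi>. \<zeta> \<xi> * Wv s \<xi>"])
    show "L2_deriv (\<lambda>s \<xi>. \<zeta> \<xi> * Wv s \<xi>) X' t"
      unfolding X'_def by (rule L2_deriv_mult[OF derV[OF t] t mem(4) mem(2)[OF t] \<zeta>m \<zeta>b])
    show "mem_Lp 2 (\<lambda>\<xi>. \<zeta> \<xi> * Wv s \<xi>)" if "s \<ge> 0" for s by (rule L2_bounded_mult(1)[OF mem(4)[OF that] \<zeta>m \<zeta>b])
    show "AE \<xi> in lborel. X s \<xi> = \<theta> \<xi> * U0 \<xi> + \<zeta> \<xi> * Wv s \<xi>" if "s \<ge> 0" for s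
      using eqU[OF that] by eventually_elim (simp only: X_def \<zeta>_def, simp add: algebra_simps)
  qed (use Xm X'm t in auto)
  have dY: "L2_deriv Y Y' t"
  proof (rule L2_deriv_cong_AE[where c="\<lambda>\<xi>. \<theta> \<xi> * V0 \<xi>" and X="\<lambda>s \<xi>. \<zeta> \<xi> * Wu s \<xi> + (- \<theta> \<xi>) * Wv s \<xi>"])
    have m1: "mem_Lp 2 (\<lambda>\<xi>. \<zeta> \<xi> * Wu s \<xi>)" "mem_Lp 2 (\<lambda>\<xi>. (- \<theta> \<xi>) * Wv s \<xi>)" if "s \<ge> 0" for s
      by (rule L2_bounded_mult(1)[OF mem(3)[OF that] \<zeta>m \<zeta>b], rule L2_bounded_mult(1)[OF mem(4)[OF that] m\<theta>])
    show "L2_deriv (\<lambda>s \<xi>. \<zeta> \<xi> * Wu s \<xi> + (- \<theta> \<xi>) * Wv s \<xi>) Y' t"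
      unfolding Y'_def
    proof (rule L2_deriv_add[OF _ _ t m1(1) _ m1(2)])
      show "L2_deriv (\<lambda>s \<xi>. \<zeta> \<xi> * Wu s \<xi>) (\<lambda>\<xi>. \<zeta> \<xi> * U t \<xi>) t"
        by (rule L2_deriv_mult[OF derU[OF t] t mem(3) mem(1)[OF t] \<zeta>m \<zeta>b])
      show "L2_deriv (\<lambda>s \<xi>. (- \<theta> \<xi>) * Wv s \<xi>) (\<lambda>\<xi>. (- \<theta> \<xi>) * V t \<xi>) t"
        by (rule L2_deriv_mult[OF derV[OF t] t mem(4) mem(2)[OF t] m\<theta>])
    qed (assumption | rule L2_bounded_mult(1)[OF mem(1)[OF t] \<zeta>m \<zeta>b] | rule L2_bounded_mult(1)[OF mem(2)[OF t] m\<theta>])+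
    show "mem_Lp 2 (\<lambda>\<xi>. \<zeta> \<xi> * Wu s \<xi> + (- \<theta> \<xi>) * Wv s \<xi>)" if "s \<ge> 0" for s by (rule L2_add(1)[OF m1[OF that]])
    show "AE \<xi> in lborel. Y s \<xi> = \<theta> \<xi> * V0 \<xi> + (\<zeta> \<xi> * Wu s \<xi> + (- \<theta> \<xi>) * Wv s \<xi>)" if "s \<ge> 0" for s
      using eqV[OF that] by eventually_elim (simp only: Y_def \<zeta>_def, simp add: algebra_simps)
  qed (use Ym Y'm t in auto)
  have dZ: "L2_deriv Z Z' t"
    unfolding Z_def Z'_def by (rule L2_deriv_mult[OF dY t Ym Y'm polarizer])
  define A B C where "A \<xi> = cnj (X' \<xi>) * X t \<xi> + cnj (X t \<xi>) * X' \<xi>"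
    and "B \<xi> = cnj (Y' \<xi>) * Y t \<xi> + cnj (Y t \<xi>) * Y' \<xi>" and "C \<xi> = cnj (X' \<xi>) * Z t \<xi> + cnj (X t \<xi>) * Z' \<xi>" for \<xi>
  have int: "integrable lborel A" "integrable lborel B" "integrable lborel C"
    unfolding A_def B_def C_def
    by (intro Bochner_Integration.integrable_add L2_mult_integrable L2_cnj Xm Ym Zm X'm Y'm Z'm t)+
  have E: "energy S s = Re ((LINT \<xi>|lborel. cnj (X s \<xi>) * X s \<xi>) + (LINT \<xi>|lborel. cnj (Y s \<xi>) * Y s \<xi>) + (LINT \<xi>|lborel. cnj (X s \<xi>) * Z s \<xi>))"
    if s: "s \<ge> 0" for s
  proof -
    have i: "integrable lborel (\<lambda>\<xi>. cnj (X s \<xi>) * X s \<xi>)" "integrable lborel (\<lambda>\<xi>. cnj (Y s \<xi>) * Y s \<xi>)"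
      "integrable lborel (\<lambda>\<xi>. cnj (X s \<xi>) * Z s \<xi>)"
      by (intro L2_mult_integrable L2_cnj Xm Ym Zm s)+
    have "Re ((LINT \<xi>|lborel. cnj (X s \<xi>) * X s \<xi>) + (LINT \<xi>|lborel. cnj (Y s \<xi>) * Y s \<xi>) + (LINT \<xi>|lborel. cnj (X s \<xi>) * Z s \<xi>))
       = Re (LINT \<xi>|lborel. cnj (X s \<xi>) * X s \<xi> + cnj (Y s \<xi>) * Y s \<xi> + cnj (X s \<xi>) * Z s \<xi>)"
      using i by (simp only: Bochner_Integration.integral_add Bochner_Integration.integrable_add)
    also have "\<dots> = (LINT \<xi>|lborel. Re (cnj (X s \<xi>) * X s \<xi> + cnj (Y s \<xi>) * Y s \<xi> + cnj (X s \<xi>) * Z s \<xi>))"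
      by (rule integral_Re[symmetric]) (intro Bochner_Integration.integrable_add i)
    also have "\<dots> = energy S s"
      unfolding energy_def Z_def energy_density_complex
      by (rule Bochner_Integration.integral_cong) (auto simp: X_def Y_def \<theta>_def indicator_def energy_density_def)
    finally show ?thesis ..
  qed
  define D where "D = Re ((LINT \<xi>|lborel. A \<xi>) + (LINT \<xi>|lborel. B \<xi>) + (LINT \<xi>|lborel. C \<xi>))"
  have "((\<lambda>s. Re ((LINT \<xi>|lborel. cnj (X s \<xi>) * X s \<xi>) + (LINT \<xi>|lborel. cnj (Y s \<xi>) * Y s \<xi>) + (LINT \<xi>|lborel. cnj (X s \<xi>) * Z s \<xi>)))
     has_vector_derivative D) (at t within {0..})"
    unfolding D_def A_def B_def C_def
    by (intro bounded_linear.has_vector_derivative[OF bounded_linear_Re] has_vector_derivative_add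
        L2_deriv_product dX dY dZ t Xm Ym Zm X'm Y'm Z'm)
  then have "(energy S has_vector_derivative D) (at t within {0..})"
    by (rule has_vector_derivative_transform[rotated 2]) (use t E in auto)
  then have 1: "(energy S has_real_derivative D) (at t within {0..})"
    by (simp add: has_real_derivative_iff_has_vector_derivative)
  have "D = Re (LINT \<xi>|lborel. A \<xi> + B \<xi> + C \<xi>)"
    unfolding D_def using int by (simp only: Bochner_Integration.integral_add Bochner_Integration.integrable_add)
  also have "\<dots> = (LINT \<xi>|lborel. Re (A \<xi> + B \<xi> + C \<xi>))"
    by (rule integral_Re[symmetric]) (intro Bochner_Integration.integrable_add int)
  also have "\<dots> \<le> (LINT \<xi>|lborel. - 2 * m * (indicator S \<xi> * energy_density \<xi> (U t \<xi>) (V t \<xi>)))"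
  proof (rule integral_mono)
    show "integrable lborel (\<lambda>\<xi>. Re (A \<xi> + B \<xi> + C \<xi>))"
      by (intro integrable_Re Bochner_Integration.integrable_add int)
    show "integrable lborel (\<lambda>\<xi>. - 2 * m * (indicator S \<xi> * energy_density \<xi> (U t \<xi>) (V t \<xi>)))"
      by (intro integrable_mult_right energy_density_integrable t S)
    fix \<xi>
    show "Re (A \<xi> + B \<xi> + C \<xi>) \<le> - 2 * m * (indicator S \<xi> * energy_density \<xi> (U t \<xi>) (V t \<xi>))"
    proof (cases "\<xi> \<in> S")
      case True
      have e: "X t \<xi> = U t \<xi>" "Y t \<xi> = V t \<xi>" using True by (simp_all add: X_def Y_def \<theta>_def)
      have "X' \<xi> = - \<i> * of_real \<xi> * V t \<xi>" "Y' \<xi> = - \<i> * of_real \<xi> * U t \<xi> - V t \<xi>"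
        using True by (simp_all add: X'_def Y'_def \<zeta>_def \<theta>_def)
      from energy_density_derivative[OF this]
      have "Re (A \<xi> + B \<xi> + C \<xi>) \<le> - 2 * mu_tilde \<xi> * energy_density \<xi> (U t \<xi>) (V t \<xi>)"
        unfolding A_def B_def C_def Z_def Z'_def e .
      also have "\<dots> \<le> - 2 * m * energy_density \<xi> (U t \<xi>) (V t \<xi>)"
        using S(3)[OF True] by (intro mult_right_mono energy_density_nonneg) simp
      finally show ?thesis using True by simp
    next
      case False
      then show ?thesis by (simp add: A_def B_def C_def X_def Y_def Z_def X'_def Y'_def Z'_def \<zeta>_def \<theta>_def)
    qed
  qed
  also have "\<dots> = - 2 * m * energy S t" unfolding energy_def by (rule integral_mult_right_zero)
  finally show ?thesis using that 1 by blast
qed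

lemma energy_decay:
  assumes S: "S \<in> sets borel" "\<And>\<xi>. \<xi> \<in> S \<Longrightarrow> \<bar>\<xi>\<bar> \<le> N" "\<And>\<xi>. \<xi> \<in> S \<Longrightarrow> m \<le> mu_tilde \<xi>" and t: "t \<ge> 0"
  shows "energy S t \<le> exp (- 2 * m * t) * energy S 0"
proof -
  \<comment> \<open>At \<open>0\<close> the derivative is one-sided, so monotonicity rests on the open interval and on continuity.\<close>
  define h where "h s = exp (2 * m * s) * energy S s" for s
  have "h t \<le> h 0"
  proof (rule DERIV_nonpos_imp_decreasing_open[OF t])
    fix s :: real assume s: "0 < s" "s < t"
    then obtain D where D: "(energy S has_real_derivative D) (at s within {0..})" "D \<le> - 2 * m * energy S s"
      using energy_has_derivative[OF S, of s] by force
    have "s \<in> interior {0..}" using s by simp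
    then have "(energy S has_real_derivative D) (at s)" using D(1) at_within_interior by metis
    then have "(h has_real_derivative exp (2 * m * s) * (2 * m) * energy S s + D * exp (2 * m * s)) (at s)"
      unfolding h_def by (auto intro!: derivative_eq_intros)
    moreover have "exp (2 * m * s) * (2 * m) * energy S s + D * exp (2 * m * s) \<le> 0"
    proof -
      have "exp (2 * m * s) * (2 * m * energy S s + D) \<le> 0"
        using D(2) by (intro mult_nonneg_nonpos) auto
      then show ?thesis by (simp add: algebra_simps)
    qed
    ultimately show "\<exists>y. (h has_real_derivative y) (at s) \<and> y \<le> 0" by blast
  next
    have "continuous_on {0..} (energy S)"
      unfolding continuous_on_eq_continuous_within
    proof
      fix s :: real assume "s \<in> {0..}"
      then obtain D where "(energy S has_real_derivative D) (at s within {0..})"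
        using energy_has_derivative[OF S, of s] by force
      then show "continuous (at s within {0..}) (energy S)" by (rule DERIV_continuous)
    qed
    then have "continuous_on {0..t} (energy S)" by (rule continuous_on_subset) auto
    then show "continuous_on {0..t} h" unfolding h_def by (intro continuous_intros)
  qed
  then have "exp (- 2 * m * t) * (exp (2 * m * t) * energy S t) \<le> exp (- 2 * m * t) * energy S 0"
    by (simp add: h_def)
  also have "exp (- 2 * m * t) * (exp (2 * m * t) * energy S t) = energy S t"
    unfolding mult.assoc[symmetric] exp_add[symmetric] by simp
  finally show ?thesis .
qed

lemma mu_tilde_measurable: "mu_tilde \<in> borel_measurable borel"
proof -
  have "sqrt (1 + 4 * \<xi>\<^sup>2 * (1 + 4 * \<xi>\<^sup>2)) \<noteq> 0" for \<xi> :: real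
  proof -
    have "0 < 1 + 4 * \<xi>\<^sup>2 * (1 + 4 * \<xi>\<^sup>2)" by (intro add_pos_nonneg) auto
    then show ?thesis by simp
  qed
  then show ?thesis unfolding mu_tilde_def[abs_def]
    by (intro borel_measurable_continuous_onI continuous_intros) auto
qed

text \<open>The energy decays in every bounded set \<open>S\<close> of frequencies at any rate that is admissible on all of
  \<open>S\<close>. Applied to the part of \<open>[-N, N]\<close> where \<open>\<mu> \<ge> q\<close> and the claim
  with rate \<open>q\<close> fails, this shows that the set is null; countably many such sets, for rational
  \<open>q\<close> and bounds \<open>N\<close>, cover the frequencies where the claim fails.\<close>

theorem energy_density_decay:
  assumes t: "t \<ge> 0"
  shows "AE \<xi> in lborel. energy_density \<xi> (U t \<xi>) (V t \<xi>) \<le> exp (- 2 * mu_tilde \<xi> * t) * energy_density \<xi> (U 0 \<xi>) (V 0 \<xi>)"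
proof -
  define e where "e s \<xi> = energy_density \<xi> (U s \<xi>) (V s \<xi>)" for s \<xi>
  have em: "e s \<in> borel_measurable borel" if "s \<ge> 0" for s
    using borel_measurable_integrable[OF energy_density_integrable[OF that, of UNIV]] unfolding e_def[abs_def] by simp
  have "AE \<xi> in lborel. \<forall>q::rat. \<forall>N::nat. \<not> (\<bar>\<xi>\<bar> \<le> real N \<and> of_rat q \<le> mu_tilde \<xi> \<and> exp (- 2 * of_rat q * t) * e 0 \<xi> < e t \<xi>)"
    unfolding AE_all_countable
  proof (intro allI)
    fix q :: rat and N :: nat
    define m :: real where "m = of_rat q"
    define S where "S = {\<xi>. \<bar>\<xi>\<bar> \<le> real N \<and> m \<le> mu_tilde \<xi> \<and> exp (- 2 * m * t) * e 0 \<xi> < e t \<xi>}"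
    note [measurable] = mu_tilde_measurable em[OF t] em[OF order_refl]
    have S: "S \<in> sets borel" unfolding S_def by measurable
    have dec: "energy S t \<le> exp (- 2 * m * t) * energy S 0"
      by (rule energy_decay[OF S _ _ t, of "real N"]) (auto simp: S_def)
    define g where "g \<xi> = indicator S \<xi> * e t \<xi> - exp (- 2 * m * t) * (indicator S \<xi> * e 0 \<xi>)" for \<xi>
    note i = energy_density_integrable[OF t S] energy_density_integrable[OF order_refl S]
    have gi: "integrable lborel g" unfolding g_def e_def by (intro Bochner_Integration.integrable_diff integrable_mult_right i)
    have g0: "0 \<le> g \<xi>" for \<xi> by (auto simp: g_def S_def indicator_def)
    have "(LINT \<xi>|lborel. g \<xi>) = energy S t - exp (- 2 * m * t) * energy S 0"
      unfolding g_def e_def energy_def using i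
      by (simp only: Bochner_Integration.integral_diff integrable_mult_right integral_mult_right_zero)
    then have "(LINT \<xi>|lborel. g \<xi>) = 0" using dec Bochner_Integration.integral_nonneg[of lborel g] g0 by (simp add: antisym)
    then have "AE \<xi> in lborel. g \<xi> = 0" using integral_nonneg_eq_0_iff_AE[OF gi] g0 by simp
    then show "AE \<xi> in lborel. \<not> (\<bar>\<xi>\<bar> \<le> real N \<and> of_rat q \<le> mu_tilde \<xi> \<and> exp (- 2 * of_rat q * t) * e 0 \<xi> < e t \<xi>)"
    proof eventually_elim
      case (elim \<xi>)
      then show ?case unfolding m_def[symmetric] by (auto simp: g_def S_def indicator_def split: if_splits)
    qed
  qed
  then show ?thesis
  proof eventually_elim
    case (elim \<xi>)
    show ?case
    proof (rule ccontr)
      assume "\<not> ?thesis"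
      then have gt: "exp (- 2 * mu_tilde \<xi> * t) * e 0 \<xi> < e t \<xi>" by (simp add: e_def)
      have "((\<lambda>m. exp (- 2 * m * t) * e 0 \<xi>) \<longlongrightarrow> exp (- 2 * mu_tilde \<xi> * t) * e 0 \<xi>) (at_left (mu_tilde \<xi>))"
        by (intro tendsto_intros)
      from order_tendstoD(2)[OF this gt] obtain b where b: "b < mu_tilde \<xi>"
        "\<And>m. b < m \<Longrightarrow> m < mu_tilde \<xi> \<Longrightarrow> exp (- 2 * m * t) * e 0 \<xi> < e t \<xi>"
        unfolding eventually_at_left_field by auto
      obtain q where q: "b < of_rat q" "of_rat q < mu_tilde \<xi>" using of_rat_dense[OF b(1)] by blast
      obtain N :: nat where "\<bar>\<xi>\<bar> \<le> real N" using real_arch_simple by blast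
      then show False using elim b(2)[OF q] q(2) less_imp_le by blast
    qed
  qed
qed

end

section \<open>Mild solutions on the Fourier side\<close>

lemma L2_components:
  fixes w :: "real \<Rightarrow> real \<times> real"
  assumes "mem_Lp 2 w"
  shows "mem_Lp 2 (\<lambda>x. fst (w x))" "Lp_norm 2 (\<lambda>x. fst (w x)) \<le> Lp_norm 2 w"
    and "mem_Lp 2 (\<lambda>x. snd (w x))" "Lp_norm 2 (\<lambda>x. snd (w x)) \<le> Lp_norm 2 w"
    and "(Lp_norm 2 w)\<^sup>2 = (Lp_norm 2 (\<lambda>x. fst (w x)))\<^sup>2 + (Lp_norm 2 (\<lambda>x. snd (w x)))\<^sup>2"
proof -
  have m: "(\<lambda>x. fst (w x)) \<in> borel_measurable borel" "(\<lambda>x. snd (w x)) \<in> borel_measurable borel"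
    using L2_measurable[OF assms]
    by (auto intro: borel_measurable_continuous_on[OF continuous_on_fst[OF continuous_on_id]]
        borel_measurable_continuous_on[OF continuous_on_snd[OF continuous_on_id]])
  have b: "norm (fst p) \<le> 1 * norm p" "norm (snd p) \<le> 1 * norm p" for p :: "real \<times> real"
    using norm_fst_le[of "fst p" "snd p"] norm_snd_le[of "snd p" "fst p"] by simp_all
  show 1: "mem_Lp 2 (\<lambda>x. fst (w x))" and 2: "mem_Lp 2 (\<lambda>x. snd (w x))"
    by (rule L2_dominated(1)[OF assms m(1), of 1], simp, intro AE_I2 b)
       (rule L2_dominated(1)[OF assms m(2), of 1], simp, intro AE_I2 b)
  have "Lp_norm 2 (\<lambda>x. fst (w x)) \<le> 1 * Lp_norm 2 w"
    by (rule L2_dominated(2)[OF assms m(1)], simp, intro AE_I2 b)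
  then show "Lp_norm 2 (\<lambda>x. fst (w x)) \<le> Lp_norm 2 w" by simp
  have "Lp_norm 2 (\<lambda>x. snd (w x)) \<le> 1 * Lp_norm 2 w"
    by (rule L2_dominated(2)[OF assms m(2)], simp, intro AE_I2 b)
  then show "Lp_norm 2 (\<lambda>x. snd (w x)) \<le> Lp_norm 2 w" by simp
  have "(norm p)\<^sup>2 = (norm (fst p))\<^sup>2 + (norm (snd p))\<^sup>2" for p :: "real \<times> real"
    by (cases p) (simp add: norm_Pair)
  then show "(Lp_norm 2 w)\<^sup>2 = (Lp_norm 2 (\<lambda>x. fst (w x)))\<^sup>2 + (Lp_norm 2 (\<lambda>x. snd (w x)))\<^sup>2"
    unfolding L2_norm_sq using L2_integrable_sq[OF 1] L2_integrable_sq[OF 2] by simp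
qed

lemma L2_deriv_fourier:
  fixes X :: "real \<Rightarrow> real \<Rightarrow> complex"
  assumes X: "L2_deriv X X' t" and t: "t \<ge> 0"
    and m: "\<And>s. s \<ge> 0 \<Longrightarrow> mem_Lp 2 (X s)" "mem_Lp 2 X'"
  shows "L2_deriv (\<lambda>s. fourier (X s)) (fourier X') t"
proof (rule L2_deriv_lipschitz[OF X, of 1])
  fix s :: real assume s: "s \<ge> 0"
  have m1: "mem_Lp 2 (\<lambda>x. X s x - X t x)" by (intro L2_diff m s t)
  have m2: "mem_Lp 2 (\<lambda>x. of_real (s - t) * X' x)" by (rule L2_cmult(1)[OF m(2)])
  have "Lp_norm 2 (\<lambda>\<xi>. fourier (X s) \<xi> - fourier (X t) \<xi> - (s - t) *\<^sub>R fourier X' \<xi>)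
    = Lp_norm 2 (fourier (\<lambda>x. X s x - X t x - of_real (s - t) * X' x))"
  proof (rule L2_norm_cong_AE)
    show "AE \<xi> in lborel. cmod (fourier (X s) \<xi> - fourier (X t) \<xi> - (s - t) *\<^sub>R fourier X' \<xi>)
        = cmod (fourier (\<lambda>x. X s x - X t x - of_real (s - t) * X' x) \<xi>)"
      using fourier_diff[OF m1 m2] fourier_diff[OF m(1)[OF s] m(1)[OF t]] fourier_cmult[OF m(2), of "of_real (s - t)"]
      by eventually_elim (simp only: scaleR_conv_of_real)
  qed (intro L2_measurable L2_diff L2_scaleR L2_cmult fourier m s t)+
  also have "\<dots> = Lp_norm 2 (\<lambda>x. X s x - X t x - of_real (s - t) * X' x)"
    by (rule Plancherel[OF L2_diff(1)[OF m1 m2]])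
  finally show "Lp_norm 2 (\<lambda>\<xi>. fourier (X s) \<xi> - fourier (X t) \<xi> - (s - t) *\<^sub>R fourier X' \<xi>)
    \<le> 1 * L2_remainder X X' s t"
    by (simp only: scaleR_conv_of_real mult_1)
qed simp

definition fourier_re :: "(real \<Rightarrow> real) \<Rightarrow> real \<Rightarrow> complex" where
  "fourier_re f = fourier (\<lambda>x. of_real (f x))"

lemma fourier_re_L2: "mem_Lp 2 f \<Longrightarrow> mem_Lp 2 (fourier_re f)"
  unfolding fourier_re_def by (intro fourier L2_of_real)

lemma fourier_re_norm: "mem_Lp 2 f \<Longrightarrow> Lp_norm 2 (fourier_re f) = Lp_norm 2 f"
  unfolding fourier_re_def by (simp only: Plancherel L2_of_real)

lemma fourier_re_diff_AE:
  assumes "mem_Lp 2 h" "mem_Lp 2 f" "mem_Lp 2 g" "AE x in lborel. h x = f x - g x"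
  shows "AE \<xi> in lborel. fourier_re h \<xi> = fourier_re f \<xi> - fourier_re g \<xi>"
proof -
  have "AE x in lborel. complex_of_real (h x) = of_real (f x) - of_real (g x)"
    using assms(4) by eventually_elim simp
  from fourier_cong_AE[OF L2_of_real(1)[OF assms(1)] L2_diff(1)[OF L2_of_real(1)[OF assms(2)] L2_of_real(1)[OF assms(3)]] this]
    fourier_diff[OF L2_of_real(1)[OF assms(2)] L2_of_real(1)[OF assms(3)]]
  show ?thesis unfolding fourier_re_def by eventually_elim simp
qed

lemma L2_deriv_fourier_re:
  fixes X :: "real \<Rightarrow> real \<Rightarrow> real"
  assumes X: "L2_deriv X X' t" and t: "t \<ge> 0"
    and m: "\<And>s. s \<ge> 0 \<Longrightarrow> mem_Lp 2 (X s)" "mem_Lp 2 X'"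
  shows "L2_deriv (\<lambda>s. fourier_re (X s)) (fourier_re X') t"
  unfolding fourier_re_def
proof (rule L2_deriv_fourier[OF _ t L2_of_real(1)[OF m(1)] L2_of_real(1)[OF m(2)]])
  show "L2_deriv (\<lambda>s x. complex_of_real (X s x)) (\<lambda>x. complex_of_real (X' x)) t"
  proof (rule L2_deriv_lipschitz[OF X, of 1])
    fix s
    have "complex_of_real (X s x) - of_real (X t x) - (s - t) *\<^sub>R of_real (X' x) = of_real (X s x - X t x - (s - t) *\<^sub>R X' x)" for x
      by (simp add: scaleR_conv_of_real)
    then show "Lp_norm 2 (\<lambda>x. complex_of_real (X s x) - of_real (X t x) - (s - t) *\<^sub>R of_real (X' x)) \<le> 1 * L2_remainder X X' s t"
      by (simp only: Lp_norm_def norm_of_real real_norm_def mult_1)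
  qed simp
qed

text \<open>Derivatives in \<open>x\<close> become multiplication by \<open>\<i>\<xi>\<close>. The transforms of the time
  integrals are differentiable with the transforms of the solution as derivatives, because the transform is linear and
  isometric. The integral over \<open>[0, 0]\<close> vanishes, which gives the initial values.\<close>

theorem GT_mild_solution_modes:
  assumes sol: "GT_mild_solution (\<lambda>t x. (u t x, v t x)) (\<lambda>x. (u0 x, v0 x))"
    and u0: "mem_Lp 2 u0" and v0: "mem_Lp 2 v0"
  obtains Wu Wv where "telegraph_modes (\<lambda>t. fourier_re (u t)) (\<lambda>t. fourier_re (v t)) Wu Wv (fourier_re u0) (fourier_re v0)"
    and "\<And>t. t \<ge> 0 \<Longrightarrow> mem_Lp 2 (u t)" "\<And>t. t \<ge> 0 \<Longrightarrow> mem_Lp 2 (v t)"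
    and "AE \<xi> in lborel. fourier_re (u 0) \<xi> = fourier_re u0 \<xi>" "AE \<xi> in lborel. fourier_re (v 0) \<xi> = fourier_re v0 \<xi>"
proof -
  define y where "y = (\<lambda>t x. (u t x, v t x))"
  have cont: "continuous_L2 y" using sol unfolding GT_mild_solution_def y_def by blast
  have ym: "mem_Lp 2 (y t)" if "t \<ge> 0" for t using cont that unfolding continuous_L2_def by blast
  have um: "mem_Lp 2 (u t)" and vm: "mem_Lp 2 (v t)" if "t \<ge> 0" for t
    using L2_components(1,3)[OF ym[OF that]] by (simp_all add: y_def)
  have "\<forall>t\<in>{0..}. \<exists>w. has_L2_integral y w 0 t \<and> (\<exists>z. GT_generator w z \<and> (AE x in lborel. y t x = (u0 x, v0 x) + z x))"
    using sol unfolding GT_mild_solution_def y_def by fastforce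
  from bchoice[OF this] obtain w where w: "\<And>t. t \<ge> 0 \<Longrightarrow> has_L2_integral y (w t) 0 t"
    "\<And>t. t \<ge> 0 \<Longrightarrow> \<exists>z. GT_generator (w t) z \<and> (AE x in lborel. y t x = (u0 x, v0 x) + z x)"
    by (auto simp: Ball_def)
  have wm: "mem_Lp 2 (w t)" if "t \<ge> 0" for t using w(1)[OF that] unfolding has_L2_integral_def by blast
  note c1 = L2_components(1)[OF wm] and c2 = L2_components(3)[OF wm]
  define Wu Wv where "Wu t = fourier_re (\<lambda>x. fst (w t x))" and "Wv t = fourier_re (\<lambda>x. snd (w t x))" for t
  have der: "L2_deriv (\<lambda>s x. fst (w s x)) (u t) t \<and> L2_deriv (\<lambda>s x. snd (w s x)) (v t) t" if t: "t \<ge> 0" for t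
  proof -
    have d: "L2_deriv w (y t) t" by (rule L2_integral_deriv[OF cont w(1) t])
    have m: "mem_Lp 2 (\<lambda>x. w s x - w t x - (s - t) *\<^sub>R y t x)" if "s \<ge> 0" for s
      by (intro L2_diff L2_scaleR wm ym t that)
    show ?thesis
    proof
      show "L2_deriv (\<lambda>s x. fst (w s x)) (u t) t"
        by (rule L2_deriv_lipschitz[OF d, of 1]) (use L2_components(2)[OF m] in \<open>simp_all add: y_def\<close>)
      show "L2_deriv (\<lambda>s x. snd (w s x)) (v t) t"
        by (rule L2_deriv_lipschitz[OF d, of 1]) (use L2_components(4)[OF m] in \<open>simp_all add: y_def\<close>)
    qed
  qed
  have eqs: "(AE \<xi> in lborel. fourier_re (u t) \<xi> = fourier_re u0 \<xi> - \<i> * of_real \<xi> * Wv t \<xi>) \<and>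
      (AE \<xi> in lborel. fourier_re (v t) \<xi> = fourier_re v0 \<xi> - \<i> * of_real \<xi> * Wu t \<xi> - Wv t \<xi>)" if t: "t \<ge> 0" for t
  proof -
    obtain z where "GT_generator (w t) z" and yz: "AE x in lborel. y t x = (u0 x, v0 x) + z x"
      using w(2)[OF t] by blast
    then obtain du dv where du: "mem_Lp 2 du" "weak_deriv (\<lambda>x. fst (w t x)) du"
      and dv: "mem_Lp 2 dv" "weak_deriv (\<lambda>x. snd (w t x)) dv"
      and z: "AE x in lborel. z x = (- dv x, - du x - snd (w t x))"
      unfolding GT_generator_def by blast
    have ut: "AE x in lborel. u t x = u0 x - dv x" using yz z by eventually_elim (simp add: y_def)
    have vt: "AE x in lborel. v t x = (v0 x - du x) - snd (w t x)" using yz z by eventually_elim (simp add: y_def)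
    have FD: "AE \<xi> in lborel. fourier_re du \<xi> = \<i> * of_real \<xi> * Wu t \<xi>"
      "AE \<xi> in lborel. fourier_re dv \<xi> = \<i> * of_real \<xi> * Wv t \<xi>"
      unfolding Wu_def Wv_def fourier_re_def
      by (rule fourier_weak_deriv[OF c1[OF t] du], rule fourier_weak_deriv[OF c2[OF t] dv])
    have m: "mem_Lp 2 (\<lambda>x. v0 x - du x)" by (intro L2_diff v0 du)
    have "AE x in lborel. v0 x - du x = v0 x - du x" by simp
    note F1 = fourier_re_diff_AE[OF um[OF t] u0 dv(1) ut]
      and F2 = fourier_re_diff_AE[OF vm[OF t] m c2[OF t] vt]
      and F3 = fourier_re_diff_AE[OF m v0 du(1) this]
    have "AE \<xi> in lborel. fourier_re (u t) \<xi> = fourier_re u0 \<xi> - \<i> * of_real \<xi> * Wv t \<xi>"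
      using F1 FD(2) by eventually_elim simp
    moreover have "AE \<xi> in lborel. fourier_re (v t) \<xi> = fourier_re v0 \<xi> - \<i> * of_real \<xi> * Wu t \<xi> - Wv t \<xi>"
      using F2 F3 FD(1) by eventually_elim (simp add: Wv_def)
    ultimately show ?thesis ..
  qed
  have modes: "telegraph_modes (\<lambda>t. fourier_re (u t)) (\<lambda>t. fourier_re (v t)) Wu Wv (fourier_re u0) (fourier_re v0)"
  proof
    fix t :: real assume t: "t \<ge> 0"
    show "mem_Lp 2 (fourier_re (u t))" "mem_Lp 2 (fourier_re (v t))" "mem_Lp 2 (Wu t)" "mem_Lp 2 (Wv t)"
      unfolding Wu_def Wv_def by (intro fourier_re_L2 um vm c1 c2 t)+
    show "AE \<xi> in lborel. fourier_re (u t) \<xi> = fourier_re u0 \<xi> - \<i> * of_real \<xi> * Wv t \<xi>"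
      "AE \<xi> in lborel. fourier_re (v t) \<xi> = fourier_re v0 \<xi> - \<i> * of_real \<xi> * Wu t \<xi> - Wv t \<xi>"
      using eqs[OF t] by auto
    show "L2_deriv Wu (fourier_re (u t)) t" "L2_deriv Wv (fourier_re (v t)) t"
      unfolding Wu_def[abs_def] Wv_def[abs_def]
      by (rule L2_deriv_fourier_re[OF conjunct1[OF der[OF t]] t c1 um[OF t]], assumption,
          rule L2_deriv_fourier_re[OF conjunct2[OF der[OF t]] t c2 vm[OF t]], assumption)
  qed
  have "Lp_norm 2 (w 0) = 0" using has_L2_integral_degenerate[OF w(1)[OF order_refl]] .
  then have "Lp_norm 2 (Wu 0) = 0" "Lp_norm 2 (Wv 0) = 0"
    using L2_components(2,4)[OF wm[OF order_refl]] Lp_norm_nonneg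
    unfolding Wu_def Wv_def fourier_re_norm[OF c1[OF order_refl]] fourier_re_norm[OF c2[OF order_refl]]
    by (auto intro: antisym)
  then have W0: "AE \<xi> in lborel. Wu 0 \<xi> = 0" "AE \<xi> in lborel. Wv 0 \<xi> = 0"
    unfolding Wu_def Wv_def
    by (auto intro!: L2_norm_zero_AE fourier_re_L2 c1 c2)
  have "AE \<xi> in lborel. fourier_re (u 0) \<xi> = fourier_re u0 \<xi>" "AE \<xi> in lborel. fourier_re (v 0) \<xi> = fourier_re v0 \<xi>"
    using conjunct1[OF eqs[OF order_refl]] conjunct2[OF eqs[OF order_refl]] W0
    by (eventually_elim, simp)+
  then show ?thesis using that modes um vm by blast
qed

section \<open>Low and high frequencies\<close>

text \<open>The Euclidean norm of the vector-valued Fourier integral is at most the integral of the Euclidean norm.\<close>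

lemma fourier_pair_bound:
  assumes u: "mem_Lp 1 u" "mem_Lp 2 u" and v: "mem_Lp 1 v" "mem_Lp 2 v"
  shows "AE \<xi> in lborel. (cmod (fourier_re u \<xi>))\<^sup>2 + (cmod (fourier_re v \<xi>))\<^sup>2 \<le> (Lp_norm 1 (\<lambda>x. (u x, v x)))\<^sup>2 / (2 * pi)"
proof -
  define N where "N = Lp_norm 1 (\<lambda>x. (u x, v x))"
  have N: "N = (LINT x|lborel. norm (u x, v x))" unfolding N_def Lp_norm_def by simp
  have i: "integrable lborel (\<lambda>x. complex_of_real (u x))" "integrable lborel (\<lambda>x. complex_of_real (v x))"
    using u(1) v(1) by (auto simp: mem_Lp_1_iff)
  have um: "u \<in> borel_measurable borel" "v \<in> borel_measurable borel" using u v L2_measurable by auto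
  have ni: "integrable lborel (\<lambda>x. norm (u x, v x))"
  proof (rule Bochner_Integration.integrable_bound)
    show "integrable lborel (\<lambda>x. \<bar>u x\<bar> + \<bar>v x\<bar>)" using u(1) v(1) by (auto simp: mem_Lp_1_iff)
    show "(\<lambda>x. norm (u x, v x)) \<in> borel_measurable lborel" using um by simp
    show "AE x in lborel. norm (norm (u x, v x)) \<le> norm (\<bar>u x\<bar> + \<bar>v x\<bar>)"
      by (intro AE_I2) (simp add: norm_Pair sqrt_sum_squares_le_sum_abs)
  qed
  have bound: "(cmod (fourier_int (\<lambda>x. of_real (u x)) \<xi>))\<^sup>2 + (cmod (fourier_int (\<lambda>x. of_real (v x)) \<xi>))\<^sup>2 \<le> N\<^sup>2 / (2 * pi)" for \<xi>
  proof -
    define a b where "a x = exp (- \<i> * of_real (x * \<xi>)) * complex_of_real (u x)"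
      and "b x = exp (- \<i> * of_real (x * \<xi>)) * complex_of_real (v x)" for x
    have ab: "integrable lborel a" "integrable lborel b" unfolding a_def b_def by (intro fourier_integrable i)+
    have nab: "norm (a x, b x) = norm (u x, v x)" for x
      unfolding norm_Pair a_def b_def norm_mult norm_fourier_kernel by simp
    have pi2: "integrable lborel (\<lambda>x. (a x, b x))"
    proof (rule Bochner_Integration.integrable_bound[OF ni])
      show "(\<lambda>x. (a x, b x)) \<in> borel_measurable lborel" using ab by (intro borel_measurable_Pair) auto
    qed (simp add: nab)
    define p where "p = (LINT x|lborel. (a x, b x))"
    have p: "fst p = (LINT x|lborel. a x)" "snd p = (LINT x|lborel. b x)"
      unfolding p_def using integral_fst[OF pi2] integral_snd[OF pi2] by simp_all
    have "norm p \<le> (LINT x|lborel. norm (a x, b x))" unfolding p_def by (rule integral_norm_bound)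
    then have "norm p \<le> N" unfolding nab N .
    then have "(norm p)\<^sup>2 \<le> N\<^sup>2" by (intro power_mono) auto
    moreover have "(norm p)\<^sup>2 = (cmod (fst p))\<^sup>2 + (cmod (snd p))\<^sup>2" by (cases p) (simp add: norm_Pair)
    ultimately have "((cmod (fst p))\<^sup>2 + (cmod (snd p))\<^sup>2) / (2 * pi) \<le> N\<^sup>2 / (2 * pi)" by (simp add: divide_right_mono)
    moreover have "cmod (fourier_int (\<lambda>x. of_real (u x)) \<xi>) = cmod (fst p) / sqrt (2 * pi)"
      "cmod (fourier_int (\<lambda>x. of_real (v x)) \<xi>) = cmod (snd p) / sqrt (2 * pi)"
      unfolding fourier_int_def p a_def b_def norm_divide norm_of_real by simp_all
    ultimately show ?thesis by (simp only: power_divide add_divide_distrib) simp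
  qed
  show ?thesis
    using fourier_eq_fourier_int[OF i(1) L2_of_real(1)[OF u(2)]] fourier_eq_fourier_int[OF i(2) L2_of_real(1)[OF v(2)]]
    unfolding fourier_re_def N_def[symmetric] by eventually_elim (simp only: bound)
qed

lemma mu_tilde_mono:
  assumes "0 \<le> R" "R \<le> \<bar>\<xi>\<bar>" shows "mu_tilde R \<le> mu_tilde \<xi>"
proof -
  have sq: "R\<^sup>2 \<le> \<xi>\<^sup>2" using power_mono[OF assms(2,1), of 2] by simp
  define s where "s x = 1 + 4 * x\<^sup>2 * (1 + 4 * x\<^sup>2)" for x :: real
  have "s R \<le> s \<xi>" unfolding s_def using sq by (intro add_left_mono mult_mono) auto
  moreover have "1 \<le> s R" unfolding s_def by simp
  ultimately have "1 / sqrt (s \<xi>) \<le> 1 / sqrt (s R)" by (intro divide_left_mono) auto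
  then show ?thesis unfolding mu_tilde_def s_def[symmetric] by simp
qed

text \<open>With \<open>x = \<xi>\<^sup>2\<close> the claim is \<open>s (1 - 2 x)\<^sup>2 \<ge> 1\<close> for \<open>s = 1 + 4 x
  (1 + 4 x)\<close>, and \<open>s (1 - 2 x)\<^sup>2 - 1 = 4 x\<^sup>2 (1 - 12 x + 16 x\<^sup>2)\<close>. The smaller
  root of the quadratic factor is \<open>(3 - sqrt 5) / 8 = ((sqrt 5 - 1) / 4)\<^sup>2\<close>; this is where the
  range of \<open>R\<close> in the decay estimate comes from.\<close>

lemma mu_tilde_ge_square:
  assumes "\<bar>\<xi>\<bar> \<le> (sqrt 5 - 1) / 4" shows "\<xi>\<^sup>2 \<le> mu_tilde \<xi>"
proof -
  define x where "x = \<xi>\<^sup>2"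
  define s where "s = 1 + 4 * x * (1 + 4 * x)"
  have x0: "0 \<le> x" by (simp add: x_def)
  have s5: "sqrt 5 * sqrt 5 = 5" by simp
  have "x \<le> ((sqrt 5 - 1) / 4)\<^sup>2" unfolding x_def using power_mono[OF assms abs_ge_zero, of 2] by simp
  also have "\<dots> = (3 - sqrt 5) / 8" by (simp add: power2_eq_square field_simps)
  finally have x1: "x \<le> (3 - sqrt 5) / 8" .
  have "2 \<le> sqrt 5" by (rule real_le_rsqrt) simp
  then have x2: "x \<le> (3 + sqrt 5) / 8" "0 < 1 - 2 * x" using x1 by auto
  have "0 \<le> 16 * (((3 - sqrt 5) / 8 - x) * ((3 + sqrt 5) / 8 - x))"
    using x1 x2(1) by (intro mult_nonneg_nonneg) auto
  also have "\<dots> = 1 - 12 * x + 16 * x\<^sup>2" by (simp add: power2_eq_square field_simps)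
  finally have "0 \<le> 4 * x\<^sup>2 * (1 - 12 * x + 16 * x\<^sup>2)" by (intro mult_nonneg_nonneg) auto
  also have "\<dots> = s * (1 - 2 * x)\<^sup>2 - 1" unfolding s_def by (simp add: power2_eq_square algebra_simps)
  finally have "1 \<le> s * (1 - 2 * x)\<^sup>2" by simp
  then have "sqrt 1 \<le> sqrt (s * (1 - 2 * x)\<^sup>2)" by (rule real_sqrt_le_mono)
  then have "1 \<le> sqrt s * (1 - 2 * x)" using x2(2) by (simp add: real_sqrt_mult)
  moreover have "0 < sqrt s" unfolding s_def using x0 by (simp add: add_pos_nonneg)
  ultimately have "1 / sqrt s \<le> 1 - 2 * x" by (simp add: divide_le_eq mult.commute)
  then show ?thesis unfolding mu_tilde_def x_def[symmetric] s_def[symmetric] by simp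
qed

lemma coupling_mono:
  assumes "\<bar>\<xi>\<bar> \<le> R" "R \<le> 1 / 2" shows "\<bar>coupling \<xi>\<bar> \<le> coupling R"
proof -
  have R: "0 \<le> R" using assms(1) by simp
  have "(2 * R) * (2 * \<bar>\<xi>\<bar>) \<le> 1 * 1" using assms R by (intro mult_mono) auto
  then have "0 \<le> (R - \<bar>\<xi>\<bar>) * (1 - 4 * R * \<bar>\<xi>\<bar>)" using assms(1) by (intro mult_nonneg_nonneg) auto
  also have "\<dots> = R * (1 + 4 * \<xi>\<^sup>2) - \<bar>\<xi>\<bar> * (1 + 4 * R\<^sup>2)"
    by (simp add: algebra_simps power2_eq_square)
  finally have "\<bar>\<xi>\<bar> * (1 + 4 * R\<^sup>2) \<le> R * (1 + 4 * \<xi>\<^sup>2)" by simp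
  then have "\<bar>\<xi>\<bar> / (1 + 4 * \<xi>\<^sup>2) \<le> R / (1 + 4 * R\<^sup>2)"
    using one_plus_sq_pos[of \<xi>] one_plus_sq_pos[of R] by (simp add: divide_le_eq le_divide_eq mult.commute pos_divide_le_eq)
  moreover have "\<bar>coupling \<xi>\<bar> = 2 * (\<bar>\<xi>\<bar> / (1 + 4 * \<xi>\<^sup>2))"
    using one_plus_sq_pos[of \<xi>] by (simp add: coupling_def abs_mult)
  ultimately show ?thesis by (simp add: coupling_def)
qed

lemma gaussian_interval_integral:
  assumes R: "R > 0" and t: "t \<ge> 0"
  shows "integrable lborel (\<lambda>\<xi>. indicator {- R..R} \<xi> * exp (- 2 * \<xi>\<^sup>2 * t))"
    and "(LINT \<xi>|lborel. indicator {- R..R} \<xi> * exp (- 2 * \<xi>\<^sup>2 * t)) \<le> (if t = 0 then 2 * R else min (2 * R) (sqrt (pi / (2 * t))))"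
    and "0 \<le> (LINT \<xi>|lborel. indicator {- R..R} \<xi> * exp (- 2 * \<xi>\<^sup>2 * t))"
proof -
  define g where "g \<xi> = indicator {- R..R} \<xi> * exp (- 2 * \<xi>\<^sup>2 * t)" for \<xi>
  have ii: "integrable lborel (indicator {- R..R} :: real \<Rightarrow> real)"
    by (intro integrable_real_indicator) (auto simp: emeasure_lborel_Icc_eq)
  have e1: "exp (- 2 * \<xi>\<^sup>2 * t) \<le> 1" for \<xi> using t by simp
  have g0: "0 \<le> g \<xi>" "g \<xi> \<le> indicator {- R..R} \<xi>" "g \<xi> \<le> exp (- 2 * \<xi>\<^sup>2 * t)" for \<xi>
    using e1[of \<xi>] by (auto simp: g_def indicator_def)
  have gi: "integrable lborel g"
    by (rule Bochner_Integration.integrable_bound[OF ii]) (use g0 in \<open>auto simp: g_def[abs_def]\<close>)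
  then show "integrable lborel (\<lambda>\<xi>. indicator {- R..R} \<xi> * exp (- 2 * \<xi>\<^sup>2 * t))" by (simp add: g_def[abs_def])
  show "0 \<le> (LINT \<xi>|lborel. indicator {- R..R} \<xi> * exp (- 2 * \<xi>\<^sup>2 * t))"
    unfolding g_def[symmetric] by (rule Bochner_Integration.integral_nonneg) (rule g0)
  have "(LINT \<xi>|lborel. g \<xi>) \<le> (LINT \<xi>|lborel. (indicator {- R..R} \<xi> :: real))"
    by (rule integral_mono[OF gi ii g0(2)])
  then have le1: "(LINT \<xi>|lborel. g \<xi>) \<le> 2 * R" using R by simp
  have le2: "(LINT \<xi>|lborel. g \<xi>) \<le> sqrt (pi / (2 * t))" if "t \<noteq> 0"
  proof -
    have tp: "t > 0" using t that by simp
    define s where "s = 2 * sqrt t"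
    have s: "s > 0" using tp by (simp add: s_def)
    have ex: "exp (- (s * \<xi>)\<^sup>2 / 2) = exp (- 2 * \<xi>\<^sup>2 * t)" for \<xi>
      using tp by (simp add: s_def power_mult_distrib mult.commute)
    have int: "integrable lborel (\<lambda>\<xi>. exp (- 2 * \<xi>\<^sup>2 * t))" using gaussian_integrable[of s] s unfolding ex by simp
    have "complex_of_real (LINT \<xi>|lborel. exp (- 2 * \<xi>\<^sup>2 * t)) = of_real (2 * pi / s * std_normal_density 0)"
      using gaussian_fourier[OF s, of 0] unfolding ex by simp
    then have "(LINT \<xi>|lborel. exp (- 2 * \<xi>\<^sup>2 * t)) = 2 * pi / s * std_normal_density 0" by (simp only: of_real_eq_iff)
    also have "\<dots> = (2 * pi / sqrt (2 * pi)) / s" by (simp add: std_normal_density_def)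
    also have "2 * pi / sqrt (2 * pi) = sqrt (2 * pi)" by (rule real_div_sqrt) simp
    also have "sqrt (2 * pi) / s = sqrt (2 * pi / s\<^sup>2)" using s by (simp add: real_sqrt_divide)
    also have "2 * pi / s\<^sup>2 = pi / (2 * t)" using tp by (simp add: s_def power_mult_distrib)
    finally have "(LINT \<xi>|lborel. exp (- 2 * \<xi>\<^sup>2 * t)) = sqrt (pi / (2 * t))" .
    then show ?thesis using integral_mono[OF gi int g0(3)] by simp
  qed
  show "(LINT \<xi>|lborel. indicator {- R..R} \<xi> * exp (- 2 * \<xi>\<^sup>2 * t)) \<le> (if t = 0 then 2 * R else min (2 * R) (sqrt (pi / (2 * t))))"
    unfolding g_def[symmetric] using le1 le2 by auto
qed

text \<open>The energy density and \<open>\<bar>y\<bar>\<^sup>2\<close> differ at most by the eigenvalues \<open>1 \<plusminus>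
  coupling\<close>, so the square of the modulus decays at the rate \<open>2 \<mu>(\<xi>)\<close> up to the factor
  \<open>(1 + a) / (1 - a)\<close> with \<open>a = \<bar>coupling \<xi>\<bar>\<close>. For \<open>\<bar>\<xi>\<bar>
  \<le> R\<close> the factor is at most \<open>\<kappa>\<close>, the rate at least \<open>2 \<xi>\<^sup>2\<close>, and
  \<open>\<bar>y\<bar>\<^sup>2\<close> initially at most the square of the \<open>L\<^sup>1\<close> norm divided by
  \<open>2 \<pi>\<close>. For \<open>\<bar>\<xi>\<bar> > R\<close> the factor is at most \<open>3\<close> and the rate
  at least \<open>2 \<mu>(R)\<close>.\<close>

theorem GT_decay:
  assumes u0: "mem_Lp 1 u0" "mem_Lp 2 u0" and v0: "mem_Lp 1 v0" "mem_Lp 2 v0"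
    and sol: "GT_mild_solution (\<lambda>t x. (u t x, v t x)) (\<lambda>x. (u0 x, v0 x))"
    and t: "t \<ge> 0" and R: "0 < R" "R \<le> (sqrt 5 - 1) / 4"
  shows "(Lp_norm 2 (\<lambda>x. (u t x, v t x)))\<^sup>2 \<le>
      (1 + 2 * R + 4 * R\<^sup>2) / (1 - 2 * R + 4 * R\<^sup>2)
        * (if t = 0 then 2 * R else min (2 * R) (sqrt (pi / (2 * t))))
        * (Lp_norm 1 (\<lambda>x. (u0 x, v0 x)))\<^sup>2
      + 3 * exp (- 2 * mu_tilde R * t) * (Lp_norm 2 (\<lambda>x. (u0 x, v0 x)))\<^sup>2"
proof -
  obtain Wu Wv where modes: "telegraph_modes (\<lambda>t. fourier_re (u t)) (\<lambda>t. fourier_re (v t)) Wu Wv (fourier_re u0) (fourier_re v0)"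
    and m: "\<And>t. t \<ge> 0 \<Longrightarrow> mem_Lp 2 (u t)" "\<And>t. t \<ge> 0 \<Longrightarrow> mem_Lp 2 (v t)"
    and init: "AE \<xi> in lborel. fourier_re (u 0) \<xi> = fourier_re u0 \<xi>" "AE \<xi> in lborel. fourier_re (v 0) \<xi> = fourier_re v0 \<xi>"
    by (rule GT_mild_solution_modes[OF sol u0(2) v0(2)]) (rule that, assumption, blast, blast, assumption, assumption)
  interpret telegraph_modes "\<lambda>t. fourier_re (u t)" "\<lambda>t. fourier_re (v t)" Wu Wv "fourier_re u0" "fourier_re v0"
    by (rule modes)
  define G where "G f g \<xi> = (cmod (fourier_re f \<xi>))\<^sup>2 + (cmod (fourier_re g \<xi>))\<^sup>2" for f g \<xi>
  have G: "integrable lborel (G f g)" "(LINT \<xi>|lborel. G f g \<xi>) = (Lp_norm 2 (\<lambda>x. (f x, g x)))\<^sup>2"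
    if "mem_Lp 2 f" "mem_Lp 2 g" for f g
  proof -
    note i = L2_integrable_sq[OF fourier_re_L2[OF that(1)]] L2_integrable_sq[OF fourier_re_L2[OF that(2)]]
    show "integrable lborel (G f g)" unfolding G_def by (intro Bochner_Integration.integrable_add i)
    have "mem_Lp 2 (\<lambda>x. (f x, g x))"
    proof -
      have "(norm (f x, g x))\<^sup>2 = (norm (f x))\<^sup>2 + (norm (g x))\<^sup>2" for x by (simp add: norm_Pair)
      then show ?thesis using that L2_measurable[OF that(1)] L2_measurable[OF that(2)] by (auto simp: mem_Lp_2_iff)
    qed
    from L2_components(5)[OF this]
    show "(LINT \<xi>|lborel. G f g \<xi>) = (Lp_norm 2 (\<lambda>x. (f x, g x)))\<^sup>2"
      unfolding G_def using i by (simp add: L2_norm_sq[symmetric] fourier_re_norm that)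
  qed
  define \<kappa> where "\<kappa> = (1 + 2 * R + 4 * R\<^sup>2) / (1 - 2 * R + 4 * R\<^sup>2)"
  define M where "M = (Lp_norm 1 (\<lambda>x. (u0 x, v0 x)))\<^sup>2"
  have "sqrt 5 \<le> 3" by (rule real_le_lsqrt) auto
  then have Rhalf: "R \<le> 1 / 2" using R(2) by simp
  define A where "A = coupling R"
  have A: "0 \<le> A" "A \<le> 1 / 2"
    using abs_coupling_le_half[of R] R(1) one_plus_sq_pos[of R] by (auto simp: A_def coupling_def)
  have \<kappa>: "\<kappa> = (1 + A) / (1 - A)"
  proof -
    have d: "1 + 4 * R\<^sup>2 > 0" by (rule one_plus_sq_pos)
    have "1 + A = (1 + 2 * R + 4 * R\<^sup>2) / (1 + 4 * R\<^sup>2)" "1 - A = (1 - 2 * R + 4 * R\<^sup>2) / (1 + 4 * R\<^sup>2)"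
      unfolding A_def coupling_def using d by (simp_all add: field_simps)
    then show ?thesis unfolding \<kappa>_def using d by simp
  qed
  have \<kappa>0: "0 \<le> \<kappa>" unfolding \<kappa> using A by simp
  have M0: "0 \<le> M" by (simp add: M_def)
  have pw: "AE \<xi> in lborel. G (u t) (v t) \<xi> \<le> \<kappa> * (M / (2 * pi)) * (indicator {- R..R} \<xi> * exp (- 2 * \<xi>\<^sup>2 * t))
      + 3 * exp (- 2 * mu_tilde R * t) * G u0 v0 \<xi>"
    using energy_density_decay[OF t] init fourier_pair_bound[OF u0 v0]
  proof eventually_elim
    case (elim \<xi>)
    define a where "a = \<bar>coupling \<xi>\<bar>"
    have a: "0 \<le> a" "a \<le> 1 / 2" using abs_coupling_le_half by (auto simp: a_def)
    have G0: "0 \<le> G u0 v0 \<xi>" by (simp add: G_def)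
    have "(1 - a) * G (u t) (v t) \<xi> \<le> energy_density \<xi> (fourier_re (u t) \<xi>) (fourier_re (v t) \<xi>)"
      unfolding a_def G_def by (rule energy_density_bounds)
    also have "\<dots> \<le> exp (- 2 * mu_tilde \<xi> * t) * energy_density \<xi> (fourier_re u0 \<xi>) (fourier_re v0 \<xi>)"
      using elim(1) unfolding elim(2,3) .
    also have "\<dots> \<le> exp (- 2 * mu_tilde \<xi> * t) * ((1 + a) * G u0 v0 \<xi>)"
      unfolding a_def G_def by (intro mult_left_mono energy_density_bounds) simp
    finally have "(1 - a) * G (u t) (v t) \<xi> \<le> exp (- 2 * mu_tilde \<xi> * t) * ((1 + a) * G u0 v0 \<xi>)" .
    then have main: "G (u t) (v t) \<xi> \<le> (1 + a) / (1 - a) * (exp (- 2 * mu_tilde \<xi> * t) * G u0 v0 \<xi>)"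
      using a by (simp add: field_simps)
    show ?case
    proof (cases "\<bar>\<xi>\<bar> \<le> R")
      case True
      have aA: "a \<le> A" unfolding a_def A_def by (rule coupling_mono[OF True Rhalf])
      have "(1 + a) / (1 - a) \<le> \<kappa>" unfolding \<kappa> using aA a A by (intro frac_le) auto
      moreover have "exp (- 2 * mu_tilde \<xi> * t) * G u0 v0 \<xi> \<le> exp (- 2 * \<xi>\<^sup>2 * t) * (M / (2 * pi))"
      proof (rule mult_mono)
        have "\<xi>\<^sup>2 * t \<le> mu_tilde \<xi> * t" using mu_tilde_ge_square[of \<xi>] True R(2) t by (intro mult_right_mono) auto
        then show "exp (- 2 * mu_tilde \<xi> * t) \<le> exp (- 2 * \<xi>\<^sup>2 * t)" by simp
        show "G u0 v0 \<xi> \<le> M / (2 * pi)" using elim(4) by (simp add: G_def M_def)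
      qed (use G0 in auto)
      ultimately have "(1 + a) / (1 - a) * (exp (- 2 * mu_tilde \<xi> * t) * G u0 v0 \<xi>) \<le> \<kappa> * (exp (- 2 * \<xi>\<^sup>2 * t) * (M / (2 * pi)))"
        by (rule mult_mono) (rule \<kappa>0, rule mult_nonneg_nonneg[OF exp_ge_zero G0])
      also have "\<dots> = \<kappa> * (M / (2 * pi)) * (indicator {- R..R} \<xi> * exp (- 2 * \<xi>\<^sup>2 * t))"
        using True by (simp add: abs_le_iff)
      finally show ?thesis using main G0 by (intro order_trans[OF main] add_increasing2) auto
    next
      case False
      have "(1 + a) / (1 - a) \<le> 3" using a by (simp add: divide_le_eq)
      moreover have "exp (- 2 * mu_tilde \<xi> * t) * G u0 v0 \<xi> \<le> exp (- 2 * mu_tilde R * t) * G u0 v0 \<xi>"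
      proof (rule mult_right_mono[OF _ G0])
        have "mu_tilde R * t \<le> mu_tilde \<xi> * t" using mu_tilde_mono[of R \<xi>] False R(1) t by (intro mult_right_mono) auto
        then show "exp (- 2 * mu_tilde \<xi> * t) \<le> exp (- 2 * mu_tilde R * t)" by simp
      qed
      ultimately have "(1 + a) / (1 - a) * (exp (- 2 * mu_tilde \<xi> * t) * G u0 v0 \<xi>) \<le> 3 * (exp (- 2 * mu_tilde R * t) * G u0 v0 \<xi>)"
        by (rule mult_mono) (simp, rule mult_nonneg_nonneg[OF exp_ge_zero G0])
      then have "G (u t) (v t) \<xi> \<le> 3 * exp (- 2 * mu_tilde R * t) * G u0 v0 \<xi>" using main by simp
      moreover have "0 \<le> \<kappa> * (M / (2 * pi)) * (indicator {- R..R} \<xi> * exp (- 2 * \<xi>\<^sup>2 * t))"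
        using \<kappa>0 M0 by (intro mult_nonneg_nonneg divide_nonneg_nonneg) auto
      ultimately show ?thesis by linarith
    qed
  qed
  define J where "J = (LINT \<xi>|lborel. indicator {- R..R} \<xi> * exp (- 2 * \<xi>\<^sup>2 * t))"
  define B where "B = (if t = 0 then 2 * R else min (2 * R) (sqrt (pi / (2 * t))))"
  note g = gaussian_interval_integral[OF R(1) t, folded J_def B_def]
  have "(Lp_norm 2 (\<lambda>x. (u t x, v t x)))\<^sup>2 = (LINT \<xi>|lborel. G (u t) (v t) \<xi>)"
    by (rule G(2)[OF m(1)[OF t] m(2)[OF t], symmetric])
  also have "\<dots> \<le> (LINT \<xi>|lborel. \<kappa> * (M / (2 * pi)) * (indicator {- R..R} \<xi> * exp (- 2 * \<xi>\<^sup>2 * t))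
      + 3 * exp (- 2 * mu_tilde R * t) * G u0 v0 \<xi>)"
    by (rule integral_mono_AE[OF _ _ pw]) (intro G m t Bochner_Integration.integrable_add integrable_mult_right g(1) u0 v0)+
  also have "\<dots> = \<kappa> * (M / (2 * pi)) * J + 3 * exp (- 2 * mu_tilde R * t) * (Lp_norm 2 (\<lambda>x. (u0 x, v0 x)))\<^sup>2"
    unfolding J_def G(2)[OF u0(2) v0(2), symmetric]
    by (subst Bochner_Integration.integral_add)
       (intro integrable_mult_right g(1) G(1) u0 v0, intro integrable_mult_right g(1) G(1) u0 v0, simp only: integral_mult_right_zero)
  also have "\<kappa> * (M / (2 * pi)) * J \<le> \<kappa> * M * B"
  proof -
    \<comment> \<open>The normalization of the transform leaves a factor \<open>1 / (2 \<pi>)\<close> to spare.\<close>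
    have "M / (2 * pi) \<le> M" using M0 pi_ge_two by (simp add: divide_le_eq mult_left_mono[of 1 "2 * pi" M, simplified])
    then have "(M / (2 * pi)) * J \<le> M * B" using g(2,3) M0 by (intro mult_mono) auto
    then have "\<kappa> * ((M / (2 * pi)) * J) \<le> \<kappa> * (M * B)" using \<kappa>0 by (rule mult_left_mono)
    then show ?thesis by (simp only: mult.assoc)
  qed
  finally show ?thesis unfolding \<kappa>_def[symmetric] B_def[symmetric] M_def[symmetric] by (simp add: mult.commute mult.left_commute)
qed

theorem proposition6:
  shows
    "(\<forall>u v :: real \<Rightarrow> real. mem_Lp 2 u \<and> mem_Lp 2 v \<longrightarrow>
        H3 u v = of_real ((Lp_norm 2 u)\<^sup>2) + of_real ((Lp_norm 2 v)\<^sup>2)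
          - 4 * (LINT x|lborel. of_real (u x) *
              fourier_multiplier (\<lambda>\<xi>. \<i> * of_real \<xi> / of_real (1 + 4 * \<xi>\<^sup>2))
                (\<lambda>x. of_real (v x)) x))
     \<and>
     (\<forall>(u :: real \<Rightarrow> real \<Rightarrow> real) (v :: real \<Rightarrow> real \<Rightarrow> real) (u0 :: real \<Rightarrow> real) (v0 :: real \<Rightarrow> real).
        mem_Lp 1 u0 \<and> mem_Lp 2 u0 \<and> mem_Lp 1 v0 \<and> mem_Lp 2 v0 \<and>
        GT_mild_solution (\<lambda>t x. (u t x, v t x)) (\<lambda>x. (u0 x, v0 x)) \<longrightarrow>
        (\<forall>t\<ge>0. (Lp_norm 2 (\<lambda>x. (u t x, v t x)))\<^sup>2 \<le>
           (INF R\<in>{0<..(sqrt 5 - 1) / 4}.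
              (1 + 2 * R + 4 * R\<^sup>2) / (1 - 2 * R + 4 * R\<^sup>2)
                * (if t = 0 then 2 * R else min (2 * R) (sqrt (pi / (2 * t))))
                * (Lp_norm 1 (\<lambda>x. (u0 x, v0 x)))\<^sup>2
              + 3 * exp (- 2 * mu_tilde R * t) * (Lp_norm 2 (\<lambda>x. (u0 x, v0 x)))\<^sup>2)))"
proof (intro conjI allI impI; (elim conjE)?)
  fix u v :: "real \<Rightarrow> real"
  assume "mem_Lp 2 u" "mem_Lp 2 v"
  from H3_physical_space[OF this]
  show "H3 u v = of_real ((Lp_norm 2 u)\<^sup>2) + of_real ((Lp_norm 2 v)\<^sup>2)
          - 4 * (LINT x|lborel. of_real (u x) *
              fourier_multiplier (\<lambda>\<xi>. \<i> * of_real \<xi> / of_real (1 + 4 * \<xi>\<^sup>2))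
                (\<lambda>x. of_real (v x)) x)"
    unfolding smoothing_symbol_def[abs_def] .
next
  fix u v :: "real \<Rightarrow> real \<Rightarrow> real" and u0 v0 :: "real \<Rightarrow> real" and t :: real
  assume a: "mem_Lp 1 u0" "mem_Lp 2 u0" "mem_Lp 1 v0" "mem_Lp 2 v0"
    "GT_mild_solution (\<lambda>t x. (u t x, v t x)) (\<lambda>x. (u0 x, v0 x))" "0 \<le> t"
  have "1 < sqrt 5" by (rule real_less_rsqrt) simp
  then have "{0<..(sqrt 5 - 1) / 4} \<noteq> {}" by simp
  then show "(Lp_norm 2 (\<lambda>x. (u t x, v t x)))\<^sup>2 \<le>
           (INF R\<in>{0<..(sqrt 5 - 1) / 4}.
              (1 + 2 * R + 4 * R\<^sup>2) / (1 - 2 * R + 4 * R\<^sup>2)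
                * (if t = 0 then 2 * R else min (2 * R) (sqrt (pi / (2 * t))))
                * (Lp_norm 1 (\<lambda>x. (u0 x, v0 x)))\<^sup>2
              + 3 * exp (- 2 * mu_tilde R * t) * (Lp_norm 2 (\<lambda>x. (u0 x, v0 x)))\<^sup>2)"
    by (rule cINF_greatest) (use GT_decay[OF a] in auto)
qed

end
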